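(* For every probability measure $\nu$ on $\mathbb{T}^p\times\mathbb{T}^d$, every $i\in\{1,\dots,d\}$ and every $f\in H$, there exists at least one minimizer in $\Sigma_i$ of the optimization problem $$\min_{g\in\Sigma_i}\mathcal{J}_\nu(f+g).$$
   Context: $\mathbb{T}=\mathbb{R}/\mathbb{Z}$, $D=p+d\ge 3$ with integers $p,d\ge 1$, $\mathbb{T}^D=\mathbb{T}^p\times\mathbb{T}^d$; points are written $(q,y)$ with $q\in\mathbb{T}^p$ and $y\in\mathbb{T}^d$. Standing assumptions: $V\in\mathcal{C}^\infty(\mathbb{T}^D)$, $\lambda\ge 0$, and $K\in\mathcal{C}^\infty(\mathbb{T}^d\times\mathbb{T}^d,\mathbb{R}_+)$ satisfies $\int_{\mathbb{T}^d}K(y,z)\,dz=1$ and $K(y,z)=K(z,y)$ for all $y,z\in\mathbb{T}^d$; moreover either $K>0$ everywhere or $\lambda>0$. $H=\{f\in H^1(\mathbb{T}^d):\int_{\mathbb{T}^d}f(z)\,dz=0\}$. For a probability measure $\nu$ on $\mathbb{T}^p\times\mathbb{T}^d$ and $f\in H$, $$\mathcal{J}_\nu(f)=\int_{\mathbb{T}^p\times\mathbb{T}^d\times\mathbb{T}^d}|\nabla_yV(q,y)-\nabla f(z)|^2K(y,z)\,dz\,d\nu(q,y)+\lambda\int_{\mathbb{T}^d}|\nabla f(z)|^2\,dz,$$ where $\nabla_yV$ is the gradient of $V$ in its last $d$ variables. For $r_1,\dots,r_d\in H^1(\mathbb{T})$, $\bigotimes_{j=1}^dr_j$ is the function $z\mapsto\prod_{j=1}^dr_j(z_j)$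 on $\mathbb{T}^d$. For $i\in\{1,\dots,d\}$, $$\Sigma_i=\Big\{g\in H:\ g=\bigotimes_{j=1}^dr_j\text{ with }r_j\in H^1(\mathbb{T})\text{ for all }j\in\{1,\dots,d\}\text{ and }\int_{\mathbb{T}}r_i(z_i)\,dz_i=0\Big\}.$$ *)

theory Defs
  imports "HOL-Probability.Probability_Measure"
begin

section \<open>The torus\<close>

quotient_type circle = real / "\<lambda>x y. x - y \<in> (\<int> :: real set)"
proof (rule equivpI)
  show "reflp (\<lambda>x y. x - y \<in> (\<int> :: real set))"
    by (simp add: reflp_def)
  show "symp (\<lambda>x y. x - y \<in> (\<int> :: real set))"
    by (metis (no_types, lifting) sympI Ints_minus minus_diff_eq)
  show "transp (\<lambda>x y. x - y \<in> (\<int> :: real set))"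
  proof (rule transpI)
    fix x y z :: real
    assume "x - y \<in> \<int>" "y - z \<in> \<int>"
    then have "(x - y) + (y - z) \<in> \<int>" by (rule Ints_add)
    then show "x - z \<in> \<int>" by simp
  qed
qed

instantiation circle :: topological_space
begin

definition open_circle :: "circle set \<Rightarrow> bool"
  where "open_circle U \<longleftrightarrow> open (abs_circle -` U)"

instance
  by standard (auto simp: open_circle_def vimage_Union intro: open_Int)

end

text \<open>
  The torus \<open>\<real>\<^sup>n / \<int>\<^sup>n\<close> is the type \<open>circle ^ 'n\<close>, with the product topology; the circle
  itself is identified with \<open>circle ^ 1\<close> where a torus is needed.
\<close>

definition to_torus :: "real ^ 'n \<Rightarrow> circle ^ 'n::finite"
  where "to_torus x = (\<chi> i. abs_circle (x $ i))"

text \<open>The normalised Lebesgue (Haar) measure, pushed forward from a fundamental domain.\<close>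

definition torus_measure :: "(circle ^ 'n::finite) measure"
  where "torus_measure =
    distr (restrict_space lborel {x. \<forall>i. 0 \<le> x $ i \<and> x $ i < 1}) borel to_torus"

section \<open>Smooth functions and gradients\<close>

primrec C_k :: "nat \<Rightarrow> ('a::euclidean_space \<Rightarrow> real) \<Rightarrow> bool" where
  "C_k 0 f \<longleftrightarrow> continuous_on UNIV f"
| "C_k (Suc k) f \<longleftrightarrow>
     f differentiable_on UNIV \<and> (\<forall>b\<in>Basis. C_k k (\<lambda>x. frechet_derivative f (at x) b))"

definition C_infinity :: "('a::euclidean_space \<Rightarrow> real) \<Rightarrow> bool"
  where "C_infinity f \<longleftrightarrow> (\<forall>k. C_k k f)"

text \<open>A function on a torus is smooth iff its periodic lift is.\<close>

definition torus_smooth :: "(circle ^ 'n::finite \<Rightarrow> real) \<Rightarrow> bool"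
  where "torus_smooth f \<longleftrightarrow> C_infinity (\<lambda>x. f (to_torus x))"

definition torus_smooth2 :: "((circle ^ 'm::finite) \<times> (circle ^ 'n::finite) \<Rightarrow> real) \<Rightarrow> bool"
  where "torus_smooth2 f \<longleftrightarrow> C_infinity (\<lambda>(x, y). f (to_torus x, to_torus y))"

text \<open>By periodicity of the lift, the choice of the preimage of \<open>z\<close> is irrelevant.\<close>

definition torus_grad :: "(circle ^ 'n::finite \<Rightarrow> real) \<Rightarrow> circle ^ 'n \<Rightarrow> real ^ 'n"
  where "torus_grad f z =
    (\<chi> i. frechet_derivative (\<lambda>x. f (to_torus x)) (at (inv to_torus z)) (axis i 1))"

section \<open>Sobolev spaces\<close>

text \<open>
  Elements of \<open>L\<^sup>2\<close> and \<open>H\<^sup>1\<close> are represented by Borel functions; two of them represent the same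
  element iff they agree almost everywhere.
\<close>

definition square_integrable :: "(circle ^ 'n::finite \<Rightarrow> 'b::real_normed_vector) \<Rightarrow> bool"
  where "square_integrable f \<longleftrightarrow>
    f \<in> borel_measurable torus_measure \<and> integrable torus_measure (\<lambda>z. (norm (f z))\<^sup>2)"

definition is_weak_grad ::
    "(circle ^ 'n::finite \<Rightarrow> real) \<Rightarrow> (circle ^ 'n \<Rightarrow> real ^ 'n) \<Rightarrow> bool"
  where "is_weak_grad f g \<longleftrightarrow> square_integrable g \<and>
    (\<forall>\<phi> i. torus_smooth \<phi> \<longrightarrow>
      (LINT z|torus_measure. f z * torus_grad \<phi> z $ i) =
        - (LINT z|torus_measure. g z $ i * \<phi> z))"

definition weak_grad :: "(circle ^ 'n::finite \<Rightarrow> real) \<Rightarrow> circle ^ 'n \<Rightarrow> real ^ 'n"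
  where "weak_grad f = (SOME g. is_weak_grad f g)"

definition H1 :: "(circle ^ 'n::finite \<Rightarrow> real) set"
  where "H1 = {f. square_integrable f \<and> (\<exists>g. is_weak_grad f g)}"

definition H1_zero_mean :: "(circle ^ 'n::finite \<Rightarrow> real) set"
  where "H1_zero_mean = {f \<in> H1. (LINT z|torus_measure. f z) = 0}"

definition Tensor :: "'n \<Rightarrow> (circle ^ 'n::finite \<Rightarrow> real) set"
  where "Tensor i = {g \<in> H1_zero_mean.
    \<exists>r :: 'n \<Rightarrow> circle \<Rightarrow> real.
      (AE z in torus_measure. g z = (\<Prod>j\<in>UNIV. r j (z $ j))) \<and>
      (\<forall>j. (\<lambda>t :: circle ^ 1. r j (t $ 1)) \<in> H1) \<and>
      (LINT t|(torus_measure :: (circle ^ 1) measure). r i (t $ 1)) = 0}"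

section \<open>The functional\<close>

definition J_functional ::
    "((circle ^ 'p::finite) \<times> (circle ^ 'd::finite) \<Rightarrow> real) \<Rightarrow>
     ((circle ^ 'd) \<times> (circle ^ 'd) \<Rightarrow> real) \<Rightarrow> real \<Rightarrow>
     ((circle ^ 'p) \<times> (circle ^ 'd)) measure \<Rightarrow> (circle ^ 'd \<Rightarrow> real) \<Rightarrow> real"
  where "J_functional V K lam \<nu> f =
    (LINT ((q, y), z)|(\<nu> \<Otimes>\<^sub>M torus_measure).
        (norm (torus_grad (\<lambda>y'. V (q, y')) y - weak_grad f z))\<^sup>2 * K (y, z)) +
    lam * (LINT z|torus_measure. (norm (weak_grad f z))\<^sup>2)"

end

theory Submission
  imports Defs "HOL-Probability.Infinite_Product_Measure" "HOL-Complex_Analysis.Great_Picard"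
begin

text \<open>
  The functional depends on a function only through its weak gradient \<open>w\<close>, as the quadratic
  expression \<open>\<integral>\<integral> |W - w|\<^sup>2 K + \<lambda> \<integral> |w|\<^sup>2\<close> with \<open>W = \<nabla>\<^sub>y V\<close>. The weight \<open>K + \<lambda>\<close> is bounded below by
  a positive constant, either by compactness of the torus or because \<open>\<lambda> > 0\<close>, so this energy is
  coercive and uniformly convex in \<open>L\<^sup>2\<close>. The minimizer is found by the direct method, and two
  properties make the method work.

  \<^item> Lower semicontinuity (\<open>weak_grad_relaxation\<close>). If functions of energy close to \<open>m\<close> come
    arbitrarily close to \<open>u\<close> in \<open>L\<^sup>2\<close>, then \<open>u\<close> has a weak gradient of energy at most \<open>m\<close>. Weak
    compactness is avoided: the functions that are close to \<open>u\<close> and have energy at most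
    \<open>m + \<epsilon>\<close> form a convex set, and by uniform convexity almost minimal elements of these sets have
    gradients that converge strongly.

  \<^item> Compactness of tensor products (\<open>Tensor_limit\<close>). For \<open>g = \<Otimes> r\<^sub>j\<close> the \<open>j\<close>-th component of the
    gradient has the \<open>L\<^sup>2\<close> norm \<open>\<parallel>r\<^sub>j'\<parallel> \<Prod>\<^bsub>k\<noteq>j\<^esub> \<parallel>r\<^sub>k\<parallel>\<close> (\<open>is_weak_grad_tensor\<close>). As long as \<open>\<parallel>g\<parallel>\<close> stays
    away from zero, the factors can be normalised so that all \<open>\<parallel>r\<^sub>j'\<parallel>\<close> are bounded
    (\<open>Tensor_Holder_factors\<close>). Functions of one variable with square integrable derivative are
    Hoelder continuous of exponent 1/2 (\<open>H1_circle_Holder\<close>), so by the Arzela-Ascoli theorem all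
    factors converge uniformly along a subsequence. The limit of the products is the product of the
    limits, hence again a tensor product, and the condition of zero mean survives.

  In a minimizing sequence either \<open>\<parallel>g\<parallel>\<close> becomes arbitrarily small, and then \<open>g = 0\<close> is a minimizer
  by lower semicontinuity, or it stays away from zero, and then a limit of tensor products is one.
\<close>

section \<open>Coordinates and Haar measure on the torus\<close>

lemma abs_circle_eq_iff: "abs_circle x = abs_circle y \<longleftrightarrow> x - y \<in> \<int>"
  using circle.abs_eq_iff by blast

lemma continuous_abs_circle [continuous_intros]: "continuous_on UNIV abs_circle"
  by (simp add: continuous_on_open_vimage open_circle_def)

lemma measurable_abs_circle [measurable]: "abs_circle \<in> borel_measurable borel"
  by (intro borel_measurable_continuous_onI continuous_abs_circle)

text \<open>
  A section of the quotient map. It is Borel measurable, so a function on the torus can be recovered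
  measurably from its periodic lift.
\<close>

definition circle_coord :: "circle \<Rightarrow> real" where
  "circle_coord t = frac (rep_circle t)"

lemma abs_circle_coord [simp]: "abs_circle (circle_coord t) = t"
proof -
  have "abs_circle (circle_coord t) = abs_circle (rep_circle t)"
    by (simp add: abs_circle_eq_iff circle_coord_def frac_def)
  also have "\<dots> = t"
    by (metis Quotient3_abs_rep Quotient3_circle)
  finally show ?thesis .
qed

lemma circle_coord_bounds: "0 \<le> circle_coord t" "circle_coord t < 1"
  by (simp_all add: circle_coord_def frac_ge_0 frac_lt_1)

lemma circle_coord_abs: "0 \<le> x \<Longrightarrow> x < 1 \<Longrightarrow> circle_coord (abs_circle x) = x"
proof -
  assume x: "0 \<le> x" "x < 1"
  have "abs_circle (circle_coord (abs_circle x)) = abs_circle x" by simp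
  then have "circle_coord (abs_circle x) - x \<in> \<int>" by (simp only: abs_circle_eq_iff)
  moreover have "\<bar>circle_coord (abs_circle x) - x\<bar> < 1"
    using circle_coord_bounds[of "abs_circle x"] x by linarith
  ultimately show ?thesis
    by (metis Ints_cases abs_zero eq_iff_diff_eq_0 of_int_abs of_int_less_1_iff of_int_0 zabs_less_one_iff)
qed

text \<open>
  An initial segment of \<open>[0, 1)\<close> corresponds to the point \<open>0\<close>, which is closed, together with an
  arc, which is open because its preimage is a union of translated intervals.
\<close>

lemma measurable_circle_coord [measurable]: "circle_coord \<in> borel_measurable borel"
proof (rule borel_measurableI_less)
  fix a :: real
  have "{t. circle_coord t < a} \<in> sets borel"
  proof (cases "a \<le> 0")
    case True
    then have "{t. circle_coord t < a} = {}"
      using circle_coord_bounds(1) by (auto simp: not_less intro: order_trans)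
    then show ?thesis by simp
  next
    case False
    define b where "b = min a 1"
    have b: "0 < b" "b \<le> 1" using False by (auto simp: b_def)
    have eq: "{t. circle_coord t < a} = abs_circle ` {0<..<b} \<union> {abs_circle 0}"
    proof (intro set_eqI iffI)
      fix t assume "t \<in> {t. circle_coord t < a}"
      then have "circle_coord t < b" using circle_coord_bounds(2)[of t] by (simp add: b_def)
      then show "t \<in> abs_circle ` {0<..<b} \<union> {abs_circle 0}"
        using circle_coord_bounds(1)[of t] abs_circle_coord[of t]
        by (cases "circle_coord t = 0") (auto intro!: image_eqI[of _ _ "circle_coord t"])
    next
      fix t assume "t \<in> abs_circle ` {0<..<b} \<union> {abs_circle 0}"
      then show "t \<in> {t. circle_coord t < a}"
        using b by (auto simp: circle_coord_abs b_def)
    qed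
    have "abs_circle -` (abs_circle ` {0<..<b}) = (\<Union>k::int. {of_int k<..<of_int k + b})"
    proof (intro set_eqI iffI)
      fix x assume "x \<in> abs_circle -` (abs_circle ` {0<..<b})"
      then obtain y where y: "y \<in> {0<..<b}" "abs_circle x = abs_circle y" by auto
      then obtain k where "x - y = of_int k" by (auto simp: abs_circle_eq_iff elim: Ints_cases)
      with y show "x \<in> (\<Union>k::int. {of_int k<..<of_int k + b})"
        by (auto intro!: exI[of _ k])
    next
      fix x assume "x \<in> (\<Union>k::int. {of_int k<..<of_int k + b})"
      then obtain k :: int where k: "of_int k < x" "x < of_int k + b" by auto
      then have "abs_circle x = abs_circle (x - of_int k)" "x - of_int k \<in> {0<..<b}"
        by (auto simp: abs_circle_eq_iff)
      then show "x \<in> abs_circle -` (abs_circle ` {0<..<b})" by blast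
    qed
    then have "open (abs_circle ` {0<..<b})" by (auto simp: open_circle_def)
    moreover have "closed {abs_circle 0}"
    proof -
      have "abs_circle -` (- {abs_circle 0}) = - (\<int>::real set)"
        by (auto simp: abs_circle_eq_iff)
      moreover have "open (- (\<int>::real set))" by (simp add: closed_Ints open_Compl)
      ultimately show ?thesis by (simp add: closed_def open_circle_def)
    qed
    ultimately show ?thesis unfolding eq by (intro sets.Un) auto
  qed
  then show "{x \<in> space borel. circle_coord x < a} \<in> sets borel" by simp
qed

definition torus_coord :: "circle ^ 'n::finite \<Rightarrow> real ^ 'n" where
  "torus_coord z = (\<chi> i. circle_coord (z $ i))"

lemma to_torus_coord [simp]: "to_torus (torus_coord z) = z"
  by (simp add: to_torus_def torus_coord_def vec_eq_iff)

lemma torus_coord_bounds: "0 \<le> torus_coord z $ i" "torus_coord z $ i < 1"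
  by (simp_all add: torus_coord_def circle_coord_bounds)

lemma surj_to_torus: "surj to_torus"
  by (metis surjI to_torus_coord)

lemma to_torus_eq_iff: "to_torus x = to_torus y \<longleftrightarrow> (\<forall>i. x $ i - y $ i \<in> \<int>)"
  by (simp add: to_torus_def vec_eq_iff abs_circle_eq_iff)

lemma continuous_vec_lambda:
  fixes f :: "'a::topological_space \<Rightarrow> 'n::finite \<Rightarrow> 'b::topological_space"
  assumes "\<And>i. continuous_on S (\<lambda>x. f x i)"
  shows "continuous_on S (\<lambda>x. \<chi> i. f x i)"
  using assms unfolding continuous_on_def by (auto intro: vec_tendstoI)

lemma continuous_to_torus [continuous_intros]: "continuous_on UNIV to_torus"
  unfolding to_torus_def
  by (intro continuous_vec_lambda continuous_on_compose2[OF continuous_abs_circle] continuous_intros) auto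

lemma measurable_to_torus [measurable]: "to_torus \<in> borel_measurable borel"
  by (intro borel_measurable_continuous_onI continuous_to_torus)

lemma measurable_circle_vec_nth [measurable]:
  "(\<lambda>z :: 'a::topological_space ^ 'n::finite. z $ i) \<in> borel_measurable borel"
  by (intro borel_measurable_continuous_onI continuous_intros)

lemma borel_measurable_vec_lambda:
  fixes f :: "'a \<Rightarrow> 'n::finite \<Rightarrow> real"
  assumes [measurable]: "\<And>i. (\<lambda>x. f x i) \<in> borel_measurable M"
  shows "(\<lambda>x. \<chi> i. f x i) \<in> borel_measurable M"
proof -
  have "(\<lambda>x. \<chi> i. f x i) = (\<lambda>x. \<Sum>i\<in>UNIV. f x i *\<^sub>R axis i 1)"
    by (auto simp: vec_eq_iff axis_def if_distrib[of "\<lambda>y. _ * y"] cong: if_cong)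
  then show ?thesis by simp
qed

lemma measurable_torus_coord [measurable]: "torus_coord \<in> borel_measurable borel"
  unfolding torus_coord_def by (intro borel_measurable_vec_lambda) measurable

lemma borel_measurable_on_torus:
  fixes g :: "circle ^ 'n::finite \<Rightarrow> 'b::topological_space"
  assumes "continuous_on UNIV (\<lambda>x. g (to_torus x))"
  shows "g \<in> borel_measurable borel"
proof -
  have [measurable]: "(\<lambda>x. g (to_torus x)) \<in> borel_measurable borel"
    by (intro borel_measurable_continuous_onI assms)
  have "(\<lambda>z. g (to_torus (torus_coord z))) \<in> borel_measurable borel" by measurable
  then show ?thesis by simp
qed

text \<open>
  Lebesgue measure on \<open>[0, 1)\<close>, taken as a density and not as a restriction: its space is the whole
  line, so that every function from the index set to the reals is a point of the product space.
\<close>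

definition unit_measure :: "real measure" where
  "unit_measure = density lborel (indicator {0..<1})"

lemma sets_unit_measure [simp, measurable_cong]: "sets unit_measure = sets borel"
  by (simp add: unit_measure_def)

lemma space_unit_measure [simp]: "space unit_measure = UNIV"
  by (simp add: unit_measure_def)

lemma emeasure_unit_measure: "A \<in> sets borel \<Longrightarrow> emeasure unit_measure A = emeasure lborel (A \<inter> {0..<1})"
  by (simp add: unit_measure_def emeasure_density indicator_inter_arith[symmetric] Int_commute)

interpretation unit_measure: prob_space unit_measure
  by standard (simp add: emeasure_unit_measure)

lemma AE_unit_measure: "AE t in unit_measure. 0 \<le> t \<and> t < 1"
  unfolding unit_measure_def by (subst AE_density) (auto simp: indicator_def)

definition cube_measure :: "('n::finite \<Rightarrow> real) measure" where
  "cube_measure = (\<Pi>\<^sub>M j\<in>UNIV. unit_measure)"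

lemma sets_cube_measure [simp, measurable_cong]: "sets cube_measure = sets (\<Pi>\<^sub>M j\<in>UNIV. borel)"
  unfolding cube_measure_def by (intro sets_PiM_cong) auto

lemma space_cube_measure [simp]: "space cube_measure = UNIV"
  by (simp add: cube_measure_def space_PiM)

interpretation cube: product_prob_space "\<lambda>_. unit_measure" "UNIV :: 'n::finite set" ..

interpretation cube_measure: prob_space cube_measure
  unfolding cube_measure_def by (rule cube.P.prob_space_axioms)

lemma measurable_vec_lambda_PiM [measurable]:
  "(\<lambda>x. \<chi> j. x j) \<in> borel_measurable (\<Pi>\<^sub>M j\<in>(UNIV::'n::finite set). (borel :: real measure))"
  by (intro borel_measurable_vec_lambda) measurable

lemma lborel_vec: "(lborel :: (real ^ 'n::finite) measure) = distr (\<Pi>\<^sub>M j\<in>UNIV. lborel) borel (\<lambda>x. \<chi> j. x j)"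
proof (rule lborel_eqI)
  interpret product_sigma_finite "\<lambda>_::'n. lborel :: real measure" ..
  fix l u :: "real ^ 'n"
  assume le: "\<And>b. b \<in> Basis \<Longrightarrow> l \<bullet> b \<le> u \<bullet> b"
  have le': "l $ i \<le> u $ i" for i
    using le[of "axis i 1"] by (simp add: axis_in_Basis_iff inner_axis)
  have "emeasure (distr (\<Pi>\<^sub>M j\<in>UNIV. lborel) borel (\<lambda>x. \<chi> j. x j)) (box l u)
      = emeasure (\<Pi>\<^sub>M j\<in>UNIV. lborel) (\<Pi>\<^sub>E j\<in>UNIV. {l $ j<..<u $ j})"
    by (subst emeasure_distr) (auto intro!: arg_cong2[where f=emeasure] simp: mem_box_cart space_PiM PiE_iff)
  also have "\<dots> = (\<Prod>j\<in>UNIV. ennreal (u $ j - l $ j))"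
    by (subst emeasure_PiM) (auto simp: le')
  also have "\<dots> = ennreal (\<Prod>j\<in>UNIV. u $ j - l $ j)"
    by (intro prod_ennreal) (simp add: le')
  also have "(\<Prod>j\<in>UNIV. u $ j - l $ j) = (\<Prod>b\<in>Basis. (u - l) \<bullet> b)"
    unfolding Basis_vec_def
    by (auto simp: axis_eq_axis inner_axis prod.UNION_disjoint intro!: prod.reindex_bij_betw[symmetric] prod.cong 
       simp flip: prod.reindex)
  finally show "emeasure (distr (\<Pi>\<^sub>M j\<in>UNIV. lborel) borel (\<lambda>x. \<chi> j. x j)) (box l u)
      = ennreal (\<Prod>b\<in>Basis. (u - l) \<bullet> b)" .
qed simp

text \<open>
  Lebesgue measure of a product set is the product of the measures of its sides, so the restriction of
  Lebesgue measure to the unit cube, read in coordinates, is the product measure. Integrals over the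
  torus can then be computed by Fubini's theorem.
\<close>

lemma torus_measure_cube:
  "torus_measure = distr cube_measure borel (\<lambda>x. to_torus (\<chi> j::'n::finite. x j))"
proof -
  define Q where "Q = {x :: real ^ 'n. \<forall>i. 0 \<le> x $ i \<and> x $ i < 1}"
  define P where "P = distr (restrict_space lborel Q) (\<Pi>\<^sub>M j\<in>UNIV. unit_measure) (\<lambda>x j. x $ j)"
  have Q[measurable]: "Q \<in> sets borel"
    unfolding Q_def by measurable
  have coord[measurable]: "(\<lambda>x (j::'n). (x :: real ^ 'n) $ j) \<in> borel \<rightarrow>\<^sub>M (\<Pi>\<^sub>M j\<in>UNIV. unit_measure)"
    by (intro measurable_PiM_single') (auto simp: space_PiM)
  have coord'[measurable]:
    "(\<lambda>x (j::'n). (x :: real ^ 'n) $ j) \<in> restrict_space lborel Q \<rightarrow>\<^sub>M (\<Pi>\<^sub>M j\<in>UNIV. unit_measure)"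
    by (intro measurable_restrict_space1) simp
  have "P = (\<Pi>\<^sub>M j\<in>UNIV. unit_measure)"
    unfolding P_def
  proof (rule cube.PiM_eqI)
    fix A :: "'n \<Rightarrow> real set"
    assume A: "\<And>i. i \<in> UNIV \<Longrightarrow> A i \<in> sets unit_measure"
    have [measurable]: "A i \<in> sets borel" for i using A by simp
    interpret L: product_sigma_finite "\<lambda>_::'n. lborel :: real measure" ..
    have "emeasure (distr (restrict_space lborel Q) (\<Pi>\<^sub>M j\<in>UNIV. unit_measure) (\<lambda>x j. x $ j)) (Pi\<^sub>E UNIV A)
        = emeasure (restrict_space lborel Q) ((\<lambda>x j. x $ j) -` Pi\<^sub>E UNIV A \<inter> space (restrict_space lborel Q))"
      by (intro emeasure_distr coord') auto
    also have "\<dots> = emeasure lborel ((\<lambda>x j. x $ j) -` Pi\<^sub>E UNIV A \<inter> space (restrict_space lborel Q))"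
      by (intro emeasure_restrict_space) (auto simp: space_restrict_space)
    also have "\<dots> = emeasure (\<Pi>\<^sub>M j\<in>UNIV. lborel)
       ((\<lambda>x. \<chi> j. x j) -` ((\<lambda>x j. x $ j) -` Pi\<^sub>E UNIV A \<inter> space (restrict_space lborel Q)) \<inter> space (\<Pi>\<^sub>M j\<in>UNIV. lborel))"
    proof -
      have "(\<lambda>x j. x $ j) -` Pi\<^sub>E UNIV A \<inter> space (restrict_space lborel Q) = {x. \<forall>j. x $ j \<in> A j} \<inter> Q"
        by (auto simp: space_restrict_space)
      then show ?thesis
        by (subst lborel_vec, subst emeasure_distr) auto
    qed
    also have "(\<lambda>x. \<chi> j. x j) -` ((\<lambda>x j. x $ j) -` Pi\<^sub>E UNIV A \<inter> space (restrict_space lborel Q)) \<inter> space (\<Pi>\<^sub>M j\<in>UNIV. lborel)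
       = Pi\<^sub>E UNIV (\<lambda>j. A j \<inter> {0..<1})"
      by (auto simp: space_restrict_space Q_def space_PiM PiE_iff)
    also have "emeasure (\<Pi>\<^sub>M j\<in>UNIV. lborel) (Pi\<^sub>E UNIV (\<lambda>j. A j \<inter> {0..<1})) = (\<Prod>j\<in>UNIV. emeasure lborel (A j \<inter> {0..<1}))"
      by (intro L.emeasure_PiM) auto
    also have "\<dots> = (\<Prod>j\<in>UNIV. emeasure unit_measure (A j))"
      by (simp add: emeasure_unit_measure)
    finally show "emeasure (distr (restrict_space lborel Q) (\<Pi>\<^sub>M j\<in>UNIV. unit_measure) (\<lambda>x j. x $ j)) (Pi\<^sub>E UNIV A)
        = (\<Prod>j\<in>UNIV. emeasure unit_measure (A j))" .
  qed simp_all
  then have eq: "cube_measure = P" by (simp add: cube_measure_def)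
  have "distr P borel (\<lambda>x. to_torus (\<chi> j::'n. x j)) = distr (restrict_space lborel Q) borel (\<lambda>x. to_torus (\<chi> j. x $ j))"
    unfolding P_def by (subst distr_distr) (auto simp: o_def)
  then show ?thesis
    unfolding torus_measure_def Q_def[symmetric] eq by simp
qed

lemma sets_torus_measure [simp, measurable_cong]: "sets torus_measure = sets borel"
  by (simp add: torus_measure_def)

lemma space_torus_measure [simp]: "space torus_measure = UNIV"
  by (simp add: torus_measure_def)

interpretation torus: prob_space torus_measure
  unfolding torus_measure_cube by (intro cube_measure.prob_space_distr) measurable

definition torus_point :: "('n::finite \<Rightarrow> real) \<Rightarrow> circle ^ 'n" where
  "torus_point x = to_torus (\<chi> j. x j)"

lemma torus_point_nth [simp]: "torus_point x $ j = abs_circle (x j)"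
  by (simp add: torus_point_def to_torus_def)

lemma measurable_torus_point [measurable]: "torus_point \<in> (\<Pi>\<^sub>M j\<in>UNIV. borel) \<rightarrow>\<^sub>M borel"
  unfolding torus_point_def by measurable

lemma torus_measure_distr: "torus_measure = distr cube_measure borel torus_point"
  unfolding torus_measure_cube torus_point_def ..

lemma integral_torus:
  fixes F :: "circle ^ 'n::finite \<Rightarrow> 'b::{banach, second_countable_topology}"
  assumes [measurable]: "F \<in> borel_measurable borel"
  shows "(LINT z|torus_measure. F z) = (LINT x|cube_measure. F (torus_point x))"
  unfolding torus_measure_distr by (intro integral_distr) measurable

lemma integrable_torus:
  fixes F :: "circle ^ 'n::finite \<Rightarrow> 'b::{banach, second_countable_topology}"
  assumes [measurable]: "F \<in> borel_measurable borel"
  shows "integrable torus_measure F \<longleftrightarrow> integrable cube_measure (\<lambda>x. F (torus_point x))"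
  unfolding torus_measure_distr by (intro integrable_distr_eq) measurable

lemma AE_torus:
  fixes P :: "circle ^ 'n::finite \<Rightarrow> bool"
  assumes [measurable]: "Measurable.pred borel P"
  shows "(AE z in torus_measure. P z) \<longleftrightarrow> (AE x in cube_measure. P (torus_point x))"
  unfolding torus_measure_distr
  by (intro AE_distr_iff) (use assms in \<open>simp_all add: pred_def\<close>)

lemma AE_cubeI:
  assumes "AE t in unit_measure. P t"
  shows "AE x in cube_measure. P (x j)"
  unfolding cube_measure_def
  by (rule AE_PiM_component[where M="\<lambda>_. unit_measure"]) (use assms in \<open>auto intro: unit_measure.prob_space_axioms\<close>)

lemma torus1_distr: "(torus_measure :: (circle ^ 1) measure) = distr unit_measure borel (\<lambda>t. \<chi> _. abs_circle t)"
proof -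
  have "distr (\<Pi>\<^sub>M j\<in>{1::1}. unit_measure) unit_measure (\<lambda>x. x 1) = unit_measure"
    using distr_PiM_component[of "{1::1}" "\<lambda>_. unit_measure" 1] unit_measure.prob_space_axioms by simp
  then have "unit_measure = distr (cube_measure :: (1 \<Rightarrow> real) measure) unit_measure (\<lambda>x. x 1)"
    by (simp add: cube_measure_def UNIV_1)
  then have "distr unit_measure borel (\<lambda>t. (\<chi> _. abs_circle t) :: circle ^ 1)
     = distr (distr cube_measure unit_measure (\<lambda>x. x (1::1))) borel (\<lambda>t. \<chi> _. abs_circle t)"
    by (rule arg_cong[where f="\<lambda>M. distr M borel (\<lambda>t. \<chi> _. abs_circle t)"])
  also have "\<dots> = distr cube_measure borel (\<lambda>x. \<chi> _. abs_circle (x (1::1)))"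
  proof (subst distr_distr)
    have "(\<lambda>t. (\<chi> _. abs_circle t) :: circle ^ 1) \<in> borel_measurable borel"
      by (intro borel_measurable_continuous_onI continuous_vec_lambda continuous_abs_circle)
    then show "(\<lambda>t. (\<chi> _. abs_circle t) :: circle ^ 1) \<in> borel_measurable unit_measure" by simp
    show "(\<lambda>x. x 1) \<in> cube_measure \<rightarrow>\<^sub>M unit_measure" by measurable
  qed (simp add: o_def)
  also have "\<dots> = (torus_measure :: (circle ^ 1) measure)"
  proof -
    have "(\<lambda>x. \<chi> _. abs_circle (x (1::1))) = torus_point"
      by (auto simp: fun_eq_iff vec_eq_iff num1_eq1)
    then show ?thesis unfolding torus_measure_distr by (simp only:)
  qed
  finally show ?thesis by (rule sym)
qed

section \<open>Smooth functions on the torus\<close>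

lemma C_infinity_continuous: "C_infinity f \<Longrightarrow> continuous_on UNIV f"
  using C_k.simps(1) C_infinity_def by blast

lemma C_infinity_partial:
  assumes "C_infinity f" "b \<in> Basis"
  shows "C_infinity (\<lambda>x. frechet_derivative f (at x) b)"
  using assms unfolding C_infinity_def by (metis C_k.simps(2))

lemma C_infinity_has_derivative:
  assumes "C_infinity f"
  shows "(f has_derivative frechet_derivative f (at x)) (at x)"
proof -
  have "C_k (Suc 0) f" using assms C_infinity_def by blast
  then have "f differentiable (at x)" by (simp add: differentiable_on_def)
  then show ?thesis by (simp add: frechet_derivative_works)
qed

text \<open>
  A periodic function has the same derivatives at both points, so the choice made by
  \<open>frechet_derivative\<close> is the same even where the function is not differentiable. This makes the
  gradient on the torus independent of the lift of the point.
\<close>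

lemma frechet_derivative_periodic:
  fixes f :: "'a::real_normed_vector \<Rightarrow> 'b::real_normed_vector"
  assumes "\<And>x. f (x + k) = f x"
  shows "frechet_derivative f (at (x + k)) = frechet_derivative f (at x)"
proof -
  have "(f has_derivative D) (at (x + k)) \<longleftrightarrow> (f has_derivative D) (at x)" for D
  proof
    assume D: "(f has_derivative D) (at (x + k))"
    have "((\<lambda>y. f (y + k)) has_derivative (\<lambda>h. D h)) (at x)"
      by (rule has_derivative_compose[of "\<lambda>y. y + k"]) (use D in \<open>auto intro!: derivative_eq_intros\<close>)
    then show "(f has_derivative D) (at x)" by (simp add: assms)
  next
    assume D: "(f has_derivative D) (at x)"
    have "((\<lambda>y. f (y - k)) has_derivative (\<lambda>h. D h)) (at (x + k))"
      by (rule has_derivative_compose[of "\<lambda>y. y - k"]) (use D in \<open>auto intro!: derivative_eq_intros\<close>)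
    moreover have "(\<lambda>y. f (y - k)) = f" using assms[of "_ - k"] by auto
    ultimately show "(f has_derivative D) (at (x + k))" by simp
  qed
  then show ?thesis by (simp add: frechet_derivative_def)
qed

lemma torus_grad_to_torus:
  "torus_grad \<phi> (to_torus x) $ i = frechet_derivative (\<lambda>x. \<phi> (to_torus x)) (at x) (axis i 1)"
proof -
  define y where "y = inv to_torus (to_torus x)"
  have "to_torus y = to_torus x" unfolding y_def by (simp add: surj_to_torus surj_f_inv_f)
  then have "\<forall>i. (y - x) $ i \<in> \<int>" by (simp add: to_torus_eq_iff)
  then have "to_torus (z + (y - x)) = to_torus z" for z
    by (simp add: to_torus_eq_iff)
  then have "frechet_derivative (\<lambda>x. \<phi> (to_torus x)) (at (x + (y - x))) = frechet_derivative (\<lambda>x. \<phi> (to_torus x)) (at x)"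
    by (intro frechet_derivative_periodic) simp
  then show ?thesis by (simp add: torus_grad_def y_def)
qed

lemma torus_continuous_bounded:
  fixes g :: "circle ^ 'n::finite \<Rightarrow> real"
  assumes "continuous_on UNIV (\<lambda>x. g (to_torus x))"
  obtains B where "B > 0" "\<And>z. \<bar>g z\<bar> \<le> B"
proof -
  have "compact ((\<lambda>x. g (to_torus x)) ` cbox 0 1)"
    by (intro compact_continuous_image continuous_on_subset[OF assms]) auto
  then obtain B where B: "B > 0" "\<And>x. x \<in> cbox 0 1 \<Longrightarrow> \<bar>g (to_torus x)\<bar> \<le> B"
    by (force dest!: compact_imp_bounded simp: bounded_pos)
  have "\<bar>g z\<bar> \<le> B" for z
    using B(2)[of "torus_coord z"] torus_coord_bounds[of z] by (simp add: mem_box_cart less_imp_le)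
  with B(1) show ?thesis by (rule that)
qed

lemma torus_smooth_continuous: "torus_smooth \<phi> \<Longrightarrow> continuous_on UNIV (\<lambda>x. \<phi> (to_torus x))"
  unfolding torus_smooth_def by (rule C_infinity_continuous)

lemma torus_smooth_grad_continuous:
  "torus_smooth \<phi> \<Longrightarrow> continuous_on UNIV (\<lambda>x. torus_grad \<phi> (to_torus x) $ i)"
  unfolding torus_smooth_def torus_grad_to_torus
  by (intro C_infinity_continuous C_infinity_partial) (auto simp: axis_in_Basis_iff)

lemma torus_smooth_measurable: "torus_smooth \<phi> \<Longrightarrow> \<phi> \<in> borel_measurable borel"
  by (intro borel_measurable_on_torus torus_smooth_continuous)

lemma torus_smooth_grad_measurable: "torus_smooth \<phi> \<Longrightarrow> (\<lambda>z. torus_grad \<phi> z $ i) \<in> borel_measurable borel"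
  by (intro borel_measurable_on_torus torus_smooth_grad_continuous)

section \<open>Test functions and the fundamental lemma of the calculus of variations\<close>

text \<open>
  A supply of test functions, closed under partial derivatives and rich enough to approximate the
  indicator function of a box. The sigmoid satisfies \<open>\<sigma>' = \<sigma> (1 - \<sigma>)\<close>, which keeps its derivative in
  the class.
\<close>

inductive_set elementary :: "(real ^ 'n::finite \<Rightarrow> real) set" where
  const: "(\<lambda>x. c) \<in> elementary"
| sine: "(\<lambda>x. sin (a * x $ i + b)) \<in> elementary"
| sigmoid: "f \<in> elementary \<Longrightarrow> (\<lambda>x. 1 / (1 + exp (- f x))) \<in> elementary"
| add: "f \<in> elementary \<Longrightarrow> g \<in> elementary \<Longrightarrow> (\<lambda>x. f x + g x) \<in> elementary"
| mult: "f \<in> elementary \<Longrightarrow> g \<in> elementary \<Longrightarrow> (\<lambda>x. f x * g x) \<in> elementary"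

lemma elementary_derivative:
  assumes "f \<in> elementary"
  shows "\<exists>F. (\<forall>x. (f has_derivative F x) (at x)) \<and> (\<forall>b. (\<lambda>x. F x b) \<in> elementary)"
  using assms
proof induction
  case (const c)
  show ?case by (intro exI[of _ "\<lambda>_ _. 0"]) (auto intro: elementary.const)
next
  case (sine a i b)
  have *: "(\<lambda>x :: real ^ 'a. (a * h $ i) * sin (a * x $ i + (b + pi / 2))) \<in> elementary" for h :: "real ^ 'a"
    by (intro elementary.intros)
  have eq: "sin (y + (b + pi / 2)) = cos (y + b)" for y
    using sin_add[of "y + b" "pi/2"] by (simp add: add.assoc)
  have "((\<lambda>x :: real ^ 'a. sin (a * x $ i + b)) has_derivative
      (\<lambda>h. (a * h $ i) * sin (a * x $ i + (b + pi / 2)))) (at x)" for x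
    by (rule derivative_eq_intros bounded_linear.has_derivative[OF bounded_linear_vec_nth] refl)+
      (auto simp: eq)
  with * show ?case
    by (intro exI[of _ "\<lambda>x h. (a * h $ i) * sin (a * x $ i + (b + pi / 2))"]) blast
next
  case (sigmoid f)
  then obtain F where F: "\<And>x. (f has_derivative F x) (at x)" "\<And>b. (\<lambda>x. F x b) \<in> elementary" by auto
  define s where "s = (\<lambda>x. 1 / (1 + exp (- f x)))"
  have s: "s \<in> elementary" unfolding s_def using sigmoid by (intro elementary.intros)
  have pos: "1 + exp (- f x) \<noteq> 0" for x
    by (metis add_pos_pos exp_gt_zero less_numeral_extra(1) order_less_irrefl)
  have key: "1 + (-1) * (1 / (1 + exp (- f x))) = exp (- f x) * (1 / (1 + exp (- f x)))" for x
    using pos[of x] by (simp add: divide_simps)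
  have "(s has_derivative (\<lambda>h. s x * (1 + (-1) * s x) * F x h)) (at x)" for x
    unfolding s_def
    by (rule derivative_eq_intros F pos refl)+
      (rule ext, simp only: key s_def, simp add: divide_inverse)
  moreover have "(\<lambda>x. s x * (1 + (-1) * s x) * F x h) \<in> elementary" for h
    by (intro elementary.intros F s)
  ultimately show ?case unfolding s_def[symmetric]
    by (intro exI[of _ "\<lambda>x h. s x * (1 + (-1) * s x) * F x h"]) auto
next
  case (add f g)
  then obtain F G where F: "\<And>x. (f has_derivative F x) (at x)" "\<And>b. (\<lambda>x. F x b) \<in> elementary"
    and G: "\<And>x. (g has_derivative G x) (at x)" "\<And>b. (\<lambda>x. G x b) \<in> elementary" by auto
  then show ?case
    by (intro exI[of _ "\<lambda>x h. F x h + G x h"] conjI allI elementary.add) (auto intro!: derivative_eq_intros)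
next
  case (mult f g)
  then obtain F G where F: "\<And>x. (f has_derivative F x) (at x)" "\<And>b. (\<lambda>x. F x b) \<in> elementary"
    and G: "\<And>x. (g has_derivative G x) (at x)" "\<And>b. (\<lambda>x. G x b) \<in> elementary" by auto
  have "(\<lambda>x. f x * G x h + F x h * g x) \<in> elementary" for h
    using mult F G by (intro elementary.intros)
  then show ?case
    by (intro exI[of _ "\<lambda>x h. f x * G x h + F x h * g x"] conjI allI) (auto intro!: derivative_eq_intros F G)
qed

lemma elementary_smooth:
  assumes "f \<in> elementary" shows "C_infinity f"
proof -
  have "C_k k f" for k
    using assms
  proof (induction k arbitrary: f)
    case 0
    then obtain F where F: "\<And>x. (f has_derivative F x) (at x)" using elementary_derivative by blast
    have "continuous_on UNIV f"
      by (intro continuous_at_imp_continuous_on ballI has_derivative_continuous[OF F])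
    then show ?case by simp
  next
    case (Suc k)
    then obtain F where F: "\<And>x. (f has_derivative F x) (at x)" "\<And>b. (\<lambda>x. F x b) \<in> elementary"
      using elementary_derivative by blast
    have "f differentiable_on UNIV" 
      unfolding differentiable_on_def differentiable_def using F(1) by blast
    moreover have "frechet_derivative f (at x) = F x" for x using frechet_derivative_at[OF F(1)[of x]] by simp
    ultimately show ?case using Suc.IH F(2) by simp
  qed
  then show ?thesis by (simp add: C_infinity_def)
qed

lemma elementary_prod:
  "finite I \<Longrightarrow> (\<And>j. j \<in> I \<Longrightarrow> f j \<in> elementary) \<Longrightarrow> (\<lambda>x. \<Prod>j\<in>I. f j x) \<in> elementary"
proof (induction I rule: finite_induct)
  case empty
  show ?case using elementary.const[of 1] by simp
next
  case (insert i I)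
  then have "(\<lambda>x. f i x * (\<Prod>j\<in>I. f j x)) \<in> elementary" by (intro elementary.mult) auto
  with insert show ?case by simp
qed

lemma torus_smooth_const: "torus_smooth (\<lambda>_. c)"
  unfolding torus_smooth_def by (intro elementary_smooth elementary.const)

text \<open>
  This equals \<open>2 sin (\<pi> t) sin (\<pi> (b - t))\<close>: a periodic function that is positive on the arc from
  \<open>0\<close> to \<open>b\<close> and negative on the rest of the circle. The form chosen here shows that it is a
  trigonometric polynomial of period 1.
\<close>

definition arc_profile :: "real \<Rightarrow> real \<Rightarrow> real" where
  "arc_profile b t = sin (2 * pi * t + (pi / 2 - pi * b)) - cos (pi * b)"

lemma arc_profile_eq: "arc_profile b t = 2 * sin (pi * t) * sin (pi * (b - t))"
proof -
  have "sin (2 * pi * t + (pi / 2 - pi * b)) = cos (2 * pi * t - pi * b)"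
    using sin_add[of "2 * pi * t - pi * b" "pi / 2"] by (simp add: algebra_simps)
  moreover have halves: "(2 * pi * t - pi * b + pi * b) / 2 = pi * t" "(pi * b - (2 * pi * t - pi * b)) / 2 = pi * (b - t)"
    by (simp_all add: field_simps)
  ultimately show ?thesis
    unfolding arc_profile_def using cos_diff_cos[of "2 * pi * t - pi * b" "pi * b"] halves by simp
qed

lemma arc_profile_sign:
  assumes "0 < t" "t < 1" "0 \<le> b" "b \<le> 1"
  shows "t < b \<Longrightarrow> 0 < arc_profile b t" "b < t \<Longrightarrow> arc_profile b t < 0"
proof -
  have 1: "0 < sin (pi * t)" using assms by (intro sin_gt_zero) auto
  { assume "t < b"
    then have "0 < sin (pi * (b - t))" using assms
      using mult_strict_left_mono[of "b - t" 1 pi] by (intro sin_gt_zero) simp_all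
    then show "0 < arc_profile b t" using 1 by (simp add: arc_profile_eq) }
  { assume "b < t"
    then have "0 < sin (pi * (t - b))" using assms
      using mult_strict_left_mono[of "t - b" 1 pi] by (intro sin_gt_zero) simp_all
    moreover have "sin (pi * (b - t)) = - sin (pi * (t - b))"
      
      using sin_minus[of "pi * (t - b)"] by (simp add: right_diff_distrib)
    ultimately show "arc_profile b t < 0" using 1 by (simp add: arc_profile_eq mult_pos_neg) }
qed

lemma arc_profile_shift: "arc_profile b (t + of_int k) = arc_profile b t"
proof -
  have "sin (2 * pi * (t + of_int k) + (pi / 2 - pi * b)) = sin ((2 * pi * t + (pi / 2 - pi * b)) + (2 * pi) * of_int k)"
    by (simp add: algebra_simps)
  also have "\<dots> = sin (2 * pi * t + (pi / 2 - pi * b))"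
    by (subst sin_add) simp
  finally show ?thesis by (simp add: arc_profile_def)
qed

text \<open>
  Steep sigmoids of \<open>arc_profile\<close> are smooth approximations of the indicator function of \<open>[0, b)\<close>.
  Truncating \<open>b\<close> to \<open>[0, 1]\<close> covers the cases where this set is empty or the whole period.
\<close>

definition smooth_step :: "nat \<Rightarrow> real \<Rightarrow> real \<Rightarrow> real" where
  "smooth_step n b t = 1 / (1 + exp (- (real n * arc_profile (max 0 (min 1 b)) t)))"

lemma smooth_step_shift: "x - y \<in> \<int> \<Longrightarrow> smooth_step n b x = smooth_step n b y"
proof -
  assume "x - y \<in> \<int>"
  then obtain k where "x - y = of_int k" by (auto elim: Ints_cases)
  then have "x = y + of_int k" by simp
  then show ?thesis by (simp add: smooth_step_def arc_profile_shift)
qed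

lemma smooth_step_bounds: "0 \<le> smooth_step n b t" "smooth_step n b t \<le> 1"
  by (simp_all add: smooth_step_def add_pos_pos less_imp_le)

lemma smooth_step_elementary: "(\<lambda>x :: real ^ 'n::finite. smooth_step n b (x $ j)) \<in> elementary"
proof -
  define b' where "b' = max 0 (min 1 b)"
  have "(\<lambda>x :: real ^ 'n. 1 / (1 + exp (- (real n * (sin (2 * pi * x $ j + (pi / 2 - pi * b')) + (- cos (pi * b'))))))) \<in> elementary"
    by (intro elementary.intros)
  then show ?thesis unfolding smooth_step_def arc_profile_def b'_def diff_conv_add_uminus[of "sin _"] .
qed

lemma smooth_step_tendsto:
  assumes "0 < t" "t < 1" "t \<noteq> b"
  shows "(\<lambda>n. smooth_step n b t) \<longlonglongrightarrow> (if t < b then 1 else 0)"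
proof -
  define s where "s = arc_profile (max 0 (min 1 b)) t"
  have s: "t < b \<Longrightarrow> 0 < s" "\<not> t < b \<Longrightarrow> s < 0"
    unfolding s_def using assms
    by (simp_all add: arc_profile_sign)
  show ?thesis
  proof (cases "t < b")
    case True
    then have "0 < s" using s by simp
    then have "(\<lambda>n. exp (- s) ^ n) \<longlonglongrightarrow> 0" by (intro LIMSEQ_realpow_zero) auto
    then have "(\<lambda>n. 1 / (1 + exp (- s) ^ n)) \<longlonglongrightarrow> 1 / (1 + 0)"
      by (intro tendsto_divide tendsto_add tendsto_const) auto
    then have "(\<lambda>n. 1 / (1 + exp (- (real n * s)))) \<longlonglongrightarrow> 1"
      by (simp add: exp_of_nat_mult[symmetric])
    with True show ?thesis by (simp add: smooth_step_def s_def)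
  next
    case False
    then have "s < 0" using s by simp
    then have "(\<lambda>n. exp s ^ n) \<longlonglongrightarrow> 0" by (intro LIMSEQ_realpow_zero) auto
    then have "(\<lambda>n. exp s ^ n / (exp s ^ n + 1)) \<longlonglongrightarrow> 0 / (0 + 1)"
      by (intro tendsto_divide tendsto_add tendsto_const) auto
    moreover have "exp s ^ n / (exp s ^ n + 1) = 1 / (1 + exp (- (real n * s)))" for n
      by (simp add: exp_of_nat_mult[symmetric] exp_minus field_simps)
    ultimately have "(\<lambda>n. 1 / (1 + exp (- (real n * s)))) \<longlonglongrightarrow> 0" by simp
    with False show ?thesis by (simp add: smooth_step_def s_def)
  qed
qed

lemma torus_smooth_elementary:
  assumes "P \<in> elementary" "\<And>x y. to_torus x = to_torus y \<Longrightarrow> P x = P y"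
  shows "torus_smooth (\<lambda>z. P (torus_coord z))"
proof -
  have "(\<lambda>x. P (torus_coord (to_torus x))) = P"
    by (intro ext assms(2)) simp
  then show ?thesis unfolding torus_smooth_def using elementary_smooth[OF assms(1)] by simp
qed

lemma AE_unit_measure_neq: "AE t in unit_measure. t \<noteq> c"
  unfolding unit_measure_def
  by (subst AE_density) (use AE_lborel_singleton[of c] in \<open>auto elim: eventually_mono\<close>)

text \<open>
  Products of smooth steps converge boundedly to indicator functions of boxes, so the integral of
  \<open>h\<close> over every box vanishes. Boxes form an intersection-stable generator of the Borel sets; hence the
  integral over every Borel set vanishes.
\<close>

lemma AE_zero_if_orthogonal_to_smooth:
  fixes h :: "circle ^ 'n::finite \<Rightarrow> real"
  assumes int: "integrable torus_measure h"
    and orth: "\<And>\<phi>. torus_smooth \<phi> \<Longrightarrow> (LINT z|torus_measure. h z * \<phi> z) = 0"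
  shows "AE z in torus_measure. h z = 0"
proof -
  have [measurable]: "h \<in> borel_measurable borel"
    using borel_measurable_integrable[OF int] by simp
  define M where "M = distr cube_measure borel (\<lambda>x. \<chi> j::'n. x j)"
  define H where "H = (\<lambda>y. h (to_torus y))"
  have [measurable]: "H \<in> borel_measurable borel" unfolding H_def by measurable
  have sM[simp, measurable_cong]: "sets M = sets borel" and spM[simp]: "space M = UNIV" by (simp_all add: M_def)
  interpret M: prob_space M
    unfolding M_def by (intro cube_measure.prob_space_distr) measurable
  have intc: "integrable cube_measure (\<lambda>x. h (torus_point x))" using int by (simp add: integrable_torus)
  then have intM: "integrable M H"
    unfolding M_def H_def by (subst integrable_distr_eq) (auto simp: torus_point_def)
  have intA: "integrable M (\<lambda>y. indicator A y *\<^sub>R H y)" if "A \<in> sets borel" for A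
    using that by (intro integrable_mult_indicator intM) simp
  \<comment> \<open>The constant test function; complements in the induction over Borel sets need it.\<close>
  have tot: "(LINT y|M. H y) = 0"
    using orth[OF torus_smooth_const[of 1]] unfolding M_def H_def
    by (subst integral_distr) (auto simp: torus_point_def integral_torus)
  have box: "set_lebesgue_integral M (box l u) H = 0" for l u :: "real ^ 'n"
  proof (cases "\<forall>j. l $ j < u $ j")
    case False
    then have "box l u = {}" by (metis mem_box_cart all_not_in_conv order.strict_trans)
    then show ?thesis by (simp add: set_lebesgue_integral_def)
  next
    case True
    define P where "P n x = (\<Prod>j\<in>UNIV. smooth_step n (u $ j) (x $ j) * (1 + (-1) * smooth_step n (l $ j) (x $ j)))"
      for n and x :: "real ^ 'n"
    have P: "P n \<in> elementary" for n
      unfolding P_def by (intro elementary_prod elementary.mult elementary.add elementary.const smooth_step_elementary) auto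
    have per: "to_torus x = to_torus y \<Longrightarrow> P n x = P n y" for n x y
      unfolding P_def using smooth_step_shift by (auto simp: to_torus_eq_iff intro!: prod.cong) (metis)+
    have Pm[measurable]: "P n \<in> borel_measurable borel" for n
      using C_infinity_continuous[OF elementary_smooth[OF P]] by (intro borel_measurable_continuous_onI)
    have Pb: "\<bar>P n x\<bar> \<le> 1" for n x
      unfolding P_def abs_prod
      using smooth_step_bounds by (intro prod_le_1) (auto simp: abs_mult intro!: mult_le_one)
    have zero: "(LINT y|M. H y * P n y) = 0" for n
    proof -
      have "(LINT z|torus_measure. h z * P n (torus_coord z)) = 0"
        by (intro orth torus_smooth_elementary P per)
      also have "(LINT z|torus_measure. h z * P n (torus_coord z)) = (LINT x|cube_measure. h (torus_point x) * P n (torus_coord (torus_point x)))"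
        by (intro integral_torus) measurable
      also have "\<dots> = (LINT x|cube_measure. H (\<chi> j. x j) * P n (\<chi> j. x j))"
        by (intro Bochner_Integration.integral_cong refl) (auto simp: H_def torus_point_def intro!: per)
      also have "\<dots> = (LINT y|M. H y * P n y)"
        unfolding M_def by (intro integral_distr[symmetric]) auto
      finally show ?thesis by simp
    qed
    have AE1: "AE x in cube_measure. \<forall>j. 0 < x j \<and> x j < 1 \<and> x j \<noteq> l $ j \<and> x j \<noteq> u $ j"
    proof (subst AE_all_countable, intro allI AE_cubeI)
      fix j show "AE t in unit_measure. 0 < t \<and> t < 1 \<and> t \<noteq> l $ j \<and> t \<noteq> u $ j"
        using AE_unit_measure AE_unit_measure_neq[of 0] AE_unit_measure_neq[of "l $ j"] AE_unit_measure_neq[of "u $ j"]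
        by eventually_elim auto
    qed
    have "AE y in M. \<forall>j. 0 < y $ j \<and> y $ j < 1 \<and> y $ j \<noteq> l $ j \<and> y $ j \<noteq> u $ j"
      unfolding M_def by (subst AE_distr_iff) (use AE1 in auto)
    then have lim: "AE y in M. (\<lambda>n. H y * P n y) \<longlonglongrightarrow> H y * indicator (box l u) y"
    proof eventually_elim
      case (elim y)
      have "(\<lambda>n. P n y) \<longlonglongrightarrow> (\<Prod>j\<in>UNIV. (if y $ j < u $ j then 1 else 0) * (1 + (-1) * (if y $ j < l $ j then 1 else 0)))"
        unfolding P_def using elim by (intro tendsto_intros smooth_step_tendsto) auto
      also have "(\<Prod>j\<in>UNIV. (if y $ j < u $ j then 1 else 0) * (1 + (-1) * (if y $ j < l $ j then 1 else 0)))
        = (\<Prod>j\<in>UNIV. if l $ j < y $ j \<and> y $ j < u $ j then 1 else (0::real))"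
        using elim by (intro prod.cong refl) (auto simp: not_less order.strict_iff_order)
      also have "\<dots> = indicator (box l u) y"
        by (auto simp: indicator_def mem_box_cart prod_eq_1_iff prod_zero_iff)
      finally show ?case by (intro tendsto_intros)
    qed
    have "(\<lambda>n. LINT y|M. H y * P n y) \<longlonglongrightarrow> (LINT y|M. H y * indicator (box l u) y)"
    proof (rule integral_dominated_convergence[where w="\<lambda>y. \<bar>H y\<bar>"])
      show "AE y in M. norm (H y * P n y) \<le> \<bar>H y\<bar>" for n
        using Pb[of n] by (intro AE_I2) (simp add: abs_mult mult_left_le)
    qed (use lim intM in \<open>auto\<close>)
    then have "(LINT y|M. H y * indicator (box l u) y) = 0"
      by (simp add: zero LIMSEQ_const_iff)
    then show ?thesis by (simp add: set_lebesgue_integral_def mult.commute)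
  qed
  have "set_lebesgue_integral M A H = 0" if A: "A \<in> sets M" for A
  proof -
    have sig: "A \<in> sigma_sets UNIV (range (\<lambda>(a, b). box a b :: (real ^ 'n) set))"
      using A by (simp add: borel_eq_box[symmetric] sets_measure_of[symmetric]) (simp add: borel_eq_box)
    have "Int_stable (range (\<lambda>(a, b). box a b :: (real ^ 'n) set))"
      by (auto simp: Int_stable_def box_Int_box)
    moreover have "range (\<lambda>(a, b). box a b :: (real ^ 'n) set) \<subseteq> Pow UNIV" by simp
    ultimately show ?thesis
      using sig
    proof (induction rule: sigma_sets_induct_disjoint)
    next
      case (basic A)
      then show ?case using box by auto
    next
      case empty
      show ?case by (simp add: set_lebesgue_integral_def)
    next
      case (compl A)
      then have [measurable]: "A \<in> sets borel" by (simp add: borel_eq_box)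
      have "(LINT y|M. indicator (UNIV - A) y *\<^sub>R H y) = (LINT y|M. H y - indicator A y *\<^sub>R H y)"
        by (intro Bochner_Integration.integral_cong refl) (auto simp: indicator_def)
      also have "\<dots> = 0" using compl tot intA[of A] intM
        by (subst Bochner_Integration.integral_diff) (auto simp: set_lebesgue_integral_def)
      finally show ?case by (simp add: set_lebesgue_integral_def)
    next
      case (union A)
      then have "A i \<in> sets M" for i by (auto simp: borel_eq_box)
      then have "set_lebesgue_integral M (\<Union>i. A i) H = (\<Sum>i. set_lebesgue_integral M (A i) H)"
        using union intA[of "\<Union>i. A i"]
        by (intro lebesgue_integral_countable_add) (auto simp: disjoint_family_on_def set_integrable_def)
      then show ?case using union by simp
    qed
  qed
  then have "AE y in M. H y = 0" by (intro M.density_zero intM)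
  then have "AE x in cube_measure. H (\<chi> j. x j) = 0"
    unfolding M_def by (subst (asm) AE_distr_iff) auto
  then show ?thesis
    by (subst AE_torus) (auto simp: H_def torus_point_def)
qed

section \<open>Square integrable functions\<close>

lemma borel_measurable_torus [simp]:
  "f \<in> borel_measurable torus_measure \<longleftrightarrow> f \<in> borel_measurable borel"
  by (simp cong: measurable_cong_sets)

lemma square_integrable_measurable: "square_integrable f \<Longrightarrow> f \<in> borel_measurable borel"
  by (simp add: square_integrable_def)

lemma square_integrableI_bounded:
  assumes [measurable]: "f \<in> borel_measurable borel" and "\<And>z. norm (f z) \<le> B"
  shows "square_integrable f"
proof -
  have "integrable torus_measure (\<lambda>z. (norm (f z))\<^sup>2)"
    using assms(2) by (intro torus.integrable_const_bound[where B="B\<^sup>2"]) (auto intro!: power_mono)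
  then show ?thesis by (simp add: square_integrable_def)
qed

lemma square_integrable_norm_sum:
  assumes "square_integrable f" "square_integrable g"
    and "h \<in> borel_measurable borel" "\<And>z. norm (h z) \<le> a * norm (f z) + b * norm (g z)"
  shows "square_integrable h"
proof -
  have [measurable]: "f \<in> borel_measurable borel" "g \<in> borel_measurable borel" "h \<in> borel_measurable borel"
    using assms square_integrable_measurable by auto
  have "(norm (h z))\<^sup>2 \<le> 2 * a\<^sup>2 * (norm (f z))\<^sup>2 + 2 * b\<^sup>2 * (norm (g z))\<^sup>2" for z
  proof -
    have "(norm (h z))\<^sup>2 \<le> (a * norm (f z) + b * norm (g z))\<^sup>2"
      using assms(4) by (intro power_mono) auto
    also have "\<dots> \<le> 2 * a\<^sup>2 * (norm (f z))\<^sup>2 + 2 * b\<^sup>2 * (norm (g z))\<^sup>2"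
      using sum_squares_bound[of "a * norm (f z)" "b * norm (g z)"] 
      by (simp add: power2_sum power_mult_distrib algebra_simps)
    finally show ?thesis .
  qed
  note bound = this
  have "integrable torus_measure (\<lambda>z. 2 * a\<^sup>2 * (norm (f z))\<^sup>2 + 2 * b\<^sup>2 * (norm (g z))\<^sup>2)"
    using assms(1,2) by (simp add: square_integrable_def)
  then have "integrable torus_measure (\<lambda>z. (norm (h z))\<^sup>2)"
  proof (rule Bochner_Integration.integrable_bound)
    show "AE z in torus_measure. norm ((norm (h z))\<^sup>2) \<le> norm (2 * a\<^sup>2 * (norm (f z))\<^sup>2 + 2 * b\<^sup>2 * (norm (g z))\<^sup>2)"
      by (intro AE_I2) (simp only: real_norm_def abs_of_nonneg[OF zero_le_power2], intro order_trans[OF bound abs_ge_self])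
  qed simp
  then show ?thesis using assms(3) by (simp add: square_integrable_def)
qed

lemma square_integrable_combination:
  fixes f g :: "circle ^ 'n::finite \<Rightarrow> 'b::euclidean_space"
  assumes "square_integrable f" "square_integrable g"
  shows "square_integrable (\<lambda>z. a *\<^sub>R f z + b *\<^sub>R g z)"
proof (rule square_integrable_norm_sum[OF assms])
  have [measurable]: "f \<in> borel_measurable borel" "g \<in> borel_measurable borel"
    using assms square_integrable_measurable by auto
  show "(\<lambda>z. a *\<^sub>R f z + b *\<^sub>R g z) \<in> borel_measurable borel" by measurable
  show "norm (a *\<^sub>R f z + b *\<^sub>R g z) \<le> \<bar>a\<bar> * norm (f z) + \<bar>b\<bar> * norm (g z)" for z
    by (metis norm_scaleR norm_triangle_ineq)
qed

lemma square_integrable_add: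
  fixes f g :: "circle ^ 'n::finite \<Rightarrow> 'b::euclidean_space"
  shows "square_integrable f \<Longrightarrow> square_integrable g \<Longrightarrow> square_integrable (\<lambda>z. f z + g z)"
  using square_integrable_combination[of f g 1 1] by simp

lemma square_integrable_diff:
  fixes f g :: "circle ^ 'n::finite \<Rightarrow> 'b::euclidean_space"
  shows "square_integrable f \<Longrightarrow> square_integrable g \<Longrightarrow> square_integrable (\<lambda>z. f z - g z)"
  using square_integrable_combination[of f g 1 "-1"] by simp

lemma square_integrable_scaleR:
  fixes f :: "circle ^ 'n::finite \<Rightarrow> 'b::euclidean_space"
  shows "square_integrable f \<Longrightarrow> square_integrable (\<lambda>z. c *\<^sub>R f z)"
  using square_integrable_combination[of f f c 0] by simp

lemma square_integrable_mult:
  fixes f :: "circle ^ 'n::finite \<Rightarrow> real"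
  shows "square_integrable f \<Longrightarrow> square_integrable (\<lambda>z. c * f z)"
  using square_integrable_scaleR[of f c] by simp

lemma square_integrable_nth:
  fixes f :: "circle ^ 'n::finite \<Rightarrow> real ^ 'm::finite"
  assumes "square_integrable f" shows "square_integrable (\<lambda>z. f z $ i)"
proof (rule square_integrable_norm_sum[OF assms assms])
  show "(\<lambda>z. f z $ i) \<in> borel_measurable borel"
    by (rule measurable_compose[OF square_integrable_measurable[OF assms] measurable_circle_vec_nth])
  show "norm (f z $ i) \<le> 1 * norm (f z) + 0 * norm (f z)" for z
    using component_le_norm_cart[of "f z" i] by simp
qed

lemma square_integrable_integrable:
  fixes f :: "circle ^ 'n::finite \<Rightarrow> 'b::euclidean_space"
  assumes "square_integrable f" shows "integrable torus_measure f"
proof -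
  have [measurable]: "f \<in> borel_measurable borel" using assms by (rule square_integrable_measurable)
  have "integrable torus_measure (\<lambda>z. norm (f z))"
  proof (rule torus.square_integrable_imp_integrable)
    show "(\<lambda>z. norm (f z)) \<in> borel_measurable torus_measure" by measurable
    show "integrable torus_measure (\<lambda>z. (norm (f z))\<^sup>2)" using assms unfolding square_integrable_def by (rule conjunct2)
  qed
  moreover have "f \<in> borel_measurable torus_measure" by measurable
  ultimately show ?thesis by (simp only: integrable_norm_iff)
qed

text \<open>
  The squared \<open>L\<^sup>2\<close> norm.
\<close>

definition mean_square :: "(circle ^ 'n::finite \<Rightarrow> 'b::real_normed_vector) \<Rightarrow> real" where
  "mean_square f = (LINT z|torus_measure. (norm (f z))\<^sup>2)"

lemma mean_square_nonneg [simp]: "0 \<le> mean_square f"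
  by (simp add: mean_square_def)

lemma mean_square_cong_AE:
  assumes "f \<in> borel_measurable borel" "g \<in> borel_measurable borel" "AE z in torus_measure. f z = g z"
  shows "mean_square f = mean_square g"
  unfolding mean_square_def using assms by (intro integral_cong_AE) auto

lemma mean_square_scaleR: "mean_square (\<lambda>z. c *\<^sub>R f z) = c\<^sup>2 * mean_square f"
  by (simp add: mean_square_def power_mult_distrib)

lemma mean_square_mult: 
  fixes f :: "circle ^ 'n::finite \<Rightarrow> real"
  shows "mean_square (\<lambda>z. c * f z) = c\<^sup>2 * mean_square f"
  using mean_square_scaleR[of c f] by simp

lemma mean_square_le_combination:
  assumes "square_integrable f" "square_integrable g"
    and [measurable]: "h \<in> borel_measurable borel" and "\<And>z. (norm (h z))\<^sup>2 \<le> a * (norm (f z))\<^sup>2 + b * (norm (g z))\<^sup>2"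
  shows "mean_square h \<le> a * mean_square f + b * mean_square g"
proof -
  have i: "integrable torus_measure (\<lambda>z. (norm (f z))\<^sup>2)" "integrable torus_measure (\<lambda>z. (norm (g z))\<^sup>2)"
    using assms(1,2) by (auto simp: square_integrable_def)
  have "mean_square h \<le> (LINT z|torus_measure. a * (norm (f z))\<^sup>2 + b * (norm (g z))\<^sup>2)"
    unfolding mean_square_def
  proof (rule integral_mono_AE')
    show "AE z in torus_measure. (norm (h z))\<^sup>2 \<le> a * (norm (f z))\<^sup>2 + b * (norm (g z))\<^sup>2"
      by (intro AE_I2 assms(4))
    show "AE z in torus_measure. 0 \<le> a * (norm (f z))\<^sup>2 + b * (norm (g z))\<^sup>2"
      by (intro AE_I2 order_trans[OF zero_le_power2 assms(4)])
  qed (use i in simp)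
  also have "\<dots> = a * mean_square f + b * mean_square g"
    using i by (simp add: mean_square_def)
  finally show ?thesis .
qed

lemma norm_add_square_le: "(norm (x + y))\<^sup>2 \<le> 2 * (norm x)\<^sup>2 + 2 * (norm (y :: 'b::real_inner))\<^sup>2"
proof -
  have "(norm (x + y))\<^sup>2 + (norm (x - y))\<^sup>2 = 2 * (norm x)\<^sup>2 + 2 * (norm y)\<^sup>2"
    by (simp add: power2_norm_eq_inner algebra_simps inner_commute)
  then show ?thesis using zero_le_power2[of "norm (x - y)"] by linarith
qed

lemma mean_square_add_le:
  fixes f g :: "circle ^ 'n::finite \<Rightarrow> 'b::euclidean_space"
  assumes "square_integrable f" "square_integrable g"
  shows "mean_square (\<lambda>z. f z + g z) \<le> 2 * mean_square f + 2 * mean_square g"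
  using assms square_integrable_measurable[OF square_integrable_add[OF assms]]
  by (intro mean_square_le_combination norm_add_square_le)

lemma mean_square_diff_commute: "mean_square (\<lambda>z. f z - g z) = mean_square (\<lambda>z. g z - f z)"
  by (simp add: mean_square_def norm_minus_commute)

text \<open>
  The variance of \<open>|f|\<close> is not negative.
\<close>

lemma mean_norm_le_mean_square:
  fixes f :: "circle ^ 'n::finite \<Rightarrow> 'b::euclidean_space"
  assumes "square_integrable f"
  shows "(LINT z|torus_measure. norm (f z)) \<le> sqrt (mean_square f)"
proof -
  define c where "c = (LINT z|torus_measure. norm (f z))"
  have i: "integrable torus_measure (\<lambda>z. norm (f z))" "integrable torus_measure (\<lambda>z. (norm (f z))\<^sup>2)"
    using square_integrable_integrable[OF assms] assms by (auto simp: square_integrable_def)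
  have "0 \<le> (LINT z|torus_measure. (norm (f z) - c)\<^sup>2)" by simp
  also have "\<dots> = (LINT z|torus_measure. (norm (f z))\<^sup>2 - 2 * c * norm (f z) + c\<^sup>2)"
    by (simp add: power2_diff algebra_simps)
  also have "\<dots> = mean_square f - 2 * c * c + c\<^sup>2"
    using i by (simp add: mean_square_def c_def torus.prob_space[simplified])
  finally have "c\<^sup>2 \<le> mean_square f" by (simp add: power2_eq_square)
  then show ?thesis unfolding c_def by (rule real_le_rsqrt)
qed

text \<open>
  The theorem of Riesz and Fischer. A Cauchy sequence in \<open>L\<^sup>2\<close> is one in \<open>L\<^sup>1\<close>, because the measure
  is finite, so a subsequence converges almost everywhere; Fatou's lemma shows that its limit is also
  the limit in \<open>L\<^sup>2\<close>.
\<close>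

lemma L2_complete:
  fixes w :: "nat \<Rightarrow> circle ^ 'n::finite \<Rightarrow> 'b::euclidean_space"
  assumes sq: "\<And>n. square_integrable (w n)"
    and Cauchy: "\<And>e. e > 0 \<Longrightarrow> \<exists>N. \<forall>m\<ge>N. \<forall>n\<ge>N. mean_square (\<lambda>z. w m z - w n z) < e"
  obtains v where "square_integrable v" "(\<lambda>n. mean_square (\<lambda>z. w n z - v z)) \<longlonglongrightarrow> 0"
proof -
  have [measurable]: "w n \<in> borel_measurable borel" for n using sq by (rule square_integrable_measurable)
  have "\<exists>N. \<forall>i\<ge>N. \<forall>j\<ge>N. (LINT z|torus_measure. norm (w i z - w j z)) < e" if "e > 0" for e
  proof -
    obtain N where N: "\<And>m n. m \<ge> N \<Longrightarrow> n \<ge> N \<Longrightarrow> mean_square (\<lambda>z. w m z - w n z) < e\<^sup>2"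
      using Cauchy[of "e\<^sup>2"] \<open>e > 0\<close> by auto
    have "(LINT z|torus_measure. norm (w i z - w j z)) < e" if "i \<ge> N" "j \<ge> N" for i j
    proof -
      have "(LINT z|torus_measure. norm (w i z - w j z)) \<le> sqrt (mean_square (\<lambda>z. w i z - w j z))"
        by (intro mean_norm_le_mean_square square_integrable_diff sq)
      also have "\<dots> < e" using N[OF that] \<open>e > 0\<close> by (intro real_less_lsqrt) auto
      finally show ?thesis .
    qed
    then show ?thesis by blast
  qed
  then obtain r where r: "strict_mono r" "AE z in torus_measure. Cauchy (\<lambda>i. w (r i) z)"
    using cauchy_L1_AE_cauchy_subseq[of torus_measure w] square_integrable_integrable[OF sq] by blast
  define v where "v = (\<lambda>z. lim (\<lambda>i. w (r i) z))"
  have vm[measurable]: "v \<in> borel_measurable borel" unfolding v_def by measurable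
  have lim: "AE z in torus_measure. (\<lambda>i. w (r i) z) \<longlonglongrightarrow> v z"
    using r(2) by eventually_elim (simp add: v_def Cauchy_convergent_iff convergent_LIMSEQ_iff)
  have nn: "(\<integral>\<^sup>+z. ennreal ((norm (w m z - w n z))\<^sup>2) \<partial>torus_measure) = ennreal (mean_square (\<lambda>z. w m z - w n z))" for m n
    unfolding mean_square_def using square_integrable_diff[OF sq sq, of m n]
    by (intro nn_integral_eq_integral) (auto simp: square_integrable_def)
  have key: "(\<integral>\<^sup>+z. ennreal ((norm (w m z - v z))\<^sup>2) \<partial>torus_measure) \<le> ennreal e"
    if N: "\<And>n. n \<ge> N \<Longrightarrow> mean_square (\<lambda>z. w m z - w n z) < e" for N m e
  proof -
    have "(\<integral>\<^sup>+z. ennreal ((norm (w m z - v z))\<^sup>2) \<partial>torus_measure)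
        = (\<integral>\<^sup>+z. liminf (\<lambda>i. ennreal ((norm (w m z - w (r i) z))\<^sup>2)) \<partial>torus_measure)"
      using lim
    proof (intro nn_integral_cong_AE, eventually_elim)
      case (elim z)
      then have "(\<lambda>i. ennreal ((norm (w m z - w (r i) z))\<^sup>2)) \<longlonglongrightarrow> ennreal ((norm (w m z - v z))\<^sup>2)"
        by (intro tendsto_intros tendsto_ennrealI)
      then show ?case by (intro lim_imp_Liminf[symmetric]) auto
    qed
    also have "\<dots> \<le> liminf (\<lambda>i. \<integral>\<^sup>+z. ennreal ((norm (w m z - w (r i) z))\<^sup>2) \<partial>torus_measure)"
      by (intro nn_integral_liminf) measurable
    also have "\<dots> \<le> ennreal e"
    proof (rule Liminf_le[rotated])
      show "\<forall>\<^sub>F i in sequentially. (\<integral>\<^sup>+z. ennreal ((norm (w m z - w (r i) z))\<^sup>2) \<partial>torus_measure) \<le> ennreal e"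
        using eventually_ge_at_top[of N]
      proof eventually_elim
        case (elim i)
        then have "r i \<ge> N" using seq_suble[OF r(1), of i] by linarith
        then show ?case unfolding nn using N[of "r i"] by (intro ennreal_leI) simp
      qed
    qed simp
    finally show ?thesis .
  qed
  have diff: "square_integrable (\<lambda>z. w m z - v z) \<and> mean_square (\<lambda>z. w m z - v z) \<le> e"
    if N: "\<And>n. n \<ge> N \<Longrightarrow> mean_square (\<lambda>z. w m z - w n z) < e" "e > 0" for N m e
  proof
    have k: "(\<integral>\<^sup>+z. ennreal ((norm (w m z - v z))\<^sup>2) \<partial>torus_measure) \<le> ennreal e" using key[OF N(1)] .
    then have "integrable torus_measure (\<lambda>z. (norm (w m z - v z))\<^sup>2)"
      by (intro integrableI_bounded) (auto intro: le_less_trans)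
    then show "square_integrable (\<lambda>z. w m z - v z)" by (simp add: square_integrable_def)
    have "mean_square (\<lambda>z. w m z - v z) = enn2real (\<integral>\<^sup>+z. ennreal ((norm (w m z - v z))\<^sup>2) \<partial>torus_measure)"
      unfolding mean_square_def by (intro integral_eq_nn_integral) auto
    also have "\<dots> \<le> e" using k \<open>e > 0\<close> by (intro enn2real_leI) auto
    finally show "mean_square (\<lambda>z. w m z - v z) \<le> e" .
  qed
  obtain N where "\<forall>m\<ge>N. \<forall>n\<ge>N. mean_square (\<lambda>z. w m z - w n z) < 1" using Cauchy[of 1] by auto
  then have "square_integrable (\<lambda>z. w N z - v z)" using diff[of N N 1] by auto
  from square_integrable_diff[OF sq[of N] this] have v: "square_integrable v" by simp
  have "(\<lambda>n. mean_square (\<lambda>z. w n z - v z)) \<longlonglongrightarrow> 0"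
  proof (rule LIMSEQ_I)
    fix e :: real assume "e > 0"
    then obtain N where N: "\<forall>m\<ge>N. \<forall>n\<ge>N. mean_square (\<lambda>z. w m z - w n z) < e / 2" using Cauchy[of "e/2"] by auto
    show "\<exists>no. \<forall>n\<ge>no. norm (mean_square (\<lambda>z. w n z - v z) - 0) < e"
    proof (intro exI[of _ N] allI impI)
      fix n assume "N \<le> n"
      then have "mean_square (\<lambda>z. w n z - v z) \<le> e / 2"
        using diff[of N n "e/2"] N \<open>e > 0\<close> by auto
      then show "norm (mean_square (\<lambda>z. w n z - v z) - 0) < e" using \<open>e > 0\<close> by simp
    qed
  qed
  with v show ?thesis by (rule that)
qed

section \<open>Weak gradients\<close>

lemma is_weak_gradD:
  assumes "is_weak_grad f g" "torus_smooth \<phi>"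
  shows "(LINT z|torus_measure. f z * torus_grad \<phi> z $ i) = - (LINT z|torus_measure. g z $ i * \<phi> z)"
  using assms by (auto simp: is_weak_grad_def)

lemma is_weak_grad_square_integrable: "is_weak_grad f g \<Longrightarrow> square_integrable g"
  by (simp add: is_weak_grad_def)

lemma torus_smooth_bounded:
  assumes "torus_smooth \<phi>" obtains B where "B > 0" "\<And>z. \<bar>\<phi> z\<bar> \<le> B"
  using torus_continuous_bounded[OF torus_smooth_continuous[OF assms]] that by blast

lemma torus_smooth_grad_bounded:
  assumes "torus_smooth \<phi>" obtains B where "B > 0" "\<And>z. \<bar>torus_grad \<phi> z $ i\<bar> \<le> B"
  using torus_continuous_bounded[OF torus_smooth_grad_continuous[OF assms, of i]] that by blast

lemma integrable_mult_bounded: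
  fixes f g :: "circle ^ 'n::finite \<Rightarrow> real"
  assumes "integrable torus_measure f" "g \<in> borel_measurable borel" "\<And>z. \<bar>g z\<bar> \<le> B"
  shows "integrable torus_measure (\<lambda>z. f z * g z)"
proof (rule Bochner_Integration.integrable_bound[where f="\<lambda>z. B * f z"])
  show "(\<lambda>z. f z * g z) \<in> borel_measurable torus_measure"
    using borel_measurable_integrable[OF assms(1)] assms(2) by simp
  have "0 \<le> B" using assms(3)[of undefined] by linarith
  then show "AE z in torus_measure. norm (f z * g z) \<le> norm (B * f z)"
    using assms(3) by (intro AE_I2) (simp add: abs_mult mult.commute[of "\<bar>f _\<bar>"] mult_right_mono)
qed (use assms in auto)

lemma integrable_mult_smooth:
  assumes "integrable torus_measure f" "torus_smooth \<phi>"
  shows "integrable torus_measure (\<lambda>z. f z * \<phi> z)"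
    and "integrable torus_measure (\<lambda>z. f z * torus_grad \<phi> z $ i)"
proof -
  obtain B where "\<And>z. \<bar>\<phi> z\<bar> \<le> B" using torus_smooth_bounded[OF assms(2)] by blast
  then show "integrable torus_measure (\<lambda>z. f z * \<phi> z)"
    by (rule integrable_mult_bounded[OF assms(1) torus_smooth_measurable[OF assms(2)]])
  obtain C where "\<And>z. \<bar>torus_grad \<phi> z $ i\<bar> \<le> C" using torus_smooth_grad_bounded[OF assms(2)] by blast
  then show "integrable torus_measure (\<lambda>z. f z * torus_grad \<phi> z $ i)"
    by (rule integrable_mult_bounded[OF assms(1) torus_smooth_grad_measurable[OF assms(2)]])
qed

lemma is_weak_grad_combination:
  fixes f1 f2 :: "circle ^ 'n::finite \<Rightarrow> real"
  assumes "square_integrable f1" "square_integrable f2" "is_weak_grad f1 g1" "is_weak_grad f2 g2"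
  shows "is_weak_grad (\<lambda>z. a * f1 z + b * f2 z) (\<lambda>z. a *\<^sub>R g1 z + b *\<^sub>R g2 z)"
  unfolding is_weak_grad_def
proof (intro conjI allI impI)
  have g: "square_integrable g1" "square_integrable g2" using assms(3,4) is_weak_grad_square_integrable by auto
  then show "square_integrable (\<lambda>z. a *\<^sub>R g1 z + b *\<^sub>R g2 z)" by (rule square_integrable_combination)
  fix \<phi> :: "circle ^ 'n \<Rightarrow> real" and i assume \<phi>: "torus_smooth \<phi>"
  note i = integrable_mult_smooth[OF square_integrable_integrable[OF assms(1)] \<phi>]
    integrable_mult_smooth[OF square_integrable_integrable[OF assms(2)] \<phi>]
    integrable_mult_smooth[OF square_integrable_integrable[OF square_integrable_nth[OF g(1)]] \<phi>]
    integrable_mult_smooth[OF square_integrable_integrable[OF square_integrable_nth[OF g(2)]] \<phi>]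
  show "(LINT z|torus_measure. (a * f1 z + b * f2 z) * torus_grad \<phi> z $ i) =
      - (LINT z|torus_measure. (a *\<^sub>R g1 z + b *\<^sub>R g2 z) $ i * \<phi> z)"
    using i is_weak_gradD[OF assms(3) \<phi>, of i] is_weak_gradD[OF assms(4) \<phi>, of i]
    by (simp add: distrib_right mult.assoc)
qed

lemma is_weak_grad_zero: "is_weak_grad (\<lambda>_. 0) (\<lambda>_. 0)"
  by (simp add: is_weak_grad_def square_integrable_def)

lemma is_weak_grad_cong_AE:
  fixes f f' :: "circle ^ 'n::finite \<Rightarrow> real"
  assumes "is_weak_grad f g" "AE z in torus_measure. f z = f' z"
    and [measurable]: "f \<in> borel_measurable borel" "f' \<in> borel_measurable borel"
  shows "is_weak_grad f' g"
  unfolding is_weak_grad_def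
proof (intro conjI allI impI)
  show "square_integrable g" using assms(1) is_weak_grad_square_integrable by auto
  fix \<phi> :: "circle ^ 'n \<Rightarrow> real" and i assume \<phi>: "torus_smooth \<phi>"
  note [measurable] = torus_smooth_grad_measurable[OF \<phi>]
  have "(LINT z|torus_measure. f' z * torus_grad \<phi> z $ i) = (LINT z|torus_measure. f z * torus_grad \<phi> z $ i)"
    using assms(2) by (intro integral_cong_AE) auto
  then show "(LINT z|torus_measure. f' z * torus_grad \<phi> z $ i) = - (LINT z|torus_measure. g z $ i * \<phi> z)"
    using is_weak_gradD[OF assms(1) \<phi>] by simp
qed

text \<open>
  The difference of two weak gradients is orthogonal to all smooth functions.
\<close>

lemma is_weak_grad_unique:
  assumes "is_weak_grad f g1" "is_weak_grad f g2"
  shows "AE z in torus_measure. g1 z = g2 z"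
proof -
  have g: "square_integrable g1" "square_integrable g2" using assms is_weak_grad_square_integrable by auto
  have "AE z in torus_measure. g1 z $ i - g2 z $ i = 0" for i
  proof (rule AE_zero_if_orthogonal_to_smooth)
    have i: "integrable torus_measure (\<lambda>z. g1 z $ i)" "integrable torus_measure (\<lambda>z. g2 z $ i)"
      using g by (auto intro: square_integrable_integrable square_integrable_nth)
    then show "integrable torus_measure (\<lambda>z. g1 z $ i - g2 z $ i)" by simp
    fix \<phi> assume \<phi>: "torus_smooth (\<phi> :: circle ^ 'a \<Rightarrow> real)"
    show "(LINT z|torus_measure. (g1 z $ i - g2 z $ i) * \<phi> z) = 0"
      using is_weak_gradD[OF assms(1) \<phi>, of i] is_weak_gradD[OF assms(2) \<phi>, of i]
        integrable_mult_smooth[OF i(1) \<phi>] integrable_mult_smooth[OF i(2) \<phi>]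
      by (simp add: left_diff_distrib)
  qed
  then have "AE z in torus_measure. \<forall>i. g1 z $ i - g2 z $ i = 0"
    by (subst AE_all_countable) auto
  then show ?thesis by eventually_elim (simp add: vec_eq_iff)
qed

lemma is_weak_grad_weak_grad: "f \<in> H1 \<Longrightarrow> is_weak_grad f (weak_grad f)"
  unfolding H1_def weak_grad_def by (auto intro: someI_ex[of "is_weak_grad f"])

text \<open>
  Convergence in \<open>L\<^sup>2\<close> suffices to pass to the limit against a bounded function. It is used for the
  defining equation of weak gradients and for means.
\<close>

lemma integral_mult_tendsto:
  fixes f :: "nat \<Rightarrow> circle ^ 'n::finite \<Rightarrow> real"
  assumes "\<And>n. square_integrable (f n)" "square_integrable u"
    and lim: "(\<lambda>n. mean_square (\<lambda>z. f n z - u z)) \<longlonglongrightarrow> 0"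
    and b: "b \<in> borel_measurable borel" "\<And>z. \<bar>b z\<bar> \<le> B"
  shows "(\<lambda>n. LINT z|torus_measure. f n z * b z) \<longlonglongrightarrow> (LINT z|torus_measure. u z * b z)"
proof (rule Lim_null_comparison[THEN LIM_zero_cancel])
  have B: "0 \<le> B" using b(2)[of undefined] by linarith
  note i = integrable_mult_bounded[OF square_integrable_integrable[OF assms(1)] b]
    integrable_mult_bounded[OF square_integrable_integrable[OF assms(2)] b]
  note sd = square_integrable_diff[OF assms(1,2)]
  show "\<forall>\<^sub>F n in sequentially. norm ((LINT z|torus_measure. f n z * b z) - (LINT z|torus_measure. u z * b z))
      \<le> B * sqrt (mean_square (\<lambda>z. f n z - u z))"
  proof (intro always_eventually allI)
    fix n
    have "(LINT z|torus_measure. f n z * b z) - (LINT z|torus_measure. u z * b z) = (LINT z|torus_measure. (f n z - u z) * b z)"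
      using i by (simp add: left_diff_distrib)
    also have "\<bar>\<dots>\<bar> \<le> (LINT z|torus_measure. norm ((f n z - u z) * b z))"
      unfolding real_norm_def[symmetric] by (rule integral_norm_bound)
    also have "\<dots> \<le> (LINT z|torus_measure. B * norm (f n z - u z))"
      using square_integrable_integrable[OF sd[of n]] B b(2)
      by (intro integral_mono_AE') (auto simp: abs_mult mult.commute[of B] intro!: mult_left_mono)
    also have "\<dots> = B * (LINT z|torus_measure. norm (f n z - u z))" by simp
    also have "\<dots> \<le> B * sqrt (mean_square (\<lambda>z. f n z - u z))"
      by (intro mult_left_mono mean_norm_le_mean_square sd B)
    finally show "norm ((LINT z|torus_measure. f n z * b z) - (LINT z|torus_measure. u z * b z))
      \<le> B * sqrt (mean_square (\<lambda>z. f n z - u z))" by simp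
  qed
  show "(\<lambda>n. B * sqrt (mean_square (\<lambda>z. f n z - u z))) \<longlonglongrightarrow> 0"
    using tendsto_mult_right_zero[OF tendsto_real_sqrt[OF lim, simplified]] by simp
qed

text \<open>
  The gradient is a closed operator in \<open>L\<^sup>2\<close>.
\<close>

lemma is_weak_grad_limit:
  fixes u :: "circle ^ 'n::finite \<Rightarrow> real"
  assumes h: "\<And>n. square_integrable (h n)" "square_integrable u"
    and hw: "\<And>n. is_weak_grad (h n) (w n)" and v: "square_integrable v"
    and lim: "(\<lambda>n. mean_square (\<lambda>z. h n z - u z)) \<longlonglongrightarrow> 0" "(\<lambda>n. mean_square (\<lambda>z. w n z - v z)) \<longlonglongrightarrow> 0"
  shows "is_weak_grad u v"
  unfolding is_weak_grad_def
proof (intro conjI allI impI v)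
  fix \<phi> :: "circle ^ 'n \<Rightarrow> real" and i assume \<phi>: "torus_smooth \<phi>"
  obtain B where B: "\<And>z. \<bar>\<phi> z\<bar> \<le> B" using torus_smooth_bounded[OF \<phi>] by blast
  obtain B' where B': "\<And>z. \<bar>torus_grad \<phi> z $ i\<bar> \<le> B'" using torus_smooth_grad_bounded[OF \<phi>] by blast
  have w: "square_integrable (w n)" for n using hw is_weak_grad_square_integrable by auto
  have "(\<lambda>n. mean_square (\<lambda>z. w n z $ i - v z $ i)) \<longlonglongrightarrow> 0"
  proof (rule tendsto_sandwich[OF _ _ tendsto_const lim(2)])
    show "\<forall>\<^sub>F n in sequentially. mean_square (\<lambda>z. w n z $ i - v z $ i) \<le> mean_square (\<lambda>z. w n z - v z)"
    proof (intro always_eventually allI)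
      fix n
      have "mean_square (\<lambda>z. w n z $ i - v z $ i) \<le> 1 * mean_square (\<lambda>z. w n z - v z) + 0 * mean_square (\<lambda>z. w n z - v z)"
      proof (rule mean_square_le_combination)
        show "(\<lambda>z. w n z $ i - v z $ i) \<in> borel_measurable borel"
          by (intro square_integrable_measurable square_integrable_diff square_integrable_nth w v)
        show "(norm (w n z $ i - v z $ i))\<^sup>2 \<le> 1 * (norm (w n z - v z))\<^sup>2 + 0 * (norm (w n z - v z))\<^sup>2" for z
          using power_mono[OF component_le_norm_cart[of "w n z - v z" i], of 2] by simp
      qed (intro square_integrable_diff w v)+
      then show "mean_square (\<lambda>z. w n z $ i - v z $ i) \<le> mean_square (\<lambda>z. w n z - v z)" by simp
    qed
  qed auto
  then have "(\<lambda>n. LINT z|torus_measure. w n z $ i * \<phi> z) \<longlonglongrightarrow> (LINT z|torus_measure. v z $ i * \<phi> z)"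
    by (intro integral_mult_tendsto[where B=B] square_integrable_nth w v torus_smooth_measurable \<phi> B)
  from tendsto_minus[OF this] have 1: "(\<lambda>n. LINT z|torus_measure. h n z * torus_grad \<phi> z $ i) \<longlonglongrightarrow> - (LINT z|torus_measure. v z $ i * \<phi> z)"
    using is_weak_gradD[OF hw \<phi>] by simp
  have 2: "(\<lambda>n. LINT z|torus_measure. h n z * torus_grad \<phi> z $ i) \<longlonglongrightarrow> (LINT z|torus_measure. u z * torus_grad \<phi> z $ i)"
    by (rule integral_mult_tendsto[OF h lim(1) torus_smooth_grad_measurable[OF \<phi>] B'])
  show "(LINT z|torus_measure. u z * torus_grad \<phi> z $ i) = - (LINT z|torus_measure. v z $ i * \<phi> z)"
    using LIMSEQ_unique[OF 2 1] .
qed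

section \<open>Lower semicontinuity by convexity\<close>

lemma mean_square_midpoint_le:
  fixes f g u :: "circle ^ 'n::finite \<Rightarrow> real"
  assumes "square_integrable f" "square_integrable g" "square_integrable u"
    and "mean_square (\<lambda>z. f z - u z) \<le> e" "mean_square (\<lambda>z. g z - u z) \<le> e"
  shows "mean_square (\<lambda>z. (1 / 2 * f z + 1 / 2 * g z) - u z) \<le> e"
proof -
  have fg: "square_integrable (\<lambda>z. 1 / 2 * f z + 1 / 2 * g z)"
    using square_integrable_combination[OF assms(1,2), of "1/2" "1/2"] by simp
  have "mean_square (\<lambda>z. (1 / 2 * f z + 1 / 2 * g z) - u z)
      \<le> 1 / 2 * mean_square (\<lambda>z. f z - u z) + 1 / 2 * mean_square (\<lambda>z. g z - u z)"
  proof (rule mean_square_le_combination)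
    show "(\<lambda>z. (1 / 2 * f z + 1 / 2 * g z) - u z) \<in> borel_measurable borel"
      by (intro square_integrable_measurable square_integrable_diff fg assms)
    fix z
    have "0 \<le> (f z - g z)\<^sup>2" by simp
    then show "(norm ((1 / 2 * f z + 1 / 2 * g z) - u z))\<^sup>2 \<le> 1 / 2 * (norm (f z - u z))\<^sup>2 + 1 / 2 * (norm (g z - u z))\<^sup>2"
      by (simp add: power2_eq_square algebra_simps)
  qed (intro square_integrable_diff assms)+
  then show ?thesis using assms(4,5) by simp
qed

text \<open>
  The assumption on midpoints is uniform convexity. For \<open>\<epsilon> > 0\<close> let \<open>S \<epsilon>\<close> be the set of functions with
  energy at most \<open>m + \<epsilon>\<close> and squared distance at most \<open>\<epsilon>\<close> from \<open>u\<close>. It contains the midpoint of any two of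
  its elements, and its infimal energy increases to a finite limit as \<open>\<epsilon>\<close> decreases. If two elements are
  almost minimal in their sets, then their midpoint cannot have much less energy, so by uniform
  convexity their gradients are close. Almost minimal elements thus converge to \<open>u\<close> together with
  their gradients.
\<close>

lemma weak_grad_relaxation:
  fixes \<Phi> :: "(circle ^ 'n::finite \<Rightarrow> real ^ 'n) \<Rightarrow> real" and u :: "circle ^ 'n \<Rightarrow> real"
  assumes c: "c > 0"
    and par: "\<And>w1 w2. square_integrable w1 \<Longrightarrow> square_integrable w2 \<Longrightarrow>
      2 * \<Phi> (\<lambda>z. (1 / 2) *\<^sub>R w1 z + (1 / 2) *\<^sub>R w2 z) \<le> \<Phi> w1 + \<Phi> w2 - c * mean_square (\<lambda>z. w1 z - w2 z)"
    and nonneg: "\<And>w. 0 \<le> \<Phi> w"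
    and cont: "\<And>\<delta>. \<delta> > 0 \<Longrightarrow> \<exists>C. \<forall>w1 w2. square_integrable w1 \<longrightarrow> square_integrable w2 \<longrightarrow>
      \<Phi> w1 \<le> (1 + \<delta>) * \<Phi> w2 + C * mean_square (\<lambda>z. w2 z - w1 z)"
    and u: "square_integrable u"
    and approx: "\<And>\<epsilon>. \<epsilon> > 0 \<Longrightarrow> \<exists>h w. square_integrable h \<and> is_weak_grad h w \<and> \<Phi> w \<le> m + \<epsilon> \<and> mean_square (\<lambda>z. h z - u z) \<le> \<epsilon>"
  obtains v where "is_weak_grad u v" "\<Phi> v \<le> m"
proof -
  define S where "S \<epsilon> = {(h, w). square_integrable h \<and> is_weak_grad h w \<and> \<Phi> w \<le> m + \<epsilon> \<and> mean_square (\<lambda>z. h z - u z) \<le> \<epsilon>}" for \<epsilon>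
  define e where "e n = inverse (real (Suc n))" for n
  define A where "A n = Inf ((\<lambda>p. \<Phi> (snd p)) ` S (e n))" for n
  have e: "e n > 0" for n by (simp add: e_def)
  have e_mono: "n \<le> k \<Longrightarrow> e k \<le> e n" for n k by (simp add: e_def)
  have e_lim: "e \<longlonglongrightarrow> 0" unfolding e_def by (rule LIMSEQ_inverse_real_of_nat)
  have S_ne: "S (e n) \<noteq> {}" for n using approx[OF e[of n]] by (auto simp: S_def)
  have S_mono: "n \<le> k \<Longrightarrow> S (e k) \<subseteq> S (e n)" for n k
    using e_mono[of n k] by (auto simp: S_def)
  have bdd: "bdd_below ((\<lambda>p. \<Phi> (snd p)) ` X)" for X
    using nonneg by (intro bdd_belowI[of _ 0]) auto
  have A_le: "A n \<le> \<Phi> w" if "(h, w) \<in> S (e n)" for n h w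
    unfolding A_def using that by (intro cInf_lower bdd) (auto intro!: image_eqI[of _ _ "(h, w)"])
  have "incseq A"
    unfolding A_def by (intro incseq_SucI cInf_superset_mono bdd image_mono S_mono) (use S_ne in auto)
  moreover have "A n \<le> m + 1" for n
  proof -
    obtain h w where "(h, w) \<in> S (e n)" using S_ne[of n] by auto
    then have "A n \<le> \<Phi> w" "\<Phi> w \<le> m + e n" by (auto simp: A_le S_def)
    then show ?thesis using e_mono[of 0 n] by (simp add: e_def)
  qed
  ultimately obtain L where "A \<longlonglongrightarrow> L" using incseq_convergent[of A "m + 1"] by blast
  then have A_Cauchy: "Cauchy A" by (rule LIMSEQ_imp_Cauchy)
  have "\<exists>p\<in>S (e n). \<Phi> (snd p) < A n + e n" for n
    using cInf_lessD[of "(\<lambda>p. \<Phi> (snd p)) ` S (e n)" "A n + e n"] S_ne[of n] e[of n] by (auto simp: A_def)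
  then obtain p where p: "\<And>n. p n \<in> S (e n)" "\<And>n. \<Phi> (snd (p n)) < A n + e n" by metis
  define h where "h n = fst (p n)" for n
  define w where "w n = snd (p n)" for n
  have hw: "(h n, w n) \<in> S (e n)" "\<Phi> (w n) < A n + e n" for n
    using p[of n] by (auto simp: h_def w_def)
  have h: "square_integrable (h n)" and hw': "is_weak_grad (h n) (w n)" and \<Phi>w: "\<Phi> (w n) \<le> m + e n"
    and hu: "mean_square (\<lambda>z. h n z - u z) \<le> e n" for n
    using hw(1)[of n] by (auto simp: S_def)
  have w: "square_integrable (w n)" for n using hw' by (rule is_weak_grad_square_integrable)
  define D where "D n k = c * mean_square (\<lambda>z. w n z - w k z)" for n k
  have D: "0 \<le> D n k" for n k using c by (simp add: D_def)
  have D_commute: "D n k = D k n" for n k by (simp add: D_def mean_square_diff_commute[of "w n"])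
  \<comment> \<open>The midpoint of the \<open>n\<close>-th and \<open>k\<close>-th elements lies in \<open>S (e n)\<close>, so its energy is at least \<open>A n\<close>.\<close>
  have step: "D n k \<le> A k - A n + 2 * e n" if nk: "n \<le> k" for n k
  proof -
    define h' where "h' = (\<lambda>z. 1 / 2 * h n z + 1 / 2 * h k z)"
    define w' where "w' = (\<lambda>z. (1 / 2) *\<^sub>R w n z + (1 / 2) *\<^sub>R w k z)"
    have par': "2 * \<Phi> w' \<le> \<Phi> (w n) + \<Phi> (w k) - D n k"
      unfolding w'_def D_def by (intro par w)
    then have "\<Phi> w' \<le> m + e n" using D[of n k] \<Phi>w[of n] \<Phi>w[of k] e_mono[OF nk] by linarith
    moreover have "mean_square (\<lambda>z. h' z - u z) \<le> e n"
      unfolding h'_def using hu[of n] hu[of k] e_mono[OF nk]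
      by (intro mean_square_midpoint_le h u) auto
    moreover have "square_integrable h'"
      unfolding h'_def using square_integrable_combination[OF h h, of "1/2" n "1/2" k] by simp
    moreover have "is_weak_grad h' w'"
      unfolding h'_def w'_def by (intro is_weak_grad_combination h hw')
    ultimately have "(h', w') \<in> S (e n)" by (simp add: S_def)
    then have "A n \<le> \<Phi> w'" by (rule A_le)
    then show ?thesis using par' hw(2)[of n] hw(2)[of k] e_mono[OF nk] by linarith
  qed
  have sym: "D n k \<le> \<bar>A k - A n\<bar> + 2 * e n + 2 * e k" for n k
  proof (cases "n \<le> k")
    case True
    show ?thesis using step[OF True] e[of k] by linarith
  next
    case False
    then show ?thesis using step[of k n] e[of n] D_commute[of n k] by linarith
  qed
  have "\<exists>N. \<forall>i\<ge>N. \<forall>j\<ge>N. mean_square (\<lambda>z. w i z - w j z) < r" if r: "r > 0" for r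
  proof -
    obtain N1 where N1: "\<And>i j. i \<ge> N1 \<Longrightarrow> j \<ge> N1 \<Longrightarrow> dist (A i) (A j) < c * r / 6"
      using A_Cauchy r c unfolding Cauchy_def by (metis divide_pos_pos mult_pos_pos zero_less_numeral)
    obtain N2 where N2: "\<And>i. i \<ge> N2 \<Longrightarrow> e i < c * r / 6"
      using order_tendstoD(2)[OF e_lim, of "c * r / 6"] r c by (auto simp: eventually_sequentially)
    have "mean_square (\<lambda>z. w i z - w j z) < r" if "i \<ge> max N1 N2" "j \<ge> max N1 N2" for i j
    proof -
      have "\<bar>A j - A i\<bar> < c * r / 6" "e i < c * r / 6" "e j < c * r / 6"
        using N1[of j i] N2[of i] N2[of j] that by (auto simp: dist_real_def)
      then have "D i j < c * r" using sym[of i j] by linarith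
      then show ?thesis using c by (simp add: D_def)
    qed
    then show ?thesis by blast
  qed
  from L2_complete[OF w this] obtain v where v: "square_integrable v"
    and wv: "(\<lambda>n. mean_square (\<lambda>z. w n z - v z)) \<longlonglongrightarrow> 0" by blast
  have "(\<lambda>n. mean_square (\<lambda>z. h n z - u z)) \<longlonglongrightarrow> 0"
    by (rule tendsto_sandwich[OF _ _ tendsto_const e_lim]) (auto simp: hu)
  then have "is_weak_grad u v"
    by (rule is_weak_grad_limit[OF h u hw' v _ wv])
  moreover have "\<Phi> v \<le> m"
  proof -
    have le: "\<Phi> v \<le> (1 + \<delta>) * m" if \<delta>: "\<delta> > 0" for \<delta>
    proof -
      obtain C where C: "\<And>w1 w2. square_integrable w1 \<Longrightarrow> square_integrable w2 \<Longrightarrow>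
          \<Phi> w1 \<le> (1 + \<delta>) * \<Phi> w2 + C * mean_square (\<lambda>z. w2 z - w1 z)"
        using cont[OF \<delta>] by blast
      have "(\<lambda>n. (1 + \<delta>) * (m + e n) + C * mean_square (\<lambda>z. w n z - v z)) \<longlonglongrightarrow> (1 + \<delta>) * (m + 0) + C * 0"
        by (intro tendsto_add tendsto_mult tendsto_const e_lim wv)
      moreover have "\<Phi> v \<le> (1 + \<delta>) * (m + e n) + C * mean_square (\<lambda>z. w n z - v z)" for n
      proof -
        have "(1 + \<delta>) * \<Phi> (w n) \<le> (1 + \<delta>) * (m + e n)" using \<Phi>w \<delta> by (intro mult_left_mono) auto
        then show ?thesis using C[OF v w, of n] by linarith
      qed
      ultimately show ?thesis by (intro LIMSEQ_le_const[of _ "(1 + \<delta>) * m" "\<Phi> v"]) auto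
    qed
    have "(\<lambda>n. (1 + e n) * m) \<longlonglongrightarrow> (1 + 0) * m"
      by (intro tendsto_add tendsto_mult tendsto_const e_lim)
    then show ?thesis using le[OF e] by (intro LIMSEQ_le_const[of _ m "\<Phi> v"]) auto
  qed
  ultimately show ?thesis by (rule that)
qed

section \<open>Sobolev functions on the circle\<close>

definition circle1 :: "real \<Rightarrow> circle ^ 1" where
  "circle1 t = (\<chi> _. abs_circle t)"

lemma circle1_to_torus: "circle1 t = to_torus (\<chi> _. t)"
  by (simp add: circle1_def to_torus_def)

lemma to_torus_circle1: "to_torus (x :: real ^ 1) = circle1 (x $ 1)"
  by (simp add: circle1_def to_torus_def vec_eq_iff num1_eq1)

lemma circle1_nth [simp]: "circle1 t $ i = abs_circle t"
  by (simp add: circle1_def)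

lemma circle1_coord [simp]: "circle1 (circle_coord (z $ 1)) = z"
  by (simp add: circle1_def vec_eq_iff num1_eq1)

lemma circle1_add_int: "circle1 (t + of_int k) = circle1 t"
  by (simp add: vec_eq_iff abs_circle_eq_iff)

lemma continuous_circle1: "continuous_on UNIV circle1"
  unfolding circle1_def by (intro continuous_vec_lambda continuous_abs_circle)

lemma measurable_circle1 [measurable]: "circle1 \<in> borel_measurable borel"
  by (intro borel_measurable_continuous_onI continuous_circle1)

lemma torus1_measure: "torus_measure = distr unit_measure borel circle1"
  unfolding torus1_distr circle1_def ..

lemma borel_measurable_unit [simp]:
  "f \<in> borel_measurable unit_measure \<longleftrightarrow> f \<in> borel_measurable borel"
  by (simp cong: measurable_cong_sets)

lemma integral_torus1:
  fixes F :: "circle ^ 1 \<Rightarrow> 'b::{banach, second_countable_topology}"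
  assumes "F \<in> borel_measurable borel"
  shows "(LINT z|torus_measure. F z) = (LINT t|unit_measure. F (circle1 t))"
  unfolding torus1_measure using assms by (intro integral_distr) auto

lemma integrable_torus1:
  fixes F :: "circle ^ 1 \<Rightarrow> 'b::{banach, second_countable_topology}"
  assumes "F \<in> borel_measurable borel"
  shows "integrable torus_measure F \<longleftrightarrow> integrable unit_measure (\<lambda>t. F (circle1 t))"
  unfolding torus1_measure using assms by (intro integrable_distr_eq) auto

lemma AE_torus1:
  fixes P :: "circle ^ 1 \<Rightarrow> bool"
  assumes "Measurable.pred borel P"
  shows "(AE z in torus_measure. P z) \<longleftrightarrow> (AE t in unit_measure. P (circle1 t))"
  unfolding torus1_measure using assms by (intro AE_distr_iff) (auto simp: pred_def)

text \<open>
  The inequality for nonnegative extended functions, transferred to real integrals.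
\<close>

lemma integral_Cauchy_Schwarz:
  fixes f g :: "'a \<Rightarrow> real"
  assumes [measurable]: "f \<in> borel_measurable M" "g \<in> borel_measurable M"
    and f: "integrable M (\<lambda>x. (f x)\<^sup>2)" and g: "integrable M (\<lambda>x. (g x)\<^sup>2)"
  shows "\<bar>LINT x|M. f x * g x\<bar> \<le> sqrt (LINT x|M. (f x)\<^sup>2) * sqrt (LINT x|M. (g x)\<^sup>2)"
proof -
  have fg: "integrable M (\<lambda>x. \<bar>f x\<bar> * \<bar>g x\<bar>)"
  proof (rule Bochner_Integration.integrable_bound[OF Bochner_Integration.integrable_add[OF f g]])
    show "AE x in M. norm (\<bar>f x\<bar> * \<bar>g x\<bar>) \<le> norm ((f x)\<^sup>2 + (g x)\<^sup>2)"
    proof (rule AE_I2)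
      fix x
      have "2 * \<bar>f x\<bar> * \<bar>g x\<bar> \<le> (f x)\<^sup>2 + (g x)\<^sup>2"
        using sum_squares_bound[of "\<bar>f x\<bar>" "\<bar>g x\<bar>"] by simp
      moreover have "0 \<le> \<bar>f x\<bar> * \<bar>g x\<bar>" by simp
      ultimately have "\<bar>f x\<bar> * \<bar>g x\<bar> \<le> (f x)\<^sup>2 + (g x)\<^sup>2" by linarith
      then show "norm (\<bar>f x\<bar> * \<bar>g x\<bar>) \<le> norm ((f x)\<^sup>2 + (g x)\<^sup>2)" by simp
    qed
  qed simp
  define I where "I = (LINT x|M. \<bar>f x\<bar> * \<bar>g x\<bar>)"
  have I: "0 \<le> I" unfolding I_def by simp
  have "(ennreal I)\<^sup>2 = (\<integral>\<^sup>+x. ennreal \<bar>f x\<bar> * ennreal \<bar>g x\<bar> \<partial>M)\<^sup>2"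
    unfolding I_def using fg by (subst nn_integral_eq_integral[symmetric]) (auto simp: ennreal_mult)
  also have "\<dots> \<le> (\<integral>\<^sup>+x. (ennreal \<bar>f x\<bar>)\<^sup>2 \<partial>M) * (\<integral>\<^sup>+x. (ennreal \<bar>g x\<bar>)\<^sup>2 \<partial>M)"
    by (intro Cauchy_Schwarz_nn_integral) measurable
  also have "\<dots> = ennreal (LINT x|M. (f x)\<^sup>2) * ennreal (LINT x|M. (g x)\<^sup>2)"
    using f g by (simp add: nn_integral_eq_integral ennreal_power)
  finally have "ennreal (I\<^sup>2) \<le> ennreal ((LINT x|M. (f x)\<^sup>2) * (LINT x|M. (g x)\<^sup>2))"
    using I by (simp add: ennreal_power ennreal_mult)
  then have "I\<^sup>2 \<le> (LINT x|M. (f x)\<^sup>2) * (LINT x|M. (g x)\<^sup>2)"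
    by (subst (asm) ennreal_le_iff) auto
  then have "I \<le> sqrt ((LINT x|M. (f x)\<^sup>2) * (LINT x|M. (g x)\<^sup>2))" by (rule real_le_rsqrt)
  moreover have "\<bar>LINT x|M. f x * g x\<bar> \<le> I"
    unfolding I_def using integral_norm_bound[of M "\<lambda>x. f x * g x"] by (simp add: abs_mult)
  ultimately show ?thesis by (simp add: real_sqrt_mult)
qed

lemma C_k_add_const: "C_k k f \<Longrightarrow> C_k k (\<lambda>x. f x + c)"
proof (cases k)
  case 0
  then show "C_k k f \<Longrightarrow> C_k k (\<lambda>x. f x + c)" by (auto intro!: continuous_intros)
next
  case (Suc n)
  assume *: "C_k k f"
  then have d: "(f has_derivative frechet_derivative f (at x)) (at x)" for x
    using Suc by (simp add: differentiable_on_def frechet_derivative_works)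
  then have "((\<lambda>x. f x + c) has_derivative frechet_derivative f (at x)) (at x)" for x
    using has_derivative_add[OF d has_derivative_const[of c]] by simp
  then have eq: "frechet_derivative (\<lambda>x. f x + c) (at x) = frechet_derivative f (at x)"
    and "(\<lambda>x. f x + c) differentiable (at x)" for x
    using frechet_derivative_at[of "\<lambda>x. f x + c"] differentiableI by (metis, blast)
  with * Suc show ?thesis by (simp add: differentiable_on_def)
qed

lemma C_infinity_add_const: "C_infinity f \<Longrightarrow> C_infinity (\<lambda>x. f x + c)"
  by (simp add: C_infinity_def C_k_add_const)

text \<open>
  An antiderivative of a periodic function is periodic precisely when the function has zero mean.
\<close>

lemma torus_smooth_antiderivative:
  fixes \<phi> :: "circle ^ 1 \<Rightarrow> real"
  assumes \<phi>: "torus_smooth \<phi>" and zero: "(LINT z|torus_measure. \<phi> z) = 0"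
  obtains G where "\<And>t. (G has_real_derivative \<phi> (circle1 t)) (at t)"
    "torus_smooth (\<lambda>z :: circle ^ 1. G (circle_coord (z $ 1)))"
    "\<And>t. G (circle_coord (circle1 t $ 1)) = G t"
    "\<And>z. torus_grad (\<lambda>z :: circle ^ 1. G (circle_coord (z $ 1))) z $ 1 = \<phi> z"
proof -
  define f where "f t = \<phi> (circle1 t)" for t
  have f: "continuous_on UNIV f"
  proof -
    have "continuous_on UNIV (\<lambda>t. (\<chi> _. t) :: real ^ 1)"
      by (intro continuous_vec_lambda continuous_intros)
    from continuous_on_compose2[OF torus_smooth_continuous[OF \<phi>] this] show ?thesis
      unfolding f_def circle1_to_torus by simp
  qed
  then have "\<exists>F. \<forall>x :: real. - \<infinity> < ereal x \<longrightarrow> ereal x < \<infinity> \<longrightarrow> (F has_vector_derivative f x) (at x)"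
    by (intro einterval_antiderivative) (auto simp: continuous_on_eq_continuous_at)
  then obtain G where G: "\<And>t. (G has_vector_derivative f t) (at t)" by auto
  then have G': "(G has_real_derivative f t) (at t)" for t
    by (simp add: has_real_derivative_iff_has_vector_derivative)
  have "integral\<^sup>L lborel (\<lambda>x. indicator {0..1} x *\<^sub>R f x) = G 1 - G 0"
    by (intro integral_FTC_atLeastAtMost) (auto intro: has_vector_derivative_at_within[OF G] continuous_on_subset[OF f])
  moreover have "integral\<^sup>L lborel (\<lambda>x. indicator {0..1} x *\<^sub>R f x) = (LINT t|unit_measure. f t)"
  proof -
    have [measurable]: "f \<in> borel_measurable borel" using f by (rule borel_measurable_continuous_onI)
    have "(LINT t|unit_measure. f t) = (LINT t|lborel. indicator {0..<1} t *\<^sub>R f t)"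
      unfolding unit_measure_def ennreal_indicator[symmetric] by (intro integral_density) auto
    also have "\<dots> = (LINT t|lborel. indicator {0..1} t *\<^sub>R f t)"
      using AE_lborel_singleton[of 1] by (intro integral_cong_AE) (auto simp: indicator_def elim!: eventually_mono)
    finally show ?thesis by simp
  qed
  ultimately have G01: "G 1 = G 0"
    using zero torus_smooth_measurable[OF \<phi>] by (simp add: integral_torus1 f_def)
  have per1: "G (t + 1) = G t" for t
  proof -
    have "((\<lambda>t. G (t + 1) - G t) has_real_derivative 0) (at x)" for x
    proof -
      have "((\<lambda>t. G (t + 1)) has_real_derivative f (x + 1)) (at x)"
        using DERIV_shift[of G "f (x + 1)" x 1] G' by simp
      moreover have "f (x + 1) = f x" using circle1_add_int[of x 1] by (simp add: f_def)
      ultimately show ?thesis using DERIV_diff[OF _ G'[of x]] by fastforce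
    qed
    then have "G (t + 1) - G t = G (0 + 1) - G 0" by (rule DERIV_isconst_all[OF allI])
    then show ?thesis using G01 by simp
  qed
  have per_nat: "G (t + real n) = G t" for t n
  proof (induction n)
    case (Suc n)
    then show ?case using per1[of "t + real n"] by (simp add: algebra_simps)
  qed simp
  have per: "G (t + of_int k) = G t" for t k
  proof (cases "k \<ge> 0")
    case True
    then show ?thesis using per_nat[of t "nat k"] by simp
  next
    case False
    then show ?thesis using per_nat[of "t + of_int k" "nat (- k)"] by simp
  qed
  have coord: "G (circle_coord (circle1 t $ 1)) = G t" for t
  proof -
    have "abs_circle (circle_coord (circle1 t $ 1)) = abs_circle t" by simp
    then have "circle_coord (circle1 t $ 1) - t \<in> \<int>" by (simp only: abs_circle_eq_iff)
    then obtain k where "circle_coord (circle1 t $ 1) - t = of_int k" by (auto elim: Ints_cases)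
    then have "circle_coord (circle1 t $ 1) = t + of_int k" by simp
    then show ?thesis using per by simp
  qed
  have lift: "(\<lambda>x :: real ^ 1. G (circle_coord (to_torus x $ 1))) = (\<lambda>x. G (x $ 1))"
    using coord by (simp add: to_torus_circle1 del: circle1_nth)
  have der: "((\<lambda>x :: real ^ 1. G (x $ 1)) has_derivative (\<lambda>h. \<phi> (to_torus x) * h $ 1)) (at x)" for x
  proof -
    have "(G has_derivative (\<lambda>h. f (x $ 1) * h)) (at (x $ 1))"
      using G' by (simp add: has_field_derivative_def)
    from has_derivative_compose[OF bounded_linear.has_derivative[OF bounded_linear_vec_nth has_derivative_ident] this]
    show ?thesis by (simp add: f_def to_torus_circle1)
  qed
  have fd: "frechet_derivative (\<lambda>x :: real ^ 1. G (x $ 1)) (at x) = (\<lambda>h. \<phi> (to_torus x) * h $ 1)" for x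
    using frechet_derivative_at[OF der] by simp
  have Ck: "C_k k (\<lambda>x :: real ^ 1. G (x $ 1))" for k
  proof (cases k)
    case 0
    then show ?thesis
      using der by (auto intro!: continuous_at_imp_continuous_on has_derivative_continuous)
  next
    case (Suc n)
    have "(\<lambda>x :: real ^ 1. G (x $ 1)) differentiable_on UNIV"
      unfolding differentiable_on_def differentiable_def using der by blast
    moreover have "C_k n (\<lambda>x. \<phi> (to_torus x) * b $ 1)" if "b \<in> Basis" for b :: "real ^ 1"
    proof -
      have "b = axis 1 1" using that by (auto simp: Basis_vec_def num1_eq1)
      then show ?thesis using \<phi> by (simp add: torus_smooth_def C_infinity_def axis_def)
    qed
    ultimately show ?thesis using Suc by (simp add: fd)
  qed
  have "C_infinity (\<lambda>x :: real ^ 1. G (x $ 1))" using Ck by (simp add: C_infinity_def)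
  then have "torus_smooth (\<lambda>z :: circle ^ 1. G (circle_coord (z $ 1)))"
    unfolding torus_smooth_def by (subst lift)
  moreover have "torus_grad (\<lambda>z :: circle ^ 1. G (circle_coord (z $ 1))) z $ 1 = \<phi> z" for z
    using torus_grad_to_torus[of "\<lambda>z. G (circle_coord (z $ 1))" "torus_coord z" 1]
    unfolding lift fd by (simp add: axis_def)
  ultimately show ?thesis using G' coord that unfolding f_def by blast
qed

text \<open>
  The lemma of du Bois-Reymond. Let \<open>R\<close> be the primitive of the weak derivative. Integration by parts
  against the antiderivative of a smooth function of zero mean, by Fubini's theorem for \<open>R\<close> and by
  definition for \<open>r\<close>, shows that \<open>r - R\<close> is orthogonal to every smooth function of zero mean, hence
  constant almost everywhere.
\<close>

lemma H1_circle_primitive: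
  fixes r :: "circle ^ 1 \<Rightarrow> real" and s :: "circle ^ 1 \<Rightarrow> real ^ 1"
  assumes r: "square_integrable r" and rs: "is_weak_grad r s"
  obtains c where "AE t in unit_measure. r (circle1 t) = c + (LINT \<tau>|unit_measure. indicator {..<t} \<tau> * s (circle1 \<tau>) $ 1)"
proof -
  define s' where "s' t = s (circle1 t) $ 1" for t
  define R where "R t = (LINT \<tau>|unit_measure. indicator {..<t} \<tau> * s' \<tau>)" for t
  have sq: "square_integrable (\<lambda>z. s z $ 1)" using rs by (intro square_integrable_nth is_weak_grad_square_integrable)
  have sm[measurable]: "(\<lambda>z. s z $ 1) \<in> borel_measurable borel" using sq by (rule square_integrable_measurable)
  have s'm[measurable]: "s' \<in> borel_measurable borel"
    unfolding s'_def by (rule measurable_compose[OF measurable_circle1 sm])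
  have rm[measurable]: "r \<in> borel_measurable borel" using r by (rule square_integrable_measurable)
  have s'i: "integrable unit_measure s'"
    unfolding s'_def using square_integrable_integrable[OF sq] sm by (subst integrable_torus1[symmetric]) auto
  interpret P: pair_sigma_finite unit_measure unit_measure ..
  have Rm[measurable]: "R \<in> borel_measurable borel"
  proof -
    have "R \<in> borel_measurable unit_measure"
      unfolding R_def by (intro unit_measure.borel_measurable_lebesgue_integral) (simp add: indicator_def)
    then show ?thesis by simp
  qed
  have Rb: "\<bar>R t\<bar> \<le> (LINT \<tau>|unit_measure. \<bar>s' \<tau>\<bar>)" for t
  proof -
    have "\<bar>R t\<bar> \<le> (LINT \<tau>|unit_measure. norm (indicator {..<t} \<tau> * s' \<tau>))"
      unfolding R_def real_norm_def[symmetric] by (rule integral_norm_bound)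
    also have "\<dots> \<le> (LINT \<tau>|unit_measure. \<bar>s' \<tau>\<bar>)"
      using s'i by (intro integral_mono_AE') (auto simp: indicator_def)
    finally show ?thesis .
  qed
  have Ri: "integrable unit_measure R"
    using Rb by (intro unit_measure.integrable_const_bound[where B="LINT \<tau>|unit_measure. \<bar>s' \<tau>\<bar>"]) auto
  \<comment> \<open>The weak derivative tested with the constant 1.\<close>
  have s'0: "(LINT t|unit_measure. s' t) = 0"
  proof -
    have "torus_grad (\<lambda>_. 1) z $ 1 = 0" for z :: "circle ^ 1"
      using torus_grad_to_torus[of "\<lambda>_. 1" "torus_coord z" 1] frechet_derivative_const by (simp add: fun_eq_iff)
    then show ?thesis
      using is_weak_gradD[OF rs torus_smooth_const[of 1], of 1] sm by (simp add: integral_torus1 s'_def)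
  qed
  define H where "H z = r z - R (circle_coord (z $ 1))" for z :: "circle ^ 1"
  have Hm[measurable]: "H \<in> borel_measurable borel"
    unfolding H_def by measurable
  have H_circle1: "AE t in unit_measure. H (circle1 t) = r (circle1 t) - R t"
    using AE_unit_measure by eventually_elim (simp add: H_def circle_coord_abs)
  have Hi: "integrable torus_measure H"
  proof -
    have "integrable torus_measure (\<lambda>z :: circle ^ 1. R (circle_coord (z $ 1)))"
      using Rb by (intro torus.integrable_const_bound[where B="LINT \<tau>|unit_measure. \<bar>s' \<tau>\<bar>"]) auto
    then show ?thesis unfolding H_def using square_integrable_integrable[OF r] by simp
  qed
  define c where "c = (LINT z|torus_measure. H z)"
  have orth0: "(LINT z|torus_measure. H z * \<phi> z) = 0"
    if \<phi>: "torus_smooth \<phi>" and zero: "(LINT z|torus_measure. \<phi> z) = 0" for \<phi>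
  proof -
    note [measurable] = torus_smooth_measurable[OF \<phi>]
    obtain G where G: "\<And>t. (G has_real_derivative \<phi> (circle1 t)) (at t)"
      and smooth: "torus_smooth (\<lambda>z :: circle ^ 1. G (circle_coord (z $ 1)))"
      and coord: "\<And>t. G (circle_coord (circle1 t $ 1)) = G t"
      and grad: "\<And>z. torus_grad (\<lambda>z :: circle ^ 1. G (circle_coord (z $ 1))) z $ 1 = \<phi> z"
      using torus_smooth_antiderivative[OF \<phi> zero] by blast
    have contG: "continuous_on UNIV G"
      using G by (intro continuous_at_imp_continuous_on ballI DERIV_isCont) auto
    have [measurable]: "G \<in> borel_measurable borel" using contG by (rule borel_measurable_continuous_onI)
    obtain B where B: "\<And>z. \<bar>\<phi> z\<bar> \<le> B" using torus_smooth_bounded[OF \<phi>] by blast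
    obtain B' where B': "\<And>z :: circle ^ 1. \<bar>G (circle_coord (z $ 1))\<bar> \<le> B'" using torus_smooth_bounded[OF smooth] by blast
    have B'': "\<bar>G t\<bar> \<le> B'" for t using B'[of "circle1 t"] coord[of t] by simp
    have s'G: "integrable unit_measure (\<lambda>\<tau>. s' \<tau> * G \<tau>)"
    proof (rule Bochner_Integration.integrable_bound[OF integrable_mult_right[OF s'i, of B']])
      show "AE \<tau> in unit_measure. norm (s' \<tau> * G \<tau>) \<le> norm (B' * s' \<tau>)"
      proof (rule AE_I2)
        fix \<tau>
        have "\<bar>G \<tau>\<bar> * \<bar>s' \<tau>\<bar> \<le> \<bar>B'\<bar> * \<bar>s' \<tau>\<bar>"
          by (rule mult_right_mono[OF order_trans[OF B'' abs_ge_self]]) simp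
        then show "norm (s' \<tau> * G \<tau>) \<le> norm (B' * s' \<tau>)" by (simp add: abs_mult mult.commute)
      qed
    qed simp
    have 1: "(LINT t|unit_measure. r (circle1 t) * \<phi> (circle1 t)) = - (LINT t|unit_measure. s' t * G t)"
    proof -
      have "(LINT z|torus_measure. r z * \<phi> z) = - (LINT z|torus_measure. s z $ 1 * G (circle_coord (z $ 1)))"
        using is_weak_gradD[OF rs smooth, of 1] grad by simp
      moreover have "(\<lambda>z. s z $ 1 * G (circle_coord (z $ 1))) \<in> borel_measurable borel"
        by (intro borel_measurable_times sm) measurable
      ultimately show ?thesis
        using coord by (simp add: integral_torus1 s'_def)
    qed
    have 2: "(LINT t|unit_measure. R t * \<phi> (circle1 t)) = - (LINT t|unit_measure. s' t * G t)"
    proof -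
      let ?f = "\<lambda>t \<tau>. indicator {..<t} \<tau> * s' \<tau> * \<phi> (circle1 t)"
      have fm: "case_prod ?f \<in> borel_measurable (unit_measure \<Otimes>\<^sub>M unit_measure)"
        by (simp add: indicator_def) 
      have s'i2: "integrable (unit_measure \<Otimes>\<^sub>M unit_measure) (\<lambda>(t, \<tau>). B * s' \<tau>)"
        using s'i by (intro P.Fubini_integrable) (auto simp: abs_mult)
      have "integrable (unit_measure \<Otimes>\<^sub>M unit_measure) (case_prod ?f)"
      proof (rule Bochner_Integration.integrable_bound[OF s'i2 fm], rule AE_I2)
        fix x :: "real \<times> real"
        obtain t \<tau> where x: "x = (t, \<tau>)" by (cases x)
        have "\<bar>indicator {..<t} \<tau> * s' \<tau> * \<phi> (circle1 t)\<bar> \<le> \<bar>s' \<tau>\<bar> * \<bar>\<phi> (circle1 t)\<bar>"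
          by (simp add: abs_mult indicator_def)
        also have "\<dots> \<le> \<bar>s' \<tau>\<bar> * \<bar>B\<bar>"
          by (rule mult_left_mono[OF order_trans[OF B abs_ge_self]]) simp
        finally show "norm (case x of (t, \<tau>) \<Rightarrow> ?f t \<tau>) \<le> norm (case x of (t, \<tau>) \<Rightarrow> B * s' \<tau>)"
          by (simp add: x abs_mult mult.commute)
      qed
      note Fub = P.Fubini_integral[OF this]
      have "(LINT t|unit_measure. R t * \<phi> (circle1 t)) = (LINT t|unit_measure. LINT \<tau>|unit_measure. ?f t \<tau>)"
        by (simp add: R_def)
      also have "\<dots> = (LINT \<tau>|unit_measure. LINT t|unit_measure. ?f t \<tau>)"
        by (rule Fub[symmetric])
      also have "\<dots> = (LINT \<tau>|unit_measure. s' \<tau> * (G 1 - G \<tau>))"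
      proof (rule integral_cong_AE)
        show "AE \<tau> in unit_measure. (LINT t|unit_measure. ?f t \<tau>) = s' \<tau> * (G 1 - G \<tau>)"
          using AE_unit_measure
        proof eventually_elim
          case (elim \<tau>)
          have "(LINT t|unit_measure. ?f t \<tau>) = s' \<tau> * (LINT t|unit_measure. indicator {..<t} \<tau> * \<phi> (circle1 t))"
            by (simp add: mult.assoc mult.left_commute[of _ "s' \<tau>"])
          also have "(LINT t|unit_measure. indicator {..<t} \<tau> * \<phi> (circle1 t))
              = (LINT t|lborel. indicator {0..<1} t *\<^sub>R (indicator {..<t} \<tau> * \<phi> (circle1 t)))"
            unfolding unit_measure_def ennreal_indicator[symmetric]
            by (intro integral_density) (auto simp: indicator_def)
          also have "\<dots> = (LINT t|lborel. indicator {\<tau>..1} t *\<^sub>R \<phi> (circle1 t))"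
          proof (rule integral_cong_AE)
            show "AE t in lborel. indicator {0..<1} t *\<^sub>R (indicator {..<t} \<tau> * \<phi> (circle1 t))
                = indicator {\<tau>..1} t *\<^sub>R \<phi> (circle1 t)"
              using AE_lborel_singleton[of 1] AE_lborel_singleton[of \<tau>]
              by eventually_elim (use elim in \<open>auto simp: indicator_def\<close>)
          qed (simp_all add: indicator_def)
          also have "\<dots> = G 1 - G \<tau>"
          proof (rule integral_FTC_atLeastAtMost[where F=G and f="\<lambda>t. \<phi> (circle1 t)"])
            show "(G has_vector_derivative \<phi> (circle1 t)) (at t within {\<tau>..1})" for t
              by (rule has_vector_derivative_at_within[OF G[of t, unfolded has_real_derivative_iff_has_vector_derivative]])
            have "continuous_on UNIV (\<lambda>t. (\<chi> _. t) :: real ^ 1)"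
              by (intro continuous_vec_lambda continuous_intros)
            from continuous_on_compose2[OF torus_smooth_continuous[OF \<phi>] this]
            have "continuous_on UNIV (\<lambda>t. \<phi> (circle1 t))" unfolding circle1_to_torus by simp
            then show "continuous_on {\<tau>..1} (\<lambda>t. \<phi> (circle1 t))" by (rule continuous_on_subset) simp
          qed (use elim in simp)
          finally show ?case .
        qed
      qed (auto simp: indicator_def)
      also have "\<dots> = (LINT \<tau>|unit_measure. s' \<tau> * G 1 - s' \<tau> * G \<tau>)"
        by (simp add: right_diff_distrib)
      also have "\<dots> = - (LINT t|unit_measure. s' t * G t)"
        using s'i s'G s'0 by simp
      finally show ?thesis .
    qed
    have ir: "integrable unit_measure (\<lambda>t. r (circle1 t) * \<phi> (circle1 t))"
      using integrable_mult_smooth(1)[OF square_integrable_integrable[OF r] \<phi>] by (simp add: integrable_torus1)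
    have iR: "integrable unit_measure (\<lambda>t. R t * \<phi> (circle1 t))"
    proof (rule unit_measure.integrable_const_bound[where B="(LINT \<tau>|unit_measure. \<bar>s' \<tau>\<bar>) * B"])
      show "AE t in unit_measure. norm (R t * \<phi> (circle1 t)) \<le> (LINT \<tau>|unit_measure. \<bar>s' \<tau>\<bar>) * B"
        by (intro AE_I2) (simp add: abs_mult Rb B mult_mono')
    qed simp
    have "(LINT z|torus_measure. H z * \<phi> z) = (LINT t|unit_measure. H (circle1 t) * \<phi> (circle1 t))"
      by (rule integral_torus1) measurable
    also have "\<dots> = (LINT t|unit_measure. r (circle1 t) * \<phi> (circle1 t) - R t * \<phi> (circle1 t))"
      using H_circle1 by (intro integral_cong_AE) (auto simp: left_diff_distrib)
    also have "\<dots> = 0" using ir iR 1 2 by simp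
    finally show ?thesis .
  qed
  have "AE z in torus_measure. H z - c = 0"
  proof (rule AE_zero_if_orthogonal_to_smooth)
    show "integrable torus_measure (\<lambda>z. H z - c)" using Hi by simp
    fix \<phi> :: "circle ^ 1 \<Rightarrow> real" assume \<phi>: "torus_smooth \<phi>"
    note [measurable] = torus_smooth_measurable[OF \<phi>]
    obtain B where B: "\<And>z. \<bar>\<phi> z\<bar> \<le> B" using torus_smooth_bounded[OF \<phi>] by blast
    have \<phi>i: "integrable torus_measure \<phi>"
      using B by (intro torus.integrable_const_bound[where B=B]) auto
    define m where "m = (LINT z|torus_measure. \<phi> z)"
    have Hp: "integrable torus_measure (\<lambda>z. H z * \<phi> z)" by (rule integrable_mult_smooth(1)[OF Hi \<phi>])
    have "torus_smooth (\<lambda>z. \<phi> z - m)"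
      using C_infinity_add_const[of _ "- m"] \<phi> by (simp add: torus_smooth_def)
    moreover have "(LINT z|torus_measure. \<phi> z - m) = 0"
      using \<phi>i by (simp add: m_def torus.prob_space[simplified])
    ultimately have "(LINT z|torus_measure. H z * (\<phi> z - m)) = 0" by (rule orth0)
    then show "(LINT z|torus_measure. (H z - c) * \<phi> z) = 0"
      using Hp Hi \<phi>i by (simp add: left_diff_distrib right_diff_distrib c_def m_def mult.commute)
  qed
  then have "AE t in unit_measure. H (circle1 t) - c = 0"
    by (subst (asm) AE_torus1) auto
  with H_circle1 have "AE t in unit_measure. r (circle1 t) = c + R t"
    by eventually_elim simp
  then show ?thesis unfolding R_def s'_def by (rule that)
qed

text \<open>
  Increments of the primitive are integrals of the derivative over intervals and are estimated by the
  Cauchy-Schwarz inequality.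
\<close>

lemma H1_circle_Holder:
  fixes r :: "circle ^ 1 \<Rightarrow> real"
  assumes r: "square_integrable r" and rs: "is_weak_grad r s"
  obtains \<rho> :: "real \<Rightarrow> real" where "AE t in unit_measure. r (circle1 t) = \<rho> t"
    "\<And>a b. \<bar>\<rho> a - \<rho> b\<bar> \<le> sqrt (mean_square s) * sqrt \<bar>a - b\<bar>"
proof -
  define s' where "s' t = s (circle1 t) $ 1" for t
  define R where "R t = (LINT \<tau>|unit_measure. indicator {..<t} \<tau> * s' \<tau>)" for t
  obtain c where c: "AE t in unit_measure. r (circle1 t) = c + R t"
    using H1_circle_primitive[OF assms] unfolding R_def s'_def by blast
  have sq: "square_integrable (\<lambda>z. s z $ 1)" using rs by (intro square_integrable_nth is_weak_grad_square_integrable)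
  have sm[measurable]: "(\<lambda>z. s z $ 1) \<in> borel_measurable borel" using sq by (rule square_integrable_measurable)
  have s'm[measurable]: "s' \<in> borel_measurable borel"
    unfolding s'_def by (rule measurable_compose[OF measurable_circle1 sm])
  have s'i: "integrable unit_measure s'"
    unfolding s'_def using square_integrable_integrable[OF sq] sm by (subst integrable_torus1[symmetric]) auto
  have s'2: "integrable unit_measure (\<lambda>t. (s' t)\<^sup>2)"
    unfolding s'_def using sq sm by (subst integrable_torus1[symmetric]) (auto simp: square_integrable_def)
  have ms: "(LINT t|unit_measure. (s' t)\<^sup>2) = mean_square s"
  proof -
    have "mean_square s = (LINT z|torus_measure. (s z $ 1)\<^sup>2)"
      unfolding mean_square_def by (simp add: norm_vec_def L2_set_def num1_eq1)
    then show ?thesis using sm by (simp add: integral_torus1 s'_def)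
  qed
  have H: "\<bar>R b - R a\<bar> \<le> sqrt (mean_square s) * sqrt (b - a)" if ab: "a \<le> b" for a b
  proof -
    have ii: "integrable unit_measure (\<lambda>\<tau>. indicator {..<t} \<tau> * s' \<tau>)" for t
      by (rule Bochner_Integration.integrable_bound[OF s'i]) (auto simp: indicator_def)
    have "R b - R a = (LINT \<tau>|unit_measure. indicator {..<b} \<tau> * s' \<tau> - indicator {..<a} \<tau> * s' \<tau>)"
      unfolding R_def using ii by simp
    also have "\<dots> = (LINT \<tau>|unit_measure. s' \<tau> * indicator {a..<b} \<tau>)"
      using ab by (intro Bochner_Integration.integral_cong refl) (auto simp: indicator_def)
    also have "\<bar>\<dots>\<bar> \<le> sqrt (LINT t|unit_measure. (s' t)\<^sup>2) * sqrt (LINT t|unit_measure. (indicator {a..<b} t)\<^sup>2)"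
    proof (rule integral_Cauchy_Schwarz[OF _ _ s'2])
      show "integrable unit_measure (\<lambda>t. (indicator {a..<b} t :: real)\<^sup>2)"
        by (rule unit_measure.integrable_const_bound[where B=1]) (auto simp: indicator_def)
    qed auto
    also have "(LINT t|unit_measure. (indicator {a..<b} t)\<^sup>2) = measure unit_measure {a..<b}"
      by (simp add: power2_eq_square flip: indicator_inter_arith)
    also have "measure unit_measure {a..<b} \<le> b - a"
    proof -
      have "emeasure unit_measure {a..<b} \<le> emeasure lborel {a..<b}"
        by (simp add: emeasure_unit_measure emeasure_mono del: emeasure_lborel_Ico)
      also have "\<dots> = ennreal (b - a)" using ab by simp
      finally show ?thesis using ab by (simp add: unit_measure.emeasure_eq_measure)
    qed
    finally show ?thesis by (simp add: ms mult_left_mono)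
  qed
  have "\<bar>(c + R a) - (c + R b)\<bar> \<le> sqrt (mean_square s) * sqrt \<bar>a - b\<bar>" for a b
  proof (cases "a \<le> b")
    case True
    then show ?thesis using H[of a b] by (simp add: abs_minus_commute)
  next
    case False
    then show ?thesis using H[of b a] by simp
  qed
  with c show ?thesis by (rule that)
qed

section \<open>Tensor products of functions of one variable\<close>

definition tensor :: "('n::finite \<Rightarrow> circle \<Rightarrow> real) \<Rightarrow> circle ^ 'n \<Rightarrow> real" where
  "tensor r z = (\<Prod>j\<in>UNIV. r j (z $ j))"

abbreviation on_circle1 :: "(circle \<Rightarrow> real) \<Rightarrow> circle ^ 1 \<Rightarrow> real" where
  "on_circle1 a \<equiv> (\<lambda>t. a (t $ 1))"

lemma borel_measurable_on_circle1:
  assumes "on_circle1 a \<in> borel_measurable borel"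
  shows "a \<in> borel_measurable borel"
proof -
  have "(\<lambda>s :: circle. (\<chi> _. s) :: circle ^ 1) \<in> borel_measurable borel"
    by (intro borel_measurable_continuous_onI continuous_vec_lambda continuous_on_id)
  from measurable_compose[OF this assms] show ?thesis by simp
qed

lemma mean_square_on_circle1:
  assumes "on_circle1 a \<in> borel_measurable borel"
  shows "mean_square (on_circle1 a) = (LINT t|unit_measure. (a (abs_circle t))\<^sup>2)"
proof -
  have "(\<lambda>z. (on_circle1 a z)\<^sup>2) \<in> borel_measurable borel" using assms by measurable
  then show ?thesis by (simp add: mean_square_def integral_torus1)
qed

lemma square_integrable_on_circle1:
  assumes "square_integrable (on_circle1 a)"
  shows "integrable unit_measure (\<lambda>t. (a (abs_circle t))\<^sup>2)"
proof -
  have "(\<lambda>z. (on_circle1 a z)\<^sup>2) \<in> borel_measurable borel"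
    using square_integrable_measurable[OF assms] by measurable
  then show ?thesis using assms by (simp add: square_integrable_def integrable_torus1)
qed

lemma tensor_measurable:
  assumes "\<And>j. on_circle1 (a j) \<in> borel_measurable borel"
  shows "tensor a \<in> borel_measurable borel"
proof -
  have "a j \<in> borel_measurable borel" for j by (rule borel_measurable_on_circle1[OF assms])
  then have "(\<lambda>z. a j (z $ j)) \<in> borel_measurable borel" for j
    by (rule measurable_compose[OF measurable_circle_vec_nth])
  then show ?thesis unfolding tensor_def by (rule borel_measurable_prod)
qed

lemma tensor_square_integrable:
  assumes "\<And>j. square_integrable (on_circle1 (a j))"
  shows "square_integrable (tensor a)" "mean_square (tensor a) = (\<Prod>j\<in>UNIV. mean_square (on_circle1 (a j)))"
proof -
  have m: "tensor a \<in> borel_measurable borel"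
    by (intro tensor_measurable square_integrable_measurable assms)
  then have m2: "(\<lambda>z. (tensor a z)\<^sup>2) \<in> borel_measurable borel" by measurable
  have eq: "(tensor a (torus_point x))\<^sup>2 = (\<Prod>j\<in>UNIV. (a j (abs_circle (x j)))\<^sup>2)" for x
    by (simp add: tensor_def prod_power_distrib)
  have "integrable cube_measure (\<lambda>x. (tensor a (torus_point x))\<^sup>2)"
    unfolding eq cube_measure_def
    by (intro cube.product_integrable_prod square_integrable_on_circle1 assms) auto
  then show "square_integrable (tensor a)"
    using m m2 by (simp add: square_integrable_def integrable_torus)
  have "mean_square (tensor a) = (LINT x|cube_measure. (\<Prod>j\<in>UNIV. (a j (abs_circle (x j)))\<^sup>2))"
    using m2 by (simp add: mean_square_def integral_torus eq)
  also have "\<dots> = (\<Prod>j\<in>UNIV. (LINT t|unit_measure. (a j (abs_circle t))\<^sup>2))"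
    unfolding cube_measure_def
    by (intro cube.product_integral_prod square_integrable_on_circle1 assms) auto
  also have "\<dots> = (\<Prod>j\<in>UNIV. mean_square (on_circle1 (a j)))"
    using square_integrable_measurable[OF assms] by (simp add: mean_square_on_circle1)
  finally show "mean_square (tensor a) = (\<Prod>j\<in>UNIV. mean_square (on_circle1 (a j)))" .
qed

text \<open>
  The point on the line parallel to the \<open>j\<close>-th axis through \<open>x\<close> with \<open>j\<close>-th coordinate \<open>v\<close>.
  Restricting a smooth test function to such lines turns it into a test function on the circle.
\<close>

definition slice_point :: "'n::finite \<Rightarrow> ('n \<Rightarrow> real) \<Rightarrow> real ^ 1 \<Rightarrow> real ^ 'n" where
  "slice_point j x v = (\<chi> k. if k = j then v $ 1 else x k)"

lemma slice_point_has_derivative: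
  "(slice_point j x has_derivative (\<lambda>h. (h $ 1) *\<^sub>R axis j 1)) (at v)"
proof -
  have "slice_point j x = (\<lambda>v. (v $ 1) *\<^sub>R axis j 1 + (\<chi> k. if k = j then 0 else x k))"
    by (auto simp: slice_point_def fun_eq_iff vec_eq_iff axis_def)
  moreover have "((\<lambda>v :: real ^ 1. (v $ 1) *\<^sub>R axis j 1 + (\<chi> k. if k = j then 0 else x k)) has_derivative
      (\<lambda>h. (h $ 1) *\<^sub>R axis j 1 + 0)) (at v)"
    by (intro has_derivative_add has_derivative_const has_derivative_scaleR_left
      bounded_linear.has_derivative[OF bounded_linear_vec_nth has_derivative_ident])
  ultimately show ?thesis by simp
qed

lemma has_derivative_slice:
  assumes "(p has_derivative D) (at (slice_point j x v))"
  shows "((\<lambda>v. p (slice_point j x v)) has_derivative (\<lambda>h. h $ 1 *\<^sub>R D (axis j 1))) (at v)"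
  using has_derivative_compose[OF slice_point_has_derivative assms]
  by (simp add: linear_scale[OF has_derivative_linear[OF assms]])

lemma C_k_slice:
  fixes p :: "real ^ 'n::finite \<Rightarrow> real"
  assumes "C_k k p"
  shows "C_k k (\<lambda>v. p (slice_point j x v))"
  using assms
proof (induction k arbitrary: p)
  case 0
  have "continuous_on UNIV (slice_point j x)"
    by (intro continuous_at_imp_continuous_on ballI has_derivative_continuous[OF slice_point_has_derivative])
  with 0 show ?case by (auto intro: continuous_on_compose2)
next
  case (Suc k)
  have d: "(p has_derivative frechet_derivative p (at y)) (at y)" for y
    using Suc.prems by (simp add: differentiable_on_def frechet_derivative_works)
  note ds = has_derivative_slice[OF d, of j x]
  have fd: "frechet_derivative (\<lambda>v. p (slice_point j x v)) (at v)
      = (\<lambda>h. h $ 1 *\<^sub>R frechet_derivative p (at (slice_point j x v)) (axis j 1))" for v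
    using frechet_derivative_at[OF ds] by simp
  have "(\<lambda>v. p (slice_point j x v)) differentiable_on UNIV"
    unfolding differentiable_on_def differentiable_def using ds by blast
  moreover have "C_k k (\<lambda>v. b $ 1 *\<^sub>R frechet_derivative p (at (slice_point j x v)) (axis j 1))"
    if "b \<in> Basis" for b :: "real ^ 1"
  proof -
    have "b = axis 1 1" using that by (auto simp: Basis_vec_def num1_eq1)
    moreover have "C_k k (\<lambda>y. frechet_derivative p (at y) (axis j 1))"
      using Suc.prems by (simp add: axis_in_Basis_iff)
    ultimately show ?thesis using Suc.IH by (simp add: axis_def)
  qed
  ultimately show ?case by (simp add: fd)
qed

definition slice :: "'n::finite \<Rightarrow> ('n \<Rightarrow> real) \<Rightarrow> (circle ^ 'n \<Rightarrow> real) \<Rightarrow> circle ^ 1 \<Rightarrow> real" where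
  "slice j x \<phi> t = \<phi> (\<chi> k. if k = j then t $ 1 else abs_circle (x k))"

lemma slice_to_torus: "slice j x \<phi> (to_torus v) = \<phi> (to_torus (slice_point j x v))"
  unfolding slice_def slice_point_def by (rule arg_cong[of _ _ \<phi>]) (simp add: vec_eq_iff to_torus_def)

lemma slice_circle1: "slice j x \<phi> (circle1 y) = \<phi> (torus_point (x(j := y)))"
  unfolding slice_def by (rule arg_cong[of _ _ \<phi>]) (simp add: vec_eq_iff)

lemma torus_smooth_slice: "torus_smooth \<phi> \<Longrightarrow> torus_smooth (slice j x \<phi>)"
  using C_k_slice[of _ "\<lambda>x. \<phi> (to_torus x)" j x]
  unfolding torus_smooth_def C_infinity_def slice_to_torus by blast

lemma torus_grad_slice:
  assumes "torus_smooth \<phi>"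
  shows "torus_grad (slice j x \<phi>) (circle1 y) $ 1 = torus_grad \<phi> (torus_point (x(j := y))) $ j"
proof -
  define p where "p = (\<lambda>x. \<phi> (to_torus x))"
  have p: "C_infinity p" using assms by (simp add: p_def torus_smooth_def)
  define v :: "real ^ 1" where "v = (\<chi> _. y)"
  have "torus_grad (slice j x \<phi>) (circle1 y) $ 1 = frechet_derivative (\<lambda>v. p (slice_point j x v)) (at v) (axis 1 1)"
    unfolding circle1_to_torus torus_grad_to_torus slice_to_torus p_def v_def ..
  also have "\<dots> = frechet_derivative p (at (slice_point j x v)) (axis j 1)"
    using frechet_derivative_at[OF has_derivative_slice[OF C_infinity_has_derivative[OF p]], of j x v, symmetric]
    by (simp add: axis_def)
  also have "\<dots> = torus_grad \<phi> (to_torus (slice_point j x v)) $ j"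
    unfolding torus_grad_to_torus p_def ..
  also have "to_torus (slice_point j x v) = torus_point (x(j := y))"
    by (simp add: vec_eq_iff slice_point_def v_def to_torus_def)
  finally show ?thesis .
qed

definition tensor_grad :: "('n::finite \<Rightarrow> circle \<Rightarrow> real) \<Rightarrow> ('n \<Rightarrow> circle \<Rightarrow> real) \<Rightarrow> circle ^ 'n \<Rightarrow> real ^ 'n" where
  "tensor_grad r d z = (\<chi> j. tensor (r(j := d j)) z)"

lemma tensor_update: "tensor (r(j := a)) (torus_point (x(j := y))) = a (abs_circle y) * (\<Prod>k\<in>UNIV - {j}. r k (abs_circle (x k)))"
  unfolding tensor_def by (subst prod.remove[of _ j]) (auto intro!: prod.cong)

text \<open>
  Fubini's theorem with the \<open>j\<close>-th coordinate integrated first; the other factors are constants for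
  the inner integral.
\<close>

lemma integral_tensor_slice:
  assumes "square_integrable (tensor (r(j := a)))"
    and b: "b \<in> borel_measurable borel" "\<And>z. \<bar>b z\<bar> \<le> B"
  shows "(LINT z|torus_measure. tensor (r(j := a)) z * b z)
     = (LINT x|(\<Pi>\<^sub>M k\<in>UNIV - {j}. unit_measure). (\<Prod>k\<in>UNIV - {j}. r k (abs_circle (x k))) *
         (LINT y|unit_measure. a (abs_circle y) * b (torus_point (x(j := y)))))"
proof -
  let ?F = "\<lambda>z. tensor (r(j := a)) z * b z"
  have i: "integrable torus_measure ?F"
    by (rule integrable_mult_bounded[OF square_integrable_integrable[OF assms(1)] b])
  have m: "?F \<in> borel_measurable borel" using borel_measurable_integrable[OF i] by simp
  have ins: "insert j (UNIV - {j}) = UNIV" by auto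
  have "(LINT z|torus_measure. ?F z) = (LINT x|cube_measure. ?F (torus_point x))"
    using m by (rule integral_torus)
  also have "\<dots> = (LINT x|(\<Pi>\<^sub>M k\<in>insert j (UNIV - {j}). unit_measure). ?F (torus_point x))"
    unfolding ins cube_measure_def ..
  also have "\<dots> = (LINT x|(\<Pi>\<^sub>M k\<in>UNIV - {j}. unit_measure). LINT y|unit_measure. ?F (torus_point (x(j := y))))"
  proof (rule cube.product_integral_insert)
    show "integrable (\<Pi>\<^sub>M k\<in>insert j (UNIV - {j}). unit_measure) (\<lambda>x. ?F (torus_point x))"
      unfolding ins cube_measure_def[symmetric] using i m by (simp add: integrable_torus)
  qed auto
  finally show ?thesis
    unfolding tensor_update by (simp add: mult.assoc mult.left_commute[of "a x" for x])
qed

text \<open>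
  The \<open>j\<close>-th partial derivative falls on the \<open>j\<close>-th factor only: on each line parallel to the \<open>j\<close>-th
  axis the defining equation of the weak derivative of \<open>r j\<close> is applied to the restricted test
  function. The norm of a tensor product is the product of the norms of its factors.
\<close>

lemma is_weak_grad_tensor:
  fixes r :: "'n::finite \<Rightarrow> circle \<Rightarrow> real"
  assumes r: "\<And>j. square_integrable (on_circle1 (r j))"
    and d: "\<And>j. is_weak_grad (on_circle1 (r j)) (\<lambda>t. \<chi> _. d j (t $ 1))"
  shows "is_weak_grad (tensor r) (tensor_grad r d)"
    and "mean_square (\<lambda>z. tensor_grad r d z $ j)
      = mean_square (on_circle1 (d j)) * (\<Prod>k\<in>UNIV - {j}. mean_square (on_circle1 (r k)))"
proof -
  have ds: "square_integrable (on_circle1 (d j))" for j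
    using square_integrable_nth[OF is_weak_grad_square_integrable[OF d[of j]], of 1] by simp
  have upd: "square_integrable (on_circle1 ((r(j := d j)) k))" for j k
    using r ds by (cases "k = j") auto
  have sq: "square_integrable (tensor (r(j := d j)))"
    "mean_square (tensor (r(j := d j))) = (\<Prod>k\<in>UNIV. mean_square (on_circle1 ((r(j := d j)) k)))" for j
    using upd by (intro tensor_square_integrable; blast)+
  have comp: "(\<lambda>z. tensor_grad r d z $ j) = tensor (r(j := d j))" for j
    by (simp add: tensor_grad_def)
  show "mean_square (\<lambda>z. tensor_grad r d z $ j)
      = mean_square (on_circle1 (d j)) * (\<Prod>k\<in>UNIV - {j}. mean_square (on_circle1 (r k)))"
    unfolding comp sq(2) by (subst prod.remove[of _ j]) (auto intro!: prod.cong)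
  show "is_weak_grad (tensor r) (tensor_grad r d)"
    unfolding is_weak_grad_def
  proof (intro conjI allI impI)
    have m: "tensor_grad r d \<in> borel_measurable borel"
      unfolding tensor_grad_def by (intro borel_measurable_vec_lambda square_integrable_measurable sq)
    have "integrable torus_measure (\<lambda>z. \<Sum>j\<in>UNIV. (norm (tensor_grad r d z $ j))\<^sup>2)"
    proof (intro Bochner_Integration.integrable_sum)
      fix j
      show "integrable torus_measure (\<lambda>z. (norm (tensor_grad r d z $ j))\<^sup>2)"
        using sq(1)[of j] by (simp add: square_integrable_def tensor_grad_def)
    qed
    then show "square_integrable (tensor_grad r d)"
      using m by (simp add: square_integrable_def norm_vec_def L2_set_def sum_nonneg)
    fix \<phi> :: "circle ^ 'n \<Rightarrow> real" and j assume \<phi>: "torus_smooth \<phi>"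
    obtain B where B: "\<And>z. \<bar>\<phi> z\<bar> \<le> B" using torus_smooth_bounded[OF \<phi>] by blast
    obtain B' where B': "\<And>z. \<bar>torus_grad \<phi> z $ j\<bar> \<le> B'" using torus_smooth_grad_bounded[OF \<phi>] by blast
    have parts: "(LINT y|unit_measure. r j (abs_circle y) * torus_grad \<phi> (torus_point (x(j := y))) $ j)
        = - (LINT y|unit_measure. d j (abs_circle y) * \<phi> (torus_point (x(j := y))))" for x
    proof -
      note sm = torus_smooth_slice[OF \<phi>, of j x]
      have "(LINT z|torus_measure. on_circle1 (r j) z * torus_grad (slice j x \<phi>) z $ 1)
          = - (LINT z|torus_measure. on_circle1 (d j) z * slice j x \<phi> z)"
        using is_weak_gradD[OF d sm, of j 1] by simp
      moreover have "(\<lambda>z. on_circle1 (r j) z * torus_grad (slice j x \<phi>) z $ 1) \<in> borel_measurable borel"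
        by (intro borel_measurable_times square_integrable_measurable r torus_smooth_grad_measurable sm)
      moreover have "(\<lambda>z. on_circle1 (d j) z * slice j x \<phi> z) \<in> borel_measurable borel"
        by (intro borel_measurable_times square_integrable_measurable ds torus_smooth_measurable sm)
      ultimately show ?thesis
        by (simp add: integral_torus1 torus_grad_slice[OF \<phi>] slice_circle1)
    qed
    have "(LINT z|torus_measure. tensor r z * torus_grad \<phi> z $ j) = (LINT z|torus_measure. tensor (r(j := r j)) z * torus_grad \<phi> z $ j)"
      by simp
    also have "\<dots> = (LINT x|(\<Pi>\<^sub>M k\<in>UNIV - {j}. unit_measure). (\<Prod>k\<in>UNIV - {j}. r k (abs_circle (x k))) *
         (LINT y|unit_measure. r j (abs_circle y) * torus_grad \<phi> (torus_point (x(j := y))) $ j))"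
      by (rule integral_tensor_slice[OF _ torus_smooth_grad_measurable[OF \<phi>] B']) (simp add: tensor_square_integrable(1)[OF r])
    also have "\<dots> = - (LINT x|(\<Pi>\<^sub>M k\<in>UNIV - {j}. unit_measure). (\<Prod>k\<in>UNIV - {j}. r k (abs_circle (x k))) *
         (LINT y|unit_measure. d j (abs_circle y) * \<phi> (torus_point (x(j := y)))))"
      by (simp add: parts)
    also have "\<dots> = - (LINT z|torus_measure. tensor (r(j := d j)) z * \<phi> z)"
      by (subst integral_tensor_slice[OF sq(1) torus_smooth_measurable[OF \<phi>] B]) simp
    finally show "(LINT z|torus_measure. tensor r z * torus_grad \<phi> z $ j) = - (LINT z|torus_measure. tensor_grad r d z $ j * \<phi> z)"
      by (simp add: comp[unfolded fun_eq_iff, rule_format])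
  qed
qed

section \<open>The functional as a quadratic energy of the gradient\<close>

text \<open>
  Young's inequality. The factor of the first term may be chosen as close to 1 as desired, which
  yields continuity of quadratic energies.
\<close>

lemma norm_add_square_le_weighted:
  fixes x y :: "'b::real_inner"
  assumes "\<delta> > 0"
  shows "(norm (x + y))\<^sup>2 \<le> (1 + \<delta>) * (norm x)\<^sup>2 + (1 + 1 / \<delta>) * (norm y)\<^sup>2"
proof -
  have "0 \<le> (norm (sqrt \<delta> *\<^sub>R x - (1 / sqrt \<delta>) *\<^sub>R y))\<^sup>2" by simp
  also have "\<dots> = \<delta> * (norm x)\<^sup>2 + 1 / \<delta> * (norm y)\<^sup>2 - 2 * (x \<bullet> y)"
    using assms by (simp add: power2_norm_eq_inner inner_diff_left inner_diff_right inner_commute real_sqrt_mult_self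
        flip: mult.assoc power2_eq_square)
  finally show ?thesis
    by (simp add: power2_norm_eq_inner inner_add_left inner_add_right inner_commute algebra_simps)
qed

text \<open>
  \<open>W\<close> stands for the gradient of \<open>V\<close> in \<open>y\<close>. The single bound \<open>c \<le> K + lam\<close> expresses both
  alternatives, a positive kernel and a positive parameter \<open>lam\<close>. One constant \<open>B\<close> bounds \<open>W\<close> and \<open>K\<close>.
\<close>

locale gradient_energy =
  fixes W :: "(circle ^ 'p::finite) \<times> (circle ^ 'd::finite) \<Rightarrow> real ^ 'd"
    and K :: "(circle ^ 'd) \<times> (circle ^ 'd) \<Rightarrow> real"
    and lam B c :: real and \<nu> :: "((circle ^ 'p) \<times> (circle ^ 'd)) measure"
  assumes prob: "prob_space \<nu>" and sets_\<nu>: "sets \<nu> = sets borel"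
    and W_measurable: "W \<in> borel_measurable borel" and W_bound: "\<And>x. norm (W x) \<le> B"
    and K_measurable: "(\<lambda>(x, z). K (snd x, z)) \<in> borel_measurable (\<nu> \<Otimes>\<^sub>M torus_measure)"
    and K_nonneg: "\<And>y z. 0 \<le> K (y, z)" and K_bound: "\<And>y z. K (y, z) \<le> B"
    and lam: "0 \<le> lam" and c: "0 < c" and coercive: "\<And>y z. c \<le> K (y, z) + lam"
begin

interpretation nu: prob_space \<nu> by (rule prob)
interpretation P: pair_prob_space \<nu> torus_measure ..

declare sets_\<nu> [measurable_cong] W_measurable [measurable] K_measurable [measurable]

lemma B_nonneg: "0 \<le> B"
  using norm_ge_zero[of "W undefined"] W_bound[of undefined] by linarith

text \<open>
  Since \<open>\<nu>\<close> is a probability measure, the term with \<open>lam\<close> can be integrated over the product space as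
  well. The energy is then a single integral, and inequalities between energies follow from pointwise
  ones.
\<close>

definition energy_density :: "(circle ^ 'd \<Rightarrow> real ^ 'd) \<Rightarrow> ((circle ^ 'p) \<times> (circle ^ 'd)) \<times> (circle ^ 'd) \<Rightarrow> real" where
  "energy_density w = (\<lambda>(x, z). (norm (W x - w z))\<^sup>2 * K (snd x, z) + lam * (norm (w z))\<^sup>2)"

definition energy :: "(circle ^ 'd \<Rightarrow> real ^ 'd) \<Rightarrow> real" where
  "energy w = (LINT (x, z)|(\<nu> \<Otimes>\<^sub>M torus_measure). (norm (W x - w z))\<^sup>2 * K (snd x, z)) + lam * mean_square w"

lemma pair_norm_square:
  assumes "square_integrable (w :: circle ^ 'd \<Rightarrow> real ^ 'd)"
  shows "integrable (\<nu> \<Otimes>\<^sub>M torus_measure) (\<lambda>(x, z). (norm (w z))\<^sup>2)"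
    and "(LINT (x, z)|(\<nu> \<Otimes>\<^sub>M torus_measure). (norm (w z))\<^sup>2) = mean_square w"
proof -
  have [measurable]: "w \<in> borel_measurable borel" using assms by (rule square_integrable_measurable)
  show i: "integrable (\<nu> \<Otimes>\<^sub>M torus_measure) (\<lambda>(x, z). (norm (w z))\<^sup>2)"
    using assms by (intro P.Fubini_integrable) (auto simp: square_integrable_def)
  show "(LINT (x, z)|(\<nu> \<Otimes>\<^sub>M torus_measure). (norm (w z))\<^sup>2) = mean_square w"
    using P.integral_fst'[OF i] by (simp add: mean_square_def nu.prob_space)
qed

lemma integrable_interaction:
  assumes "square_integrable (w :: circle ^ 'd \<Rightarrow> real ^ 'd)"
  shows "integrable (\<nu> \<Otimes>\<^sub>M torus_measure) (\<lambda>(x, z). (norm (W x - w z))\<^sup>2 * K (snd x, z))"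
proof (rule Bochner_Integration.integrable_bound)
  have [measurable]: "w \<in> borel_measurable borel" using assms by (rule square_integrable_measurable)
  show "integrable (\<nu> \<Otimes>\<^sub>M torus_measure) (\<lambda>p. 2 * B\<^sup>2 * B + 2 * B * (case p of (x, z) \<Rightarrow> (norm (w z))\<^sup>2))"
    using pair_norm_square(1)[OF assms] by simp
  show "(\<lambda>(x, z). (norm (W x - w z))\<^sup>2 * K (snd x, z)) \<in> borel_measurable (\<nu> \<Otimes>\<^sub>M torus_measure)"
    using K_measurable by (simp add: split_beta')
  show "AE p in \<nu> \<Otimes>\<^sub>M torus_measure. norm (case p of (x, z) \<Rightarrow> (norm (W x - w z))\<^sup>2 * K (snd x, z))
      \<le> norm (2 * B\<^sup>2 * B + 2 * B * (case p of (x, z) \<Rightarrow> (norm (w z))\<^sup>2))"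
  proof (rule AE_I2)
    fix p :: "((circle ^ 'p) \<times> (circle ^ 'd)) \<times> (circle ^ 'd)"
    obtain x z where p: "p = (x, z)" by (cases p)
    have "(norm (W x - w z))\<^sup>2 \<le> 2 * (norm (W x))\<^sup>2 + 2 * (norm (w z))\<^sup>2"
      using norm_add_square_le[of "W x" "- w z"] by simp
    also have "\<dots> \<le> 2 * B\<^sup>2 + 2 * (norm (w z))\<^sup>2"
      using power_mono[OF W_bound[of x] norm_ge_zero, of 2] by simp
    finally have "(norm (W x - w z))\<^sup>2 * K (snd x, z) \<le> (2 * B\<^sup>2 + 2 * (norm (w z))\<^sup>2) * B"
      by (intro mult_mono K_bound) (auto simp: K_nonneg)
    also have "\<dots> = 2 * B\<^sup>2 * B + 2 * B * (norm (w z))\<^sup>2" by (simp add: algebra_simps)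
    finally show "norm (case p of (x, z) \<Rightarrow> (norm (W x - w z))\<^sup>2 * K (snd x, z))
      \<le> norm (2 * B\<^sup>2 * B + 2 * B * (case p of (x, z) \<Rightarrow> (norm (w z))\<^sup>2))"
      using B_nonneg by (simp add: p K_nonneg)
  qed
qed

lemma integral_energy_density:
  assumes "square_integrable (w :: circle ^ 'd \<Rightarrow> real ^ 'd)"
  shows "integrable (\<nu> \<Otimes>\<^sub>M torus_measure) (energy_density w)"
    and "energy w = (LINT p|(\<nu> \<Otimes>\<^sub>M torus_measure). energy_density w p)"
proof -
  have eq: "energy_density w = (\<lambda>p. (case p of (x, z) \<Rightarrow> (norm (W x - w z))\<^sup>2 * K (snd x, z)) + lam * (case p of (x, z) \<Rightarrow> (norm (w z))\<^sup>2))"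
    by (auto simp: energy_density_def)
  show "integrable (\<nu> \<Otimes>\<^sub>M torus_measure) (energy_density w)"
    unfolding eq using integrable_interaction[OF assms] pair_norm_square(1)[OF assms] by simp
  show "energy w = (LINT p|(\<nu> \<Otimes>\<^sub>M torus_measure). energy_density w p)"
    unfolding eq energy_def using integrable_interaction[OF assms] pair_norm_square[OF assms] by simp
qed

lemma energy_nonneg: "0 \<le> energy w"
proof -
  have "0 \<le> (LINT (x, z)|(\<nu> \<Otimes>\<^sub>M torus_measure). (norm (W x - w z))\<^sup>2 * K (snd x, z))"
    by (intro Bochner_Integration.integral_nonneg) (auto simp: K_nonneg)
  then show ?thesis using lam by (simp add: energy_def)
qed

lemma energy_le_combination:
  fixes w1 w2 w3 w :: "circle ^ 'd \<Rightarrow> real ^ 'd"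
  assumes "square_integrable w1" "square_integrable w2" "square_integrable w3" "square_integrable w"
    and le: "\<And>x z. a * energy_density w1 (x, z) \<le> b1 * energy_density w2 (x, z) + b2 * energy_density w3 (x, z) + b3 * (norm (w z))\<^sup>2 + b4"
  shows "a * energy w1 \<le> b1 * energy w2 + b2 * energy w3 + b3 * mean_square w + b4"
proof -
  note i = integral_energy_density(1)[OF assms(1)] integral_energy_density(1)[OF assms(2)] integral_energy_density(1)[OF assms(3)] pair_norm_square(1)[OF assms(4)]
  have "a * energy w1 = (LINT p|(\<nu> \<Otimes>\<^sub>M torus_measure). a * energy_density w1 p)"
    using integral_energy_density[OF assms(1)] by simp
  also have "\<dots> \<le> (LINT p|(\<nu> \<Otimes>\<^sub>M torus_measure). b1 * energy_density w2 p + b2 * energy_density w3 p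
      + b3 * (case p of (x, z) \<Rightarrow> (norm (w z))\<^sup>2) + b4)"
  proof (rule integral_mono)
    fix p show "a * energy_density w1 p \<le> b1 * energy_density w2 p + b2 * energy_density w3 p + b3 * (case p of (x, z) \<Rightarrow> (norm (w z))\<^sup>2) + b4"
      using le by (cases p) simp
  qed (use i in simp_all)
  also have "\<dots> = b1 * energy w2 + b2 * energy w3 + b3 * mean_square w + b4"
    using i integral_energy_density(2)[OF assms(2)] integral_energy_density(2)[OF assms(3)] pair_norm_square(2)[OF assms(4)]
    by (simp add: P.prob_space)
  finally show ?thesis .
qed

text \<open>
  The parallelogram identity for each of the two squares, with the weight \<open>K + lam \<ge> c\<close> on the
  remainder.
\<close>

lemma energy_midpoint:
  fixes w1 w2 :: "circle ^ 'd \<Rightarrow> real ^ 'd"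
  assumes "square_integrable w1" "square_integrable w2"
  shows "2 * energy (\<lambda>z. (1 / 2) *\<^sub>R w1 z + (1 / 2) *\<^sub>R w2 z)
    \<le> energy w1 + energy w2 - c / 2 * mean_square (\<lambda>z. w1 z - w2 z)"
proof -
  let ?w = "\<lambda>z. (1 / 2) *\<^sub>R w1 z + (1 / 2) *\<^sub>R w2 z"
  have mid: "2 * (norm (v - ((1 / 2) *\<^sub>R a + (1 / 2) *\<^sub>R b)))\<^sup>2 = (norm (v - a))\<^sup>2 + (norm (v - b))\<^sup>2 - 1 / 2 * (norm (a - b))\<^sup>2"
    for v a b :: "real ^ 'd"
    unfolding power2_norm_eq_inner by (simp add: inner_diff_left inner_diff_right inner_add_left inner_add_right inner_commute algebra_simps)
  have "2 * energy ?w \<le> 1 * energy w1 + 1 * energy w2 + (- (c / 2)) * mean_square (\<lambda>z. w1 z - w2 z) + 0"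
  proof (rule energy_le_combination)
    fix x :: "(circle ^ 'p) \<times> (circle ^ 'd)" and z :: "circle ^ 'd"
    let ?k = "K (snd x, z)"
    have "2 * energy_density ?w (x, z) = (2 * (norm (W x - ?w z))\<^sup>2) * ?k + lam * (2 * (norm (0 - ?w z))\<^sup>2)"
      by (simp only: energy_density_def prod.case diff_0 norm_minus_cancel distrib_left mult.assoc mult.left_commute[of 2])
    also have "\<dots> = energy_density w1 (x, z) + energy_density w2 (x, z) - (?k + lam) / 2 * (norm (w1 z - w2 z))\<^sup>2"
      unfolding mid by (simp add: energy_density_def algebra_simps)
    also have "\<dots> \<le> energy_density w1 (x, z) + energy_density w2 (x, z) - c / 2 * (norm (w1 z - w2 z))\<^sup>2"
      using coercive[of "snd x" z] by (intro diff_left_mono mult_right_mono) auto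
    finally show "2 * energy_density ?w (x, z) \<le> 1 * energy_density w1 (x, z) + 1 * energy_density w2 (x, z) + (- (c / 2)) * (norm (w1 z - w2 z))\<^sup>2 + 0"
      by simp
  qed (intro square_integrable_combination square_integrable_diff assms)+
  then show ?thesis by simp
qed

lemma energy_continuous:
  assumes "\<delta> > 0"
  shows "\<exists>C. \<forall>w1 w2. square_integrable w1 \<longrightarrow> square_integrable w2 \<longrightarrow>
    energy w1 \<le> (1 + \<delta>) * energy w2 + C * mean_square (\<lambda>z. w2 z - w1 z)"
proof (intro exI allI impI)
  fix w1 w2 :: "circle ^ 'd \<Rightarrow> real ^ 'd"
  assume w: "square_integrable w1" "square_integrable w2"
  have "1 * energy w1 \<le> (1 + \<delta>) * energy w2 + 0 * energy w2 + ((1 + 1 / \<delta>) * (B + lam)) * mean_square (\<lambda>z. w2 z - w1 z) + 0"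
  proof (rule energy_le_combination)
    fix x :: "(circle ^ 'p) \<times> (circle ^ 'd)" and z :: "circle ^ 'd"
    let ?k = "K (snd x, z)" and ?n = "(norm (w2 z - w1 z))\<^sup>2"
    have 1: "(norm (W x - w1 z))\<^sup>2 \<le> (1 + \<delta>) * (norm (W x - w2 z))\<^sup>2 + (1 + 1 / \<delta>) * ?n"
      using norm_add_square_le_weighted[OF assms, of "W x - w2 z" "w2 z - w1 z"] by simp
    have 2: "(norm (w1 z))\<^sup>2 \<le> (1 + \<delta>) * (norm (w2 z))\<^sup>2 + (1 + 1 / \<delta>) * ?n"
      using norm_add_square_le_weighted[OF assms, of "w2 z" "w1 z - w2 z"] by (simp add: norm_minus_commute)
    have "energy_density w1 (x, z) \<le> ((1 + \<delta>) * (norm (W x - w2 z))\<^sup>2 + (1 + 1 / \<delta>) * ?n) * ?k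
        + lam * ((1 + \<delta>) * (norm (w2 z))\<^sup>2 + (1 + 1 / \<delta>) * ?n)"
      unfolding energy_density_def prod.case
      by (intro add_mono mult_right_mono mult_left_mono 1 2 K_nonneg lam)
    also have "\<dots> = (1 + \<delta>) * energy_density w2 (x, z) + (1 + 1 / \<delta>) * (?k + lam) * ?n"
      by (simp add: energy_density_def algebra_simps)
    also have "\<dots> \<le> (1 + \<delta>) * energy_density w2 (x, z) + (1 + 1 / \<delta>) * (B + lam) * ?n"
      using K_bound[of "snd x" z] assms by (intro add_left_mono mult_right_mono mult_left_mono) auto
    finally show "1 * energy_density w1 (x, z) \<le> (1 + \<delta>) * energy_density w2 (x, z) + 0 * energy_density w2 (x, z) + ((1 + 1 / \<delta>) * (B + lam)) * ?n + 0"
      by simp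
  qed (intro square_integrable_diff w)+
  then show "energy w1 \<le> (1 + \<delta>) * energy w2 + ((1 + 1 / \<delta>) * (B + lam)) * mean_square (\<lambda>z. w2 z - w1 z)" by simp
qed

text \<open>
  Pointwise \<open>|w|\<^sup>2 \<le> 2 |W - w|\<^sup>2 + 2 |W|\<^sup>2\<close>, and \<open>W\<close> and \<open>K\<close> are at most \<open>B\<close>.
\<close>

lemma energy_coercive:
  fixes w :: "circle ^ 'd \<Rightarrow> real ^ 'd"
  assumes w: "square_integrable w"
  shows "c * mean_square w \<le> 2 * energy w + 2 * B\<^sup>2 * B"
proof -
  have "0 * energy w \<le> 2 * energy w + 0 * energy w + (- c) * mean_square w + 2 * B\<^sup>2 * B"
  proof (rule energy_le_combination[OF w w w w])
    fix x :: "(circle ^ 'p) \<times> (circle ^ 'd)" and z :: "circle ^ 'd"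
    let ?k = "K (snd x, z)"
    have "c * (norm (w z))\<^sup>2 \<le> (?k + lam) * (norm (w z))\<^sup>2"
      by (intro mult_right_mono coercive) simp
    also have "\<dots> = (norm (w z))\<^sup>2 * ?k + lam * (norm (w z))\<^sup>2" by (simp add: algebra_simps)
    also have "(norm (w z))\<^sup>2 * ?k \<le> (2 * (norm (W x - w z))\<^sup>2 + 2 * B\<^sup>2) * ?k"
    proof (intro mult_right_mono K_nonneg)
      have "(norm (w z))\<^sup>2 \<le> 2 * (norm (w z - W x))\<^sup>2 + 2 * (norm (W x))\<^sup>2"
        using norm_add_square_le[of "w z - W x" "W x"] by simp
      also have "\<dots> \<le> 2 * (norm (w z - W x))\<^sup>2 + 2 * B\<^sup>2"
        using power_mono[OF W_bound[of x] norm_ge_zero, of 2] by simp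
      finally show "(norm (w z))\<^sup>2 \<le> 2 * (norm (W x - w z))\<^sup>2 + 2 * B\<^sup>2" by (simp add: norm_minus_commute)
    qed
    also have "(2 * (norm (W x - w z))\<^sup>2 + 2 * B\<^sup>2) * ?k + lam * (norm (w z))\<^sup>2
        = 2 * energy_density w (x, z) + 2 * B\<^sup>2 * ?k - lam * (norm (w z))\<^sup>2"
      by (simp add: energy_density_def algebra_simps)
    also have "\<dots> \<le> 2 * energy_density w (x, z) + 2 * B\<^sup>2 * B - 0"
      using lam K_bound[of "snd x" z] by (intro diff_mono add_left_mono mult_left_mono mult_nonneg_nonneg) auto
    finally show "0 * energy_density w (x, z) \<le> 2 * energy_density w (x, z) + 0 * energy_density w (x, z) + (- c) * (norm (w z))\<^sup>2 + 2 * B\<^sup>2 * B"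
      by simp
  qed
  then show ?thesis by simp
qed

text \<open>
  Weak gradients are determined almost everywhere only. In this form the statement is the case of
  distance zero in \<open>energy_continuous\<close>.
\<close>

lemma energy_cong_AE:
  fixes w1 w2 :: "circle ^ 'd \<Rightarrow> real ^ 'd"
  assumes w: "square_integrable w1" "square_integrable w2" and eq: "AE z in torus_measure. w1 z = w2 z"
  shows "energy w1 \<le> energy w2"
proof -
  have "mean_square (\<lambda>z. w2 z - w1 z) = mean_square (\<lambda>z :: circle ^ 'd. 0 :: real ^ 'd)"
  proof (rule mean_square_cong_AE)
    show "(\<lambda>z. w2 z - w1 z) \<in> borel_measurable borel"
      by (intro square_integrable_measurable square_integrable_diff w)
    show "AE z in torus_measure. w2 z - w1 z = 0" using eq by eventually_elim simp
  qed simp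
  then have "mean_square (\<lambda>z. w2 z - w1 z) = 0" by (simp add: mean_square_def)
  then have le: "energy w1 \<le> (1 + \<delta>) * energy w2" if "\<delta> > 0" for \<delta>
    using energy_continuous[OF that] w by force
  have "(\<lambda>n. (1 + inverse (real (Suc n))) * energy w2) \<longlonglongrightarrow> (1 + 0) * energy w2"
    by (intro tendsto_add tendsto_mult tendsto_const LIMSEQ_inverse_real_of_nat)
  then show ?thesis using le by (intro LIMSEQ_le_const[of _ "energy w2" "energy w1"]) auto
qed

end

lemma pair_continuous_bounded:
  fixes g :: "(circle ^ 'm::finite) \<times> (circle ^ 'n::finite) \<Rightarrow> real"
  assumes cont: "continuous_on UNIV (\<lambda>(x, y). g (to_torus x, to_torus y))"
  obtains B where "\<And>p. \<bar>g p\<bar> \<le> B"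
proof -
  have "compact ((\<lambda>(x, y). g (to_torus x, to_torus y)) ` (cbox 0 1 \<times> cbox 0 1))"
    by (intro compact_continuous_image continuous_on_subset[OF cont] compact_Times) auto
  then obtain B where B: "\<And>x y. x \<in> cbox 0 1 \<Longrightarrow> y \<in> cbox 0 1 \<Longrightarrow> \<bar>g (to_torus x, to_torus y)\<bar> \<le> B"
    by (force dest!: compact_imp_bounded simp: bounded_iff)
  have "\<bar>g p\<bar> \<le> B" for p
    using B[of "torus_coord (fst p)" "torus_coord (snd p)"] torus_coord_bounds[of "fst p"] torus_coord_bounds[of "snd p"]
    by (simp add: mem_box_cart less_imp_le)
  then show ?thesis by (rule that)
qed

lemma pair_continuous_positive:
  fixes g :: "(circle ^ 'm::finite) \<times> (circle ^ 'n::finite) \<Rightarrow> real"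
  assumes cont: "continuous_on UNIV (\<lambda>(x, y). g (to_torus x, to_torus y))" and pos: "\<And>p. 0 < g p"
  obtains c where "c > 0" "\<And>p. c \<le> g p"
proof -
  have "continuous_on UNIV (\<lambda>(x, y). 1 / g (to_torus x, to_torus y))"
    using continuous_on_divide[OF continuous_on_const cont, of 1] less_imp_neq[OF pos]
    by (simp add: split_beta' eq_commute[of 0])
  then obtain B where B: "\<And>p. \<bar>1 / g p\<bar> \<le> B" by (rule pair_continuous_bounded[where g="\<lambda>p. 1 / g p"]) blast
  have "1 / max B 1 \<le> g p" for p
  proof -
    have "1 / g p \<le> max B 1" using B[of p] by linarith
    then have "1 \<le> max B 1 * g p" using pos[of p] by (simp only: divide_le_eq if_True)
    moreover have "0 < max B 1" by simp
    ultimately show ?thesis by (simp only: divide_le_eq mult.commute if_True)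
  qed
  moreover have "1 / max B 1 > 0" by simp
  ultimately show ?thesis using that by blast
qed

lemma pair_continuous_measurable:
  fixes g :: "(circle ^ 'm::finite) \<times> (circle ^ 'n::finite) \<Rightarrow> real"
  assumes cont: "continuous_on UNIV (\<lambda>(x, y). g (to_torus x, to_torus y))"
    and a: "a \<in> borel_measurable M" and b: "b \<in> borel_measurable M"
  shows "(\<lambda>s. g (a s, b s)) \<in> borel_measurable M"
proof -
  have 1: "(\<lambda>(x, y). g (to_torus x, to_torus y)) \<in> borel_measurable borel"
    using cont by (rule borel_measurable_continuous_onI)
  have "(\<lambda>s. (torus_coord (a s), torus_coord (b s))) \<in> borel_measurable M"
    by (intro borel_measurable_Pair measurable_compose[OF a measurable_torus_coord] measurable_compose[OF b measurable_torus_coord])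
  from measurable_compose[OF this 1] show ?thesis by simp
qed

text \<open>
  The gradient in the second group of variables collects partial derivatives of the lift to
  \<open>\<real>\<^sup>p \<times> \<real>\<^sup>d\<close>.
\<close>

lemma partial_gradient_continuous:
  fixes V :: "(circle ^ 'p::finite) \<times> (circle ^ 'd::finite) \<Rightarrow> real"
  assumes V: "torus_smooth2 V"
  shows "continuous_on UNIV (\<lambda>(x, y). torus_grad (\<lambda>y'. V (to_torus x, y')) (to_torus y) $ i)"
proof -
  define U where "U = (\<lambda>(x, y). V (to_torus x, to_torus y))"
  have U: "C_infinity U" using V by (simp add: torus_smooth2_def U_def)
  have "torus_grad (\<lambda>y'. V (to_torus x, y')) (to_torus y) $ i = frechet_derivative U (at (x, y)) (0, axis i 1)" for x y
  proof -
    have "((\<lambda>y. (x, y)) has_derivative (\<lambda>h. (0, h))) (at y)"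
      by (intro has_derivative_Pair has_derivative_const has_derivative_ident)
    from has_derivative_compose[OF this C_infinity_has_derivative[OF U]]
    have "((\<lambda>y. V (to_torus x, to_torus y)) has_derivative (\<lambda>h. frechet_derivative U (at (x, y)) (0, h))) (at y)"
      by (simp add: U_def)
    from fun_cong[OF frechet_derivative_at[OF this], of "axis i 1"] show ?thesis
      unfolding torus_grad_to_torus by (rule sym)
  qed
  moreover have "(0, axis i 1) \<in> (Basis :: ((real ^ 'p) \<times> (real ^ 'd)) set)"
    by (simp add: Basis_prod_def axis_in_Basis_iff)
  then have "continuous_on UNIV (\<lambda>p. frechet_derivative U (at p) (0, axis i 1))"
    by (intro C_infinity_continuous C_infinity_partial U)
  ultimately show ?thesis by (simp add: split_beta')
qed

section \<open>Compactness of factors with bounded derivatives\<close>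

lemma H1I: "square_integrable f \<Longrightarrow> is_weak_grad f g \<Longrightarrow> f \<in> H1"
  by (auto simp: H1_def)

lemma mean_square_tendsto_dominated:
  fixes f :: "nat \<Rightarrow> circle ^ 'n::finite \<Rightarrow> real"
  assumes M: "prob_space M" and distr: "torus_measure = distr M borel p" and p: "p \<in> borel_measurable M"
    and f: "\<And>n. f n \<in> borel_measurable borel" and u: "u \<in> borel_measurable borel"
    and lim: "AE x in M. (\<lambda>n. f n (p x)) \<longlonglongrightarrow> u (p x)"
    and bound: "\<And>n. AE x in M. \<bar>f n (p x)\<bar> \<le> L"
  shows "(\<lambda>n. mean_square (\<lambda>z. f n z - u z)) \<longlonglongrightarrow> 0"
proof -
  interpret M: prob_space M by (rule M)
  note [measurable] = measurable_compose[OF p f] measurable_compose[OF p u]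
  have ub: "AE x in M. \<bar>u (p x)\<bar> \<le> L"
  proof -
    have "AE x in M. \<forall>n. \<bar>f n (p x)\<bar> \<le> L" using bound by (simp add: AE_all_countable)
    with lim show ?thesis
    proof eventually_elim
      case (elim x)
      then show ?case by (intro LIMSEQ_le_const2[OF tendsto_rabs]) auto
    qed
  qed
  have eq: "mean_square (\<lambda>z. f n z - u z) = (LINT x|M. (f n (p x) - u (p x))\<^sup>2)" for n
  proof -
    have "(\<lambda>z. (norm (f n z - u z))\<^sup>2) \<in> borel_measurable borel" using f u by measurable
    then show ?thesis unfolding mean_square_def distr by (subst integral_distr[OF p]) auto
  qed
  have "(\<lambda>n. LINT x|M. (f n (p x) - u (p x))\<^sup>2) \<longlonglongrightarrow> (LINT x|M. 0)"
  proof (rule integral_dominated_convergence[where w="\<lambda>_. (2 * L)\<^sup>2"])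
    show "AE x in M. (\<lambda>n. (f n (p x) - u (p x))\<^sup>2) \<longlonglongrightarrow> 0"
      using lim
    proof eventually_elim
      case (elim x)
      then have "(\<lambda>n. (f n (p x) - u (p x))\<^sup>2) \<longlonglongrightarrow> (u (p x) - u (p x))\<^sup>2" by (intro tendsto_intros)
      then show ?case by simp
    qed
    show "AE x in M. norm ((f n (p x) - u (p x))\<^sup>2) \<le> (2 * L)\<^sup>2" for n
      using ub bound[of n]
    proof eventually_elim
      case (elim x)
      then have "\<bar>f n (p x) - u (p x)\<bar> \<le> 2 * L" by linarith
      then have "\<bar>f n (p x) - u (p x)\<bar>\<^sup>2 \<le> (2 * L)\<^sup>2" by (rule power_mono) simp
      then show ?case by simp
    qed
  qed auto
  then show ?thesis by (simp add: eq)
qed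

lemma mean_square_midpoint:
  fixes w1 w2 :: "circle ^ 'n::finite \<Rightarrow> real ^ 'n"
  assumes w: "square_integrable w1" "square_integrable w2"
  shows "2 * mean_square (\<lambda>z. (1 / 2) *\<^sub>R w1 z + (1 / 2) *\<^sub>R w2 z)
    = mean_square w1 + mean_square w2 - 1 / 2 * mean_square (\<lambda>z. w1 z - w2 z)"
proof -
  have mid: "2 * (norm ((1 / 2) *\<^sub>R a + (1 / 2) *\<^sub>R b))\<^sup>2 = (norm a)\<^sup>2 + (norm b)\<^sup>2 - 1 / 2 * (norm (a - b))\<^sup>2"
    for a b :: "real ^ 'n"
    unfolding power2_norm_eq_inner by (simp add: inner_diff_left inner_diff_right inner_add_left inner_add_right inner_commute algebra_simps)
  have i: "integrable torus_measure (\<lambda>z. (norm (w1 z))\<^sup>2)" "integrable torus_measure (\<lambda>z. (norm (w2 z))\<^sup>2)"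
    "integrable torus_measure (\<lambda>z. (norm (w1 z - w2 z))\<^sup>2)"
    using w square_integrable_diff[OF w] by (auto simp: square_integrable_def)
  have "2 * mean_square (\<lambda>z. (1 / 2) *\<^sub>R w1 z + (1 / 2) *\<^sub>R w2 z)
      = (LINT z|torus_measure. 2 * (norm ((1 / 2) *\<^sub>R w1 z + (1 / 2) *\<^sub>R w2 z))\<^sup>2)"
    unfolding mean_square_def by (rule integral_mult_right_zero[symmetric])
  also have "\<dots> = (LINT z|torus_measure. (norm (w1 z))\<^sup>2 + (norm (w2 z))\<^sup>2 - 1 / 2 * (norm (w1 z - w2 z))\<^sup>2)"
    unfolding mid ..
  also have "\<dots> = mean_square w1 + mean_square w2 - 1 / 2 * mean_square (\<lambda>z. w1 z - w2 z)"
    using i by (simp add: mean_square_def)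
  finally show ?thesis .
qed

text \<open>
  A bound on the gradients suffices in place of their convergence: this is \<open>weak_grad_relaxation\<close> for
  the energy \<open>\<parallel>w\<parallel>\<^sup>2\<close>.
\<close>

lemma weak_grad_closed:
  fixes u :: "circle ^ 'n::finite \<Rightarrow> real"
  assumes h: "\<And>n. square_integrable (h n)" and u: "square_integrable u"
    and hw: "\<And>n. is_weak_grad (h n) (w n)" and bound: "\<And>n. mean_square (w n) \<le> N"
    and lim: "(\<lambda>n. mean_square (\<lambda>z. h n z - u z)) \<longlonglongrightarrow> 0"
  obtains v where "is_weak_grad u v"
proof (rule weak_grad_relaxation[where \<Phi>=mean_square and c="1/2" and m=N and u=u])
  fix \<delta> :: real assume \<delta>: "\<delta> > 0"
  show "\<exists>C. \<forall>w1 w2 :: circle ^ 'n \<Rightarrow> real ^ 'n. square_integrable w1 \<longrightarrow> square_integrable w2 \<longrightarrow>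
      mean_square w1 \<le> (1 + \<delta>) * mean_square w2 + C * mean_square (\<lambda>z. w2 z - w1 z)"
  proof (intro exI allI impI)
    fix w1 w2 :: "circle ^ 'n \<Rightarrow> real ^ 'n"
    assume w: "square_integrable w1" "square_integrable w2"
    show "mean_square w1 \<le> (1 + \<delta>) * mean_square w2 + (1 + 1 / \<delta>) * mean_square (\<lambda>z. w2 z - w1 z)"
    proof (rule mean_square_le_combination)
      show "(norm (w1 z))\<^sup>2 \<le> (1 + \<delta>) * (norm (w2 z))\<^sup>2 + (1 + 1 / \<delta>) * (norm (w2 z - w1 z))\<^sup>2" for z
        using norm_add_square_le_weighted[OF \<delta>, of "w2 z" "w1 z - w2 z"] by (simp add: norm_minus_commute)
    qed (intro w square_integrable_diff square_integrable_measurable)+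
  qed
next
  fix \<epsilon> :: real assume "\<epsilon> > 0"
  then obtain n where "mean_square (\<lambda>z. h n z - u z) < \<epsilon>"
    using order_tendstoD(2)[OF lim] by (auto simp: eventually_sequentially)
  then show "\<exists>h w. square_integrable h \<and> is_weak_grad h w \<and> mean_square w \<le> N + \<epsilon> \<and> mean_square (\<lambda>z. h z - u z) \<le> \<epsilon>"
    using h[of n] hw[of n] bound[of n] \<open>\<epsilon> > 0\<close> by (intro exI[of _ "h n"] exI[of _ "w n"]) auto
next
  fix w1 w2 :: "circle ^ 'n \<Rightarrow> real ^ 'n"
  assume "square_integrable w1" "square_integrable w2"
  from mean_square_midpoint[OF this]
  show "2 * mean_square (\<lambda>z. (1 / 2) *\<^sub>R w1 z + (1 / 2) *\<^sub>R w2 z)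
      \<le> mean_square w1 + mean_square w2 - 1 / 2 * mean_square (\<lambda>z. w1 z - w2 z)" by (rule eq_refl)
qed (use u that in simp_all)

text \<open>
  A function that oscillates by at most \<open>C\<close> differs from its mean by at most \<open>C\<close>. For factors this plays
  the role of Poincare's inequality.
\<close>

lemma Holder_near_mean:
  fixes \<rho> :: "real \<Rightarrow> real"
  assumes H: "\<And>a b. \<bar>\<rho> a - \<rho> b\<bar> \<le> C * sqrt \<bar>a - b\<bar>" and t: "0 \<le> t" "t \<le> 1"
    and i: "integrable unit_measure \<rho>" and C: "0 \<le> C"
  shows "\<bar>\<rho> t - (LINT t|unit_measure. \<rho> t)\<bar> \<le> C"
proof -
  have "\<rho> t - (LINT t|unit_measure. \<rho> t) = (LINT \<tau>|unit_measure. \<rho> t - \<rho> \<tau>)"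
    using i unit_measure.prob_space by simp
  also have "\<bar>\<dots>\<bar> \<le> (LINT \<tau>|unit_measure. norm (\<rho> t - \<rho> \<tau>))"
    unfolding real_norm_def[symmetric] by (rule integral_norm_bound)
  also have "\<dots> \<le> (LINT \<tau>|unit_measure. C)"
  proof (rule integral_mono_AE)
    show "AE \<tau> in unit_measure. norm (\<rho> t - \<rho> \<tau>) \<le> C"
      using AE_unit_measure
    proof eventually_elim
      case (elim \<tau>)
      then have "\<bar>t - \<tau>\<bar> \<le> 1" using t by linarith
      then have "sqrt \<bar>t - \<tau>\<bar> \<le> 1" by simp
      then have "C * sqrt \<bar>t - \<tau>\<bar> \<le> C * 1" using C by (intro mult_left_mono)
      then show ?case using H[of t \<tau>] by simp
    qed
  qed (use i in simp_all)
  also have "\<dots> = C" using unit_measure.prob_space by simp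
  finally show ?thesis .
qed

text \<open>
  A factor \<open>r\<close> with weak derivative \<open>s\<close>, together with its continuous representative \<open>\<rho>\<close> on the line
  and the bounds on \<open>\<rho>\<close> that make the Arzela-Ascoli theorem applicable.
\<close>

definition Holder_factor :: "real \<Rightarrow> (circle \<Rightarrow> real) \<Rightarrow> (circle ^ 1 \<Rightarrow> real ^ 1) \<Rightarrow> (real \<Rightarrow> real) \<Rightarrow> bool" where
  "Holder_factor N r s \<rho> \<longleftrightarrow> square_integrable (on_circle1 r) \<and> is_weak_grad (on_circle1 r) s \<and> mean_square s \<le> N \<and>
    (AE t in unit_measure. r (abs_circle t) = \<rho> t) \<and>
    (\<forall>a b. \<bar>\<rho> a - \<rho> b\<bar> \<le> sqrt N * sqrt \<bar>a - b\<bar>) \<and> (\<forall>t. 0 \<le> t \<longrightarrow> t \<le> 1 \<longrightarrow> \<bar>\<rho> t\<bar> \<le> 1 + sqrt N)"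

lemma Holder_factor_exists:
  assumes r: "square_integrable (on_circle1 r)" and s: "is_weak_grad (on_circle1 r) s" and N: "mean_square s \<le> N"
    and mean: "\<bar>LINT t|torus_measure. on_circle1 r t\<bar> \<le> 1"
  shows "\<exists>\<rho>. Holder_factor N r s \<rho>"
proof -
  obtain \<rho> :: "real \<Rightarrow> real" where \<rho>: "AE t in unit_measure. on_circle1 r (circle1 t) = \<rho> t"
    and H: "\<And>a b. \<bar>\<rho> a - \<rho> b\<bar> \<le> sqrt (mean_square s) * sqrt \<bar>a - b\<bar>"
    using H1_circle_Holder[OF r s] by blast
  have N0: "0 \<le> N" using N mean_square_nonneg[of s] by linarith
  have H': "\<bar>\<rho> a - \<rho> b\<bar> \<le> sqrt N * sqrt \<bar>a - b\<bar>" for a b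
    by (rule order_trans[OF H mult_right_mono]) (use N in auto)
  have cont: "continuous_on UNIV \<rho>"
  proof (intro continuous_at_imp_continuous_on ballI)
    fix x
    have "(\<lambda>y. sqrt N * sqrt \<bar>y - x\<bar>) \<midarrow>x\<rightarrow> sqrt N * sqrt \<bar>x - x\<bar>" by (intro tendsto_intros)
    then have "(\<lambda>y. sqrt N * sqrt \<bar>y - x\<bar>) \<midarrow>x\<rightarrow> 0" by simp
    then have "(\<lambda>y. \<rho> y - \<rho> x) \<midarrow>x\<rightarrow> 0"
      by (rule Lim_null_comparison[rotated]) (auto intro!: always_eventually H')
    then show "isCont \<rho> x" unfolding isCont_def by (rule LIM_zero_cancel)
  qed
  then have \<rho>m: "\<rho> \<in> borel_measurable borel" by (rule borel_measurable_continuous_onI)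
  have rm: "on_circle1 r \<in> borel_measurable borel" using r by (rule square_integrable_measurable)
  have rm': "(\<lambda>t. on_circle1 r (circle1 t)) \<in> borel_measurable borel"
    by (rule measurable_compose[OF measurable_circle1 rm])
  have "integrable unit_measure (\<lambda>t. on_circle1 r (circle1 t))"
    using square_integrable_integrable[OF r] integrable_torus1[OF rm] by simp
  then have i: "integrable unit_measure \<rho>"
    using integrable_cong_AE[OF _ _ \<rho>] rm' \<rho>m by simp
  have "(LINT t|torus_measure. on_circle1 r t) = (LINT t|unit_measure. on_circle1 r (circle1 t))"
    by (rule integral_torus1[OF rm])
  also have "\<dots> = (LINT t|unit_measure. \<rho> t)"
    using rm' \<rho>m by (intro integral_cong_AE \<rho>) simp_all
  finally have mean': "\<bar>LINT t|unit_measure. \<rho> t\<bar> \<le> 1" using mean by simp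
  have "\<bar>\<rho> t\<bar> \<le> 1 + sqrt N" if "0 \<le> t" "t \<le> 1" for t
    using Holder_near_mean[OF H' that i] mean' N0 by simp
  then show ?thesis
    using r s N \<rho> H' by (intro exI[of _ \<rho>]) (simp add: Holder_factor_def)
qed

text \<open>
  The representatives of all factors are collected in a function with values in \<open>\<real>\<^sup>n\<close>, so one
  application of the Arzela-Ascoli theorem gives a common subsequence. The limits belong to \<open>H\<^sup>1\<close>
  because the derivatives stay bounded.
\<close>

lemma Holder_factors_convergent_subsequence:
  fixes r :: "nat \<Rightarrow> 'n::finite \<Rightarrow> circle \<Rightarrow> real"
  assumes F: "\<And>n j. Holder_factor N (r n j) (s n j) (\<rho> n j)"
  obtains R :: "'n \<Rightarrow> circle \<Rightarrow> real" and k :: "nat \<Rightarrow> nat" where "strict_mono k"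
    "\<And>j. on_circle1 (R j) \<in> H1"
    "\<And>j. AE t in unit_measure. (\<lambda>n. r (k n) j (abs_circle t)) \<longlonglongrightarrow> R j (abs_circle t)"
    "\<And>n j. AE t in unit_measure. \<bar>r (k n) j (abs_circle t)\<bar> \<le> 1 + sqrt N"
    "\<And>j. (\<lambda>n. mean_square (\<lambda>z. on_circle1 (r (k n) j) z - on_circle1 (R j) z)) \<longlonglongrightarrow> 0"
proof -
  have N0: "0 \<le> N"
    using F[of 0 undefined] mean_square_nonneg[of "s 0 undefined"] unfolding Holder_factor_def by linarith
  define D where "D = real CARD('n)"
  have D: "D > 0" by (simp add: D_def)
  define X where "X n t = (\<chi> j. \<rho> n j t)" for n t
  have Xb: "norm (X n t) \<le> D * (1 + sqrt N)" if "t \<in> {0..1}" for n t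
  proof -
    have "norm (X n t) \<le> (\<Sum>j\<in>UNIV. \<bar>X n t $ j\<bar>)" by (rule norm_le_l1_cart)
    also have "\<dots> \<le> (\<Sum>j\<in>(UNIV::'n set). 1 + sqrt N)"
      using F that by (intro sum_mono) (auto simp: X_def Holder_factor_def)
    finally show ?thesis by (simp add: D_def)
  qed
  have Xd: "norm (X n x - X n y) \<le> D * sqrt N * sqrt \<bar>x - y\<bar>" for n x y
  proof -
    have "norm (X n x - X n y) \<le> (\<Sum>j\<in>UNIV. \<bar>(X n x - X n y) $ j\<bar>)" by (rule norm_le_l1_cart)
    also have "\<dots> \<le> (\<Sum>j\<in>(UNIV::'n set). sqrt N * sqrt \<bar>x - y\<bar>)"
      using F by (intro sum_mono) (auto simp: X_def Holder_factor_def)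
    finally show ?thesis by (simp add: D_def mult.assoc)
  qed
  have equi: "\<exists>d. 0 < d \<and> (\<forall>n y. y \<in> {0..1} \<and> norm (x - y) < d \<longrightarrow> norm (X n x - X n y) < e)"
    if "0 < e" for x e :: real
  proof (intro exI conjI allI impI)
    \<comment> \<open>Since \<open>D sqrt N q < e\<close>, points at distance less than \<open>q\<^sup>2\<close> have values at distance less than \<open>e\<close>.\<close>
    define q where "q = e / (D * sqrt N + 1)"
    have pos: "D * sqrt N + 1 > 0" using D N0 by (intro add_nonneg_pos mult_nonneg_nonneg) auto
    then have q: "q > 0" using that by (simp add: q_def)
    then show "0 < q\<^sup>2" by simp
    fix n y assume "y \<in> {0..1} \<and> norm (x - y) < q\<^sup>2"
    then have "sqrt \<bar>x - y\<bar> \<le> sqrt (q\<^sup>2)" by (intro real_sqrt_le_mono) simp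
    then have "sqrt \<bar>x - y\<bar> \<le> q" using q by simp
    then have "D * sqrt N * sqrt \<bar>x - y\<bar> \<le> D * sqrt N * q" using D N0 by (intro mult_left_mono) auto
    also have "\<dots> < (D * sqrt N + 1) * q" using q by (simp add: distrib_right)
    also have "\<dots> = e" using pos by (simp add: q_def)
    finally show "norm (X n x - X n y) < e" using Xd[of n x y] by linarith
  qed
  obtain G k where G: "continuous_on {0..1} G" and k: "strict_mono (k :: nat \<Rightarrow> nat)"
    and conv: "\<And>e. 0 < e \<Longrightarrow> \<exists>M. \<forall>n x. n \<ge> M \<and> x \<in> {0..1} \<longrightarrow> norm (X (k n) x - G x) < e"
    using Arzela_Ascoli[of "{0..1}" X, OF compact_Icc Xb equi] by blast
  have X_lim: "(\<lambda>n. X (k n) t) \<longlonglongrightarrow> G t" if "t \<in> {0..1}" for t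
    using conv that by (intro LIMSEQ_I) blast
  have \<rho>_lim: "(\<lambda>n. \<rho> (k n) j t) \<longlonglongrightarrow> G t $ j" if "t \<in> {0..1}" for t j
    using tendsto_vec_nth[OF X_lim[OF that], of j] by (simp add: X_def)
  define R where "R j t = G (circle_coord t) $ j" for j t
  have Rm: "on_circle1 (R j) \<in> borel_measurable borel" for j
  proof -
    have "(\<lambda>x. indicator {0..1} x *\<^sub>R G x) \<in> borel_measurable borel"
      using G by (intro borel_measurable_continuous_on_indicator) auto
    from measurable_compose[OF measurable_circle_coord this]
    have "(\<lambda>t. G (circle_coord t)) \<in> borel_measurable borel"
      using circle_coord_bounds by (simp add: less_imp_le indicator_def)
    from measurable_compose[OF this measurable_circle_vec_nth]
    have "R j \<in> borel_measurable borel" unfolding R_def .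
    from measurable_compose[OF measurable_circle_vec_nth this] show ?thesis .
  qed
  have lim: "AE t in unit_measure. (\<lambda>n. r (k n) j (abs_circle t)) \<longlonglongrightarrow> R j (abs_circle t)" for j
  proof -
    have "AE t in unit_measure. \<forall>n. r n j (abs_circle t) = \<rho> n j t"
      unfolding AE_all_countable using F by (auto simp: Holder_factor_def)
    then show ?thesis using AE_unit_measure
    proof eventually_elim
      case (elim t)
      then have "(\<lambda>n. \<rho> (k n) j t) \<longlonglongrightarrow> G t $ j" by (intro \<rho>_lim) auto
      then show ?case using elim by (simp add: R_def circle_coord_abs)
    qed
  qed
  have bound: "AE t in unit_measure. \<bar>r n j (abs_circle t)\<bar> \<le> 1 + sqrt N" for n j
  proof -
    have "AE t in unit_measure. r n j (abs_circle t) = \<rho> n j t"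
      using F by (auto simp: Holder_factor_def)
    then show ?thesis using AE_unit_measure
    proof eventually_elim
      case (elim t)
      then show ?case using F[of n j] by (auto simp: Holder_factor_def)
    qed
  qed
  have sq: "square_integrable (on_circle1 (r n j))" for n j using F by (simp add: Holder_factor_def)
  have ms: "(\<lambda>n. mean_square (\<lambda>z. on_circle1 (r (k n) j) z - on_circle1 (R j) z)) \<longlonglongrightarrow> 0" for j
    by (rule mean_square_tendsto_dominated[OF unit_measure.prob_space_axioms torus1_measure])
      (use lim bound Rm square_integrable_measurable[OF sq] in auto)
  have Gb: "norm (G t) \<le> D * (1 + sqrt N)" if "t \<in> {0..1}" for t
    using Xb[OF that] by (intro LIMSEQ_le_const2[OF tendsto_norm[OF X_lim[OF that]]]) auto
  have Rsq: "square_integrable (on_circle1 (R j))" for j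
  proof (rule square_integrableI_bounded[OF Rm])
    fix z :: "circle ^ 1"
    have "\<bar>G (circle_coord (z $ 1)) $ j\<bar> \<le> norm (G (circle_coord (z $ 1)))" by (rule component_le_norm_cart)
    also have "\<dots> \<le> D * (1 + sqrt N)" by (rule Gb) (simp add: circle_coord_bounds less_imp_le)
    finally show "norm (on_circle1 (R j) z) \<le> D * (1 + sqrt N)" by (simp add: R_def)
  qed
  have "on_circle1 (R j) \<in> H1" for j
  proof -
    have "is_weak_grad (on_circle1 (r (k n) j)) (s (k n) j)" "mean_square (s (k n) j) \<le> N" for n
      using F by (auto simp: Holder_factor_def)
    from weak_grad_closed[OF sq Rsq this ms] obtain v where "is_weak_grad (on_circle1 (R j)) v" by blast
    with Rsq show ?thesis by (rule H1I)
  qed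
  from k this lim bound ms show ?thesis by (rule that)
qed

section \<open>Existence of a minimizer\<close>

lemma tensor_scale: "tensor (\<lambda>j t. \<alpha> j * r j t) z = (\<Prod>j\<in>UNIV. \<alpha> j) * tensor r z"
  by (simp add: tensor_def prod.distrib)

lemma circle1_vector_field:
  fixes s :: "circle ^ 1 \<Rightarrow> real ^ 1"
  shows "s = (\<lambda>t. \<chi> _. s (\<chi> _. t $ 1) $ 1)"
proof
  fix t
  have "((\<chi> _. t $ 1) :: circle ^ 1) = t" by (simp add: vec_eq_iff num1_eq1)
  then have "s (\<chi> _. t $ 1) = s t" by simp
  then show "s t = (\<chi> _. s (\<chi> _. t $ 1) $ 1)" by (simp only:) (simp add: vec_eq_iff num1_eq1)
qed

text \<open>
  The factors other than the \<open>i\<close>-th are scaled to norm 1, and the \<open>i\<close>-th factor absorbs the scaling, so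
  its norm becomes \<open>\<parallel>g\<parallel>\<close>. By the formula for the gradient, the derivative of the \<open>i\<close>-th factor is bounded
  by \<open>\<parallel>\<nabla>g\<parallel>\<close>, and the derivatives of the others by \<open>\<parallel>\<nabla>g\<parallel> / \<parallel>g\<parallel>\<close>; this is where \<open>\<parallel>g\<parallel>\<close> has to be bounded
  below. The means are bounded by 1: for \<open>i\<close> the mean vanishes, for the others it is at most the
  norm.
\<close>

lemma Tensor_Holder_factors:
  fixes g :: "circle ^ 'd::finite \<Rightarrow> real"
  assumes g: "g \<in> Tensor i" and v: "is_weak_grad g v" "mean_square v \<le> M"
    and \<epsilon>: "0 < \<epsilon>" "\<epsilon> \<le> mean_square g"
  shows "\<exists>r s \<rho>. (AE z in torus_measure. g z = tensor r z) \<and> (\<forall>j. Holder_factor (M + M / \<epsilon>) (r j) (s j) (\<rho> j)) \<and>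
    (LINT t|torus_measure. on_circle1 (r i) t) = 0"
proof -
  have M0: "0 \<le> M" using v(2) mean_square_nonneg[of v] by linarith
  have gsq: "square_integrable g" using g by (simp add: Tensor_def H1_zero_mean_def H1_def)
  have gm: "g \<in> borel_measurable borel" using gsq by (rule square_integrable_measurable)
  obtain r0 :: "'d \<Rightarrow> circle \<Rightarrow> real" where r0: "AE z in torus_measure. g z = tensor r0 z"
    "\<And>j. on_circle1 (r0 j) \<in> H1" "(LINT t|torus_measure. on_circle1 (r0 i) t) = 0"
    using g by (auto simp: Tensor_def tensor_def)
  define s0 where "s0 j = weak_grad (on_circle1 (r0 j))" for j
  have r0sq: "square_integrable (on_circle1 (r0 j))" for j using r0(2)[of j] by (simp add: H1_def)
  have s0: "is_weak_grad (on_circle1 (r0 j)) (s0 j)" for j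
    unfolding s0_def by (intro is_weak_grad_weak_grad r0)
  define m where "m j = mean_square (on_circle1 (r0 j))" for j
  define G where "G = mean_square g"
  have G: "G > 0" using \<epsilon> by (simp add: G_def)
  have tm: "tensor r0 \<in> borel_measurable borel"
    using tensor_square_integrable(1)[of r0, OF r0sq] by (rule square_integrable_measurable)
  have prod_m: "(\<Prod>j\<in>UNIV. m j) = G"
    using mean_square_cong_AE[OF gm tm r0(1)] tensor_square_integrable(2)[of r0, OF r0sq] by (simp add: m_def G_def)
  have m0: "m j > 0" for j
  proof -
    have "m j \<noteq> 0" using prod_m G by (metis finite_class.finite_UNIV UNIV_I less_irrefl prod_zero)
    then show ?thesis by (simp add: m_def less_le)
  qed
  \<comment> \<open>The product of these scalars is 1, so the tensor product does not change.\<close>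
  define \<alpha> where "\<alpha> j = (if j = i then \<Prod>k\<in>UNIV - {i}. sqrt (m k) else 1 / sqrt (m j))" for j
  have \<alpha>1: "(\<Prod>j\<in>UNIV. \<alpha> j) = 1"
  proof -
    have "(\<Prod>j\<in>UNIV. \<alpha> j) = \<alpha> i * (\<Prod>j\<in>UNIV - {i}. \<alpha> j)" by (rule prod.remove) auto
    also have "(\<Prod>j\<in>UNIV - {i}. \<alpha> j) = (\<Prod>j\<in>UNIV - {i}. 1 / sqrt (m j))"
      by (intro prod.cong) (auto simp: \<alpha>_def)
    also have "\<alpha> i * \<dots> = (\<Prod>k\<in>UNIV - {i}. sqrt (m k) * (1 / sqrt (m k)))"
      by (simp only: \<alpha>_def refl if_True prod.distrib)
    also have "\<dots> = 1" using m0 by (intro prod.neutral) (simp add: less_imp_neq[THEN not_sym])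
    finally show ?thesis .
  qed
  define r where "r j t = \<alpha> j * r0 j t" for j t
  define s where "s j t = \<alpha> j *\<^sub>R s0 j t" for j t
  have tensor_r: "tensor r = tensor r0"
    using tensor_scale[of \<alpha> r0] unfolding r_def \<alpha>1 by auto
  have rsq: "square_integrable (on_circle1 (r j))" for j
    unfolding r_def by (intro square_integrable_mult r0sq)
  have rs: "is_weak_grad (on_circle1 (r j)) (s j)" for j
    using is_weak_grad_combination[OF r0sq r0sq s0 s0, of "\<alpha> j" j 0 j] unfolding r_def s_def by simp
  have ms_r: "mean_square (on_circle1 (r j)) = (if j = i then G else 1)" for j
  proof -
    have "mean_square (on_circle1 (r j)) = (\<alpha> j)\<^sup>2 * m j"
      unfolding r_def m_def by (rule mean_square_mult)
    also have "\<dots> = (if j = i then G else 1)"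
    proof (cases "j = i")
      case True
      have "(\<alpha> i)\<^sup>2 = (\<Prod>k\<in>UNIV - {i}. m k)"
        using m0 by (simp add: \<alpha>_def prod_power_distrib less_imp_le)
      then have "(\<alpha> i)\<^sup>2 * m i = G" using prod_m prod.remove[of UNIV i m] by (simp add: mult.commute)
      then show ?thesis using True by simp
    next
      case False
      then show ?thesis using m0[of j] by (simp add: \<alpha>_def power_divide)
    qed
    finally show ?thesis .
  qed
  define d where "d j t = s j (\<chi> _. t) $ 1" for j t
  have s_d: "s j = (\<lambda>t. \<chi> _. d j (t $ 1))" for j
    unfolding d_def by (rule circle1_vector_field)
  have ms_s: "mean_square (s j) = mean_square (on_circle1 (d j))" for j
    unfolding s_d mean_square_def by (simp add: norm_vec_def L2_set_def)
  have rs': "is_weak_grad (on_circle1 (r j)) (\<lambda>t. \<chi> _. d j (t $ 1))" for j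
    using rs[of j] unfolding s_d .
  note T = is_weak_grad_tensor[of r d, OF rsq rs']
  have gradT: "is_weak_grad g (tensor_grad r d)"
  proof (rule is_weak_grad_cong_AE[OF T(1)])
    show "AE z in torus_measure. tensor r z = g z" using r0(1) unfolding tensor_r by eventually_elim simp
  qed (use tm gm in \<open>simp_all add: tensor_r\<close>)
  have comp_le: "mean_square (\<lambda>z. tensor_grad r d z $ j) \<le> M" for j
  proof -
    have tg: "square_integrable (tensor_grad r d)" using gradT by (rule is_weak_grad_square_integrable)
    have "mean_square (\<lambda>z. tensor_grad r d z $ j) \<le> 1 * mean_square (tensor_grad r d) + 0 * mean_square (tensor_grad r d)"
    proof (rule mean_square_le_combination[OF tg tg])
      show "(\<lambda>z. tensor_grad r d z $ j) \<in> borel_measurable borel"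
        by (intro square_integrable_measurable square_integrable_nth tg)
      show "(norm (tensor_grad r d z $ j))\<^sup>2 \<le> 1 * (norm (tensor_grad r d z))\<^sup>2 + 0 * (norm (tensor_grad r d z))\<^sup>2" for z
        using power_mono[OF component_le_norm_cart[of "tensor_grad r d z" j], of 2] by simp
    qed
    also have "\<dots> = mean_square v"
      using mean_square_cong_AE[OF _ _ is_weak_grad_unique[OF gradT v(1)]] tg
        is_weak_grad_square_integrable[OF v(1)] by (simp add: square_integrable_measurable)
    finally show ?thesis using v(2) by simp
  qed
  have s_le: "mean_square (s j) \<le> M + M / \<epsilon>" for j
  proof -
    have "(\<Prod>k\<in>UNIV - {j}. mean_square (on_circle1 (r k))) = (if i \<in> UNIV - {j} then G else 1)"
      unfolding ms_r by (subst prod.delta) auto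
    then have le: "mean_square (s j) * (if i \<noteq> j then G else 1) \<le> M"
      using comp_le[of j] T(2)[of j] by (simp add: ms_s)
    have div0: "0 \<le> M / \<epsilon>" using M0 \<epsilon> by simp
    show ?thesis
    proof (cases "i = j")
      case True
      then show ?thesis using le div0 by simp
    next
      case False
      have "mean_square (s j) * \<epsilon> \<le> mean_square (s j) * G"
        using \<epsilon> by (intro mult_left_mono) (simp_all add: G_def)
      then have "mean_square (s j) * \<epsilon> \<le> M" using le False by simp
      then have "mean_square (s j) \<le> M / \<epsilon>" using \<epsilon> by (simp add: pos_le_divide_eq)
      then show ?thesis using M0 by simp
    qed
  qed
  have mean_i: "(LINT t|torus_measure. on_circle1 (r i) t) = 0"
    unfolding r_def using r0(3) by simp
  have mean_le: "\<bar>LINT t|torus_measure. on_circle1 (r j) t\<bar> \<le> 1" for j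
  proof (cases "j = i")
    case True
    then show ?thesis using mean_i by simp
  next
    case False
    have "\<bar>LINT t|torus_measure. on_circle1 (r j) t\<bar> \<le> (LINT t|torus_measure. norm (on_circle1 (r j) t))"
      unfolding real_norm_def[symmetric] by (rule integral_norm_bound)
    also have "\<dots> \<le> sqrt (mean_square (on_circle1 (r j)))" by (rule mean_norm_le_mean_square[OF rsq])
    finally show ?thesis using False by (simp add: ms_r)
  qed
  have "\<exists>\<rho>. Holder_factor (M + M / \<epsilon>) (r j) (s j) \<rho>" for j
    by (rule Holder_factor_exists[OF rsq rs s_le mean_le])
  then obtain \<rho> where "\<And>j. Holder_factor (M + M / \<epsilon>) (r j) (s j) (\<rho> j)" by metis
  with r0(1) mean_i show ?thesis unfolding tensor_r[symmetric] by blast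
qed

lemma tensor_H1:
  assumes "\<And>j. on_circle1 (r j) \<in> H1"
  shows "tensor r \<in> H1"
proof -
  define s where "s j = weak_grad (on_circle1 (r j))" for j
  define d where "d j t = s j (\<chi> _. t) $ 1" for j t
  have rsq: "square_integrable (on_circle1 (r j))" for j using assms by (simp add: H1_def)
  have s_d: "s j = (\<lambda>t. \<chi> _. d j (t $ 1))" for j
    unfolding d_def by (rule circle1_vector_field)
  have "is_weak_grad (on_circle1 (r j)) (\<lambda>t. \<chi> _. d j (t $ 1))" for j
    using is_weak_grad_weak_grad[OF assms, of j] unfolding s_def[symmetric] s_d .
  from is_weak_grad_tensor(1)[of r d, OF rsq this] tensor_square_integrable(1)[of r, OF rsq] show ?thesis
    by (intro H1I)
qed

lemma Tensor_zero: "(\<lambda>_. 0) \<in> Tensor (i :: 'd::finite)"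
proof -
  have "(\<lambda>_ :: circle ^ 'd. 0) \<in> H1" "(\<lambda>_ :: circle ^ 1. 0) \<in> H1"
    by (rule H1I[OF _ is_weak_grad_zero]; simp add: square_integrable_def)+
  then show ?thesis
    unfolding Tensor_def H1_zero_mean_def by (auto intro!: exI[of _ "\<lambda>_ _. 0"])
qed

lemma Tensor_limit:
  fixes g :: "nat \<Rightarrow> circle ^ 'd::finite \<Rightarrow> real"
  assumes g: "\<And>n. g n \<in> Tensor i" and F: "\<And>n j. Holder_factor N (r n j) (s n j) (\<rho> n j)"
    and gr: "\<And>n. AE z in torus_measure. g n z = tensor (r n) z"
    and mean: "\<And>n. (LINT t|torus_measure. on_circle1 (r n i) t) = 0"
  obtains h k where "strict_mono (k :: nat \<Rightarrow> nat)" "h \<in> Tensor i"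
    "(\<lambda>n. mean_square (\<lambda>z. g (k n) z - h z)) \<longlonglongrightarrow> 0"
proof -
  obtain R k where k: "strict_mono (k :: nat \<Rightarrow> nat)" and RH1: "\<And>j :: 'd. on_circle1 (R j) \<in> H1"
    and lim: "\<And>j. AE t in unit_measure. (\<lambda>n. r (k n) j (abs_circle t)) \<longlonglongrightarrow> R j (abs_circle t)"
    and bound: "\<And>n j. AE t in unit_measure. \<bar>r (k n) j (abs_circle t)\<bar> \<le> 1 + sqrt N"
    and ms: "\<And>j. (\<lambda>n. mean_square (\<lambda>z. on_circle1 (r (k n) j) z - on_circle1 (R j) z)) \<longlonglongrightarrow> 0"
  proof (rule Holder_factors_convergent_subsequence[where N=N and r=r and s=s and \<rho>=\<rho>, OF F])
    fix R :: "'d \<Rightarrow> circle \<Rightarrow> real" and k :: "nat \<Rightarrow> nat"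
    assume "strict_mono k" "\<And>j. on_circle1 (R j) \<in> H1"
      "\<And>j. AE t in unit_measure. (\<lambda>n. r (k n) j (abs_circle t)) \<longlonglongrightarrow> R j (abs_circle t)"
      "\<And>n j. AE t in unit_measure. \<bar>r (k n) j (abs_circle t)\<bar> \<le> 1 + sqrt N"
      "\<And>j. (\<lambda>n. mean_square (\<lambda>z. on_circle1 (r (k n) j) z - on_circle1 (R j) z)) \<longlonglongrightarrow> 0"
    then show thesis by (rule that)
  qed
  have rsq: "square_integrable (on_circle1 (r n j))" for n j using F by (simp add: Holder_factor_def)
  have Rsq: "square_integrable (on_circle1 (R j))" for j using RH1 by (simp add: H1_def)
  have gsq: "square_integrable (g n)" and gmean: "(LINT z|torus_measure. g n z) = 0" for n
    using g by (auto simp: Tensor_def H1_zero_mean_def H1_def)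
  have hH1: "tensor R \<in> H1" by (rule tensor_H1[OF RH1])
  have hsq: "square_integrable (tensor R)" using hH1 by (simp add: H1_def)
  have tsq: "square_integrable (tensor (r n))" for n by (rule tensor_square_integrable(1)[OF rsq])
  have "(\<lambda>n. mean_square (\<lambda>z. tensor (r (k n)) z - tensor R z)) \<longlonglongrightarrow> 0"
  proof (rule mean_square_tendsto_dominated[OF cube_measure.prob_space_axioms torus_measure_distr])
    show "torus_point \<in> borel_measurable cube_measure" by measurable
    have "AE x in cube_measure. \<forall>j. (\<lambda>n. r (k n) j (abs_circle (x j))) \<longlonglongrightarrow> R j (abs_circle (x j))"
      by (subst AE_all_countable) (intro allI AE_cubeI lim)
    then show "AE x in cube_measure. (\<lambda>n. tensor (r (k n)) (torus_point x)) \<longlonglongrightarrow> tensor R (torus_point x)"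
      by eventually_elim (simp add: tensor_def tendsto_prod)
    fix n
    have "AE x in cube_measure. \<forall>j. \<bar>r (k n) j (abs_circle (x j))\<bar> \<le> 1 + sqrt N"
      by (subst AE_all_countable) (intro allI AE_cubeI bound)
    then show "AE x in cube_measure. \<bar>tensor (r (k n)) (torus_point x)\<bar> \<le> (\<Prod>j\<in>(UNIV::'d set). 1 + sqrt N)"
    proof eventually_elim
      case (elim x)
      then show ?case unfolding tensor_def abs_prod by (intro prod_mono) auto
    qed
  qed (intro square_integrable_measurable tsq hsq)+
  moreover have "mean_square (\<lambda>z. tensor (r n) z - tensor R z) = mean_square (\<lambda>z. g n z - tensor R z)" for n
  proof (rule mean_square_cong_AE)
    show "AE z in torus_measure. tensor (r n) z - tensor R z = g n z - tensor R z"
      using gr[of n] by eventually_elim simp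
  qed (intro square_integrable_measurable square_integrable_diff tsq hsq gsq)+
  ultimately have conv: "(\<lambda>n. mean_square (\<lambda>z. g (k n) z - tensor R z)) \<longlonglongrightarrow> 0" by simp
  have mean_h: "(LINT z|torus_measure. tensor R z) = 0"
  proof -
    have "(\<lambda>n. LINT z|torus_measure. g (k n) z * 1) \<longlonglongrightarrow> (LINT z|torus_measure. tensor R z * 1)"
      by (rule integral_mult_tendsto[where B=1, OF gsq hsq conv]) auto
    then show ?thesis by (simp add: gmean LIMSEQ_const_iff)
  qed
  have mean_R: "(LINT t|torus_measure. on_circle1 (R i) t) = 0"
  proof -
    have "(\<lambda>n. LINT t|torus_measure. on_circle1 (r (k n) i) t * 1) \<longlonglongrightarrow> (LINT t|torus_measure. on_circle1 (R i) t * 1)"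
      by (rule integral_mult_tendsto[where B=1, OF rsq Rsq ms]) auto
    then show ?thesis by (simp add: mean LIMSEQ_const_iff)
  qed
  have "AE z in torus_measure. tensor R z = (\<Prod>j\<in>UNIV. R j (z $ j))" by (simp add: tensor_def)
  then have "tensor R \<in> Tensor i"
    unfolding Tensor_def H1_zero_mean_def using hH1 RH1 mean_h mean_R by blast
  from k this conv show ?thesis by (rule that)
qed

text \<open>
  Let \<open>m\<close> be the infimum. A limit in \<open>L\<^sup>2\<close> of nearly minimal tensor products is a minimizer once it is
  itself a tensor product, by \<open>weak_grad_relaxation\<close>. If there are nearly minimal tensor products of
  arbitrarily small norm, this limit is 0; otherwise the norms along a minimizing sequence are bounded
  below and \<open>Tensor_limit\<close> applies.
\<close>

lemma exists_energy_minimizer: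
  fixes W :: "(circle ^ 'p::finite) \<times> (circle ^ 'd::finite) \<Rightarrow> real ^ 'd"
  assumes energy: "gradient_energy W K lam B c \<nu>" and f: "f \<in> H1"
  shows "\<exists>g\<in>Tensor i. \<forall>h\<in>Tensor i.
    gradient_energy.energy W K lam \<nu> (weak_grad (\<lambda>z. f z + g z)) \<le> gradient_energy.energy W K lam \<nu> (weak_grad (\<lambda>z. f z + h z))"
proof -
  interpret gradient_energy W K lam B c \<nu> by (rule energy)
  define J where "J h = energy (weak_grad (\<lambda>z. f z + h z))" for h
  have fsq: "square_integrable f" using f by (simp add: H1_def)
  have fg: "is_weak_grad f (weak_grad f)" by (rule is_weak_grad_weak_grad[OF f])
  have fgsq: "square_integrable (weak_grad f)" using fg by (rule is_weak_grad_square_integrable)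
  have TH1: "h \<in> H1" if "h \<in> Tensor i" for h using that by (simp add: Tensor_def H1_zero_mean_def)
  have Tsq: "square_integrable h" if "h \<in> Tensor i" for h using TH1[OF that] by (simp add: H1_def)
  have sumsq: "square_integrable (\<lambda>z. f z + h z)" if "h \<in> Tensor i" for h
    using square_integrable_add[OF fsq Tsq[OF that]] .
  have sumH1: "(\<lambda>z. f z + h z) \<in> H1" if "h \<in> Tensor i" for h
  proof -
    have "is_weak_grad (\<lambda>z. 1 * f z + 1 * h z) (\<lambda>z. 1 *\<^sub>R weak_grad f z + 1 *\<^sub>R weak_grad h z)"
      by (intro is_weak_grad_combination fsq fg Tsq is_weak_grad_weak_grad TH1 that)
    then show ?thesis by (intro H1I[OF sumsq[OF that]]) simp
  qed
  have sumgrad: "is_weak_grad (\<lambda>z. f z + h z) (weak_grad (\<lambda>z. f z + h z))" if "h \<in> Tensor i" for h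
    by (rule is_weak_grad_weak_grad[OF sumH1[OF that]])
  have bdd: "bdd_below (J ` Tensor i)" unfolding J_def by (intro bdd_belowI[of _ 0]) (auto simp: energy_nonneg)
  have ne: "J ` Tensor i \<noteq> {}" using Tensor_zero by blast
  define m where "m = Inf (J ` Tensor i)"
  have m_le: "m \<le> J h" if "h \<in> Tensor i" for h unfolding m_def by (intro cInf_lower bdd imageI that)
  have near: "\<exists>h\<in>Tensor i. J h < m + \<epsilon>" if "\<epsilon> > 0" for \<epsilon>
    using cInf_lessD[OF ne, of "m + \<epsilon>"] that by (auto simp: m_def)
  have closing: "J g \<le> m" if g: "g \<in> Tensor i"
    and approx: "\<And>\<epsilon>. \<epsilon> > 0 \<Longrightarrow> \<exists>h\<in>Tensor i. J h \<le> m + \<epsilon> \<and> mean_square (\<lambda>z. h z - g z) \<le> \<epsilon>" for g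
  proof (rule weak_grad_relaxation[where \<Phi>=energy and c="c/2" and m=m and u="\<lambda>z. f z + g z"])
    show "c / 2 > 0" using c by simp
    show "square_integrable (\<lambda>z. f z + g z)" by (rule sumsq[OF g])
    show "\<exists>h w. square_integrable h \<and> is_weak_grad h w \<and> energy w \<le> m + \<epsilon> \<and> mean_square (\<lambda>z. h z - (f z + g z)) \<le> \<epsilon>"
      if pos: "\<epsilon> > 0" for \<epsilon>
    proof -
      obtain h where h: "h \<in> Tensor i" "J h \<le> m + \<epsilon>" "mean_square (\<lambda>z. h z - g z) \<le> \<epsilon>" using approx[OF pos] by blast
      then show ?thesis
        using sumsq[OF h(1)] sumgrad[OF h(1)] unfolding J_def
        by (intro exI[of _ "\<lambda>z. f z + h z"] exI[of _ "weak_grad (\<lambda>z. f z + h z)"]) simp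
    qed
    fix v assume v: "is_weak_grad (\<lambda>z. f z + g z) v" "energy v \<le> m"
    have "energy (weak_grad (\<lambda>z. f z + g z)) \<le> energy v"
      using is_weak_grad_square_integrable[OF sumgrad[OF g]] is_weak_grad_square_integrable[OF v(1)]
        is_weak_grad_unique[OF sumgrad[OF g] v(1)] by (rule energy_cong_AE)
    then show "J g \<le> m" using v(2) by (simp add: J_def)
  qed (use energy_midpoint energy_continuous energy_nonneg in auto)
  have "\<exists>g\<in>Tensor i. J g \<le> m"
  proof (cases "\<forall>\<epsilon>>0. \<exists>h\<in>Tensor i. J h \<le> m + \<epsilon> \<and> mean_square h \<le> \<epsilon>")
    case True
    then have "J (\<lambda>_. 0) \<le> m" by (intro closing Tensor_zero) simp
    then show ?thesis using Tensor_zero by blast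
  next
    case False
    then obtain \<epsilon>0 where pos: "\<epsilon>0 > 0" and far: "\<not> (\<exists>h\<in>Tensor i. J h \<le> m + \<epsilon>0 \<and> mean_square h \<le> \<epsilon>0)"
      by blast
    have \<epsilon>0: "\<epsilon>0 < mean_square h" if "h \<in> Tensor i" "J h \<le> m + \<epsilon>0" for h
      using pos far that by (auto simp: not_le)
    define e where "e n = \<epsilon>0 * inverse (real (Suc n))" for n
    have e: "e n > 0" "e n \<le> \<epsilon>0" for n
      using pos by (auto simp: e_def field_simps)
    have e_lim: "e \<longlonglongrightarrow> 0"
      unfolding e_def using tendsto_mult[OF tendsto_const LIMSEQ_inverse_real_of_nat, of \<epsilon>0] by simp
    have "\<exists>h. h \<in> Tensor i \<and> J h < m + e n" for n using near[OF e(1)] by blast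
    then obtain g where g: "\<And>n. g n \<in> Tensor i" "\<And>n. J (g n) < m + e n" by metis
    define Q where "Q = (2 * (m + \<epsilon>0) + 2 * B\<^sup>2 * B) / c"
    define M where "M = 2 * Q + 2 * mean_square (weak_grad f)"
    have "\<exists>v. is_weak_grad (g n) v \<and> mean_square v \<le> M" for n
    proof -
      define w where "w = weak_grad (\<lambda>z. f z + g n z)"
      have w: "is_weak_grad (\<lambda>z. f z + g n z) w" unfolding w_def by (rule sumgrad[OF g(1)])
      then have wsq: "square_integrable w" by (rule is_weak_grad_square_integrable)
      have "energy w \<le> m + \<epsilon>0" using g(2)[of n] e(2)[of n] by (simp add: J_def w_def)
      then have "c * mean_square w \<le> 2 * (m + \<epsilon>0) + 2 * B\<^sup>2 * B" 
        by (intro order_trans[OF energy_coercive[OF wsq]] add_right_mono mult_left_mono) auto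
      then have "mean_square w \<le> Q" unfolding Q_def using c by (simp add: pos_le_divide_eq mult.commute)
      moreover have "mean_square (\<lambda>z. - weak_grad f z) = mean_square (weak_grad f)" by (simp add: mean_square_def)
      moreover have "square_integrable (\<lambda>z. - weak_grad f z)"
        using square_integrable_scaleR[OF fgsq, of "-1"] by simp
      ultimately have "mean_square (\<lambda>z. w z + - weak_grad f z) \<le> M"
        using mean_square_add_le[OF wsq, of "\<lambda>z. - weak_grad f z"] unfolding M_def by simp
      moreover have "is_weak_grad (\<lambda>z. 1 * (f z + g n z) + (-1) * f z) (\<lambda>z. 1 *\<^sub>R w z + (-1) *\<^sub>R weak_grad f z)"
        by (intro is_weak_grad_combination sumsq g fsq w fg)
      ultimately show ?thesis by (intro exI[of _ "\<lambda>z. w z + - weak_grad f z"]) simp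
    qed
    moreover have "\<epsilon>0 \<le> mean_square (g n)" for n
    proof -
      have "J (g n) \<le> m + \<epsilon>0" using g(2)[of n] e(2)[of n] by linarith
      from \<epsilon>0[OF g(1) this] show ?thesis by simp
    qed
    moreover define P where "P n r s \<rho> \<longleftrightarrow> (AE z in torus_measure. g n z = tensor r z) \<and>
        (\<forall>j. Holder_factor (M + M / \<epsilon>0) (r j) (s j) (\<rho> j)) \<and> (LINT t|torus_measure. on_circle1 (r i) t) = 0" for n r s \<rho>
    ultimately have "\<exists>r s \<rho>. P n r s \<rho>" for n
      using Tensor_Holder_factors[OF g(1)] pos unfolding P_def by blast
    then obtain r where "\<And>n. \<exists>s \<rho>. P n (r n) s \<rho>"
      using choice[of "\<lambda>n r. \<exists>s \<rho>. P n r s \<rho>"] by blast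
    then obtain s where "\<And>n. \<exists>\<rho>. P n (r n) (s n) \<rho>"
      using choice[of "\<lambda>n s. \<exists>\<rho>. P n (r n) s \<rho>"] by blast
    then obtain \<rho> where P: "\<And>n. P n (r n) (s n) (\<rho> n)"
      using choice[of "\<lambda>n \<rho>. P n (r n) (s n) \<rho>"] by blast
    have gr: "AE z in torus_measure. g n z = tensor (r n) z"
      and F: "Holder_factor (M + M / \<epsilon>0) (r n j) (s n j) (\<rho> n j)"
      and mean: "(LINT t|torus_measure. on_circle1 (r n i) t) = 0" for n j
      using P[of n] by (simp_all add: P_def)
    obtain h k where k: "strict_mono (k :: nat \<Rightarrow> nat)" and h: "h \<in> Tensor i"
      and conv: "(\<lambda>n. mean_square (\<lambda>z. g (k n) z - h z)) \<longlonglongrightarrow> 0"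
      using Tensor_limit[where g=g and r=r and s=s and \<rho>=\<rho>, OF g(1) F gr mean] by blast
    have "J h \<le> m"
    proof (rule closing[OF h])
      fix \<epsilon> :: real assume \<epsilon>: "\<epsilon> > 0"
      have "(\<lambda>n. e (k n)) \<longlonglongrightarrow> 0" using LIMSEQ_subseq_LIMSEQ[OF e_lim k] by (simp add: o_def)
      then have "\<forall>\<^sub>F n in sequentially. e (k n) < \<epsilon>" using \<epsilon> by (rule order_tendstoD)
      moreover have "\<forall>\<^sub>F n in sequentially. mean_square (\<lambda>z. g (k n) z - h z) < \<epsilon>"
        using conv \<epsilon> by (rule order_tendstoD)
      ultimately have "\<forall>\<^sub>F n in sequentially. e (k n) < \<epsilon> \<and> mean_square (\<lambda>z. g (k n) z - h z) < \<epsilon>"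
        by (rule eventually_conj)
      then obtain n where n: "e (k n) < \<epsilon>" "mean_square (\<lambda>z. g (k n) z - h z) < \<epsilon>"
        by (auto simp: eventually_sequentially)
      then show "\<exists>h'\<in>Tensor i. J h' \<le> m + \<epsilon> \<and> mean_square (\<lambda>z. h' z - h z) \<le> \<epsilon>"
        using g(1)[of "k n"] g(2)[of "k n"] by (intro bexI[of _ "g (k n)"]) auto
    qed
    with h show ?thesis by blast
  qed
  then obtain g where "g \<in> Tensor i" "J g \<le> m" by blast
  then show ?thesis using m_le unfolding J_def by (meson order_trans)
qed

theorem proposition4:
  fixes V :: "(circle ^ 'p::finite) \<times> (circle ^ 'd::finite) \<Rightarrow> real"
    and K :: "(circle ^ 'd) \<times> (circle ^ 'd) \<Rightarrow> real"
    and lam :: real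
    and \<nu> :: "((circle ^ 'p) \<times> (circle ^ 'd)) measure"
    and i :: 'd
    and f :: "circle ^ 'd \<Rightarrow> real"
  assumes "CARD('p) + CARD('d) \<ge> 3"
    and "torus_smooth2 V"
    and "lam \<ge> 0"
    and "torus_smooth2 K"
    and "\<forall>y z. K (y, z) \<ge> 0"
    and "\<forall>y. (LINT z|torus_measure. K (y, z)) = 1"
    and "\<forall>y z. K (y, z) = K (z, y)"
    and "(\<forall>y z. K (y, z) > 0) \<or> lam > 0"
    and "sets \<nu> = sets borel"
    and "prob_space \<nu>"
    and "f \<in> H1_zero_mean"
  shows "\<exists>g\<in>Tensor i. \<forall>h\<in>Tensor i.
    J_functional V K lam \<nu> (\<lambda>z. f z + g z) \<le> J_functional V K lam \<nu> (\<lambda>z. f z + h z)"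
proof -
  define W where "W = (\<lambda>(q, y). torus_grad (\<lambda>y'. V (q, y')) y)"
  have W_cont: "continuous_on UNIV (\<lambda>(x, y). W (to_torus x, to_torus y) $ j)" for j
    using partial_gradient_continuous[OF assms(2)] by (simp add: W_def)
  have K_cont: "continuous_on UNIV (\<lambda>(x, y). K (to_torus x, to_torus y))"
    using assms(4) unfolding torus_smooth2_def by (rule C_infinity_continuous)
  have "\<exists>b. \<forall>p. \<bar>W p $ j\<bar> \<le> b" for j
    using pair_continuous_bounded[of "\<lambda>p. W p $ j", OF W_cont] by blast
  then obtain b where b: "\<And>p j. \<bar>W p $ j\<bar> \<le> b j" by metis
  obtain B0 where B0: "\<And>p. \<bar>K p\<bar> \<le> B0" using pair_continuous_bounded[OF K_cont] by blast
  \<comment> \<open>The sum of the bounds of the components bounds the norm of \<open>W\<close>.\<close>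
  define B where "B = max B0 (\<Sum>j\<in>UNIV. b j)"
  have "\<exists>c>0. \<forall>y z. c \<le> K (y, z) + lam"
  proof (cases "lam > 0")
    case True
    then show ?thesis using assms(5) by (intro exI[of _ lam]) auto
  next
    case False
    then have "\<And>p. 0 < K p" using assms(8) by auto
    then obtain c where "c > 0" "\<And>p. c \<le> K p" using pair_continuous_positive[OF K_cont] by blast
    then show ?thesis using assms(3) by (intro exI[of _ c]) (auto intro: add_increasing2)
  qed
  then obtain c where c: "c > 0" "\<And>y z. c \<le> K (y, z) + lam" by blast
  have fst_m: "fst \<in> borel_measurable (borel :: ((circle ^ 'p) \<times> (circle ^ 'd)) measure)"
    and snd_m: "snd \<in> borel_measurable (borel :: ((circle ^ 'p) \<times> (circle ^ 'd)) measure)"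
    by (intro borel_measurable_continuous_onI continuous_intros)+
  have energy: "gradient_energy W K lam B c \<nu>"
  proof (rule gradient_energy.intro)
    show "prob_space \<nu>" "sets \<nu> = sets borel" "0 \<le> lam" "0 < c" by fact+
    have "(\<lambda>p. W (fst p, snd p) $ j) \<in> borel_measurable borel" for j
      using pair_continuous_measurable[of "\<lambda>p. W p $ j", OF W_cont fst_m snd_m] by simp
    then have "(\<lambda>p. \<chi> j. W p $ j) \<in> borel_measurable borel" by (intro borel_measurable_vec_lambda) simp
    then show "W \<in> borel_measurable borel" by simp
    show "norm (W x) \<le> B" for x
    proof -
      have "norm (W x) \<le> (\<Sum>j\<in>UNIV. \<bar>W x $ j\<bar>)" by (rule norm_le_l1_cart)
      also have "\<dots> \<le> (\<Sum>j\<in>UNIV. b j)" by (intro sum_mono b)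
      finally show ?thesis by (simp add: B_def)
    qed
    show "(\<lambda>(x, z). K (snd x, z)) \<in> borel_measurable (\<nu> \<Otimes>\<^sub>M torus_measure)"
    proof -
      have "snd \<in> \<nu> \<rightarrow>\<^sub>M borel" using snd_m assms(9) by (simp cong: measurable_cong_sets)
      then have 1: "(\<lambda>p. snd (fst p)) \<in> borel_measurable (\<nu> \<Otimes>\<^sub>M torus_measure)"
        by (rule measurable_compose[OF measurable_fst])
      have 2: "snd \<in> borel_measurable (\<nu> \<Otimes>\<^sub>M torus_measure)"
        using measurable_snd[of \<nu> torus_measure] by (simp cong: measurable_cong_sets)
      from pair_continuous_measurable[OF K_cont 1 2] show ?thesis by (simp add: split_beta')
    qed
    show "0 \<le> K (y, z)" for y z using assms(5) by simp
    show "K (y, z) \<le> B" for y z using B0[of "(y, z)"] by (simp add: B_def)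
    show "c \<le> K (y, z) + lam" for y z by (rule c)
  qed
  interpret E: gradient_energy W K lam B c \<nu> by (rule energy)
  have J: "J_functional V K lam \<nu> u = E.energy (weak_grad u)" for u
    unfolding J_functional_def E.energy_def mean_square_def
    by (simp add: W_def split_beta')
  have "f \<in> H1" using assms(11) by (simp add: H1_zero_mean_def)
  from exists_energy_minimizer[OF energy this] show ?thesis unfolding J .
qed

end
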